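(* For every $p_0>2$, letting $q_0$ be defined by $\frac{1}{q_0}+\frac{1}{p_0}=1$, there exists a function $g$ holomorphic on $\mathbb{D}$, continuous on $\overline{\mathbb{D}}$ and without zeros in $\mathbb{D}$ such that, with $\mu=|g|^2$, the weighted Szegő projection $\mathbf{S}_{\mu}$ is bounded on $L^p(\mathbb{T},\mu)$ if and only if $q_0<p<p_0$.
   Context: $\mathbb{D}$ is the unit disc, $\mathbb{T}$ the unit circle with arc-length measure $d\theta$. For $g$ holomorphic on $\mathbb{D}$, continuous on $\overline{\mathbb{D}}$, without zeros in $\mathbb{D}$, set $\mu=|g|^2$. For $1\le p<\infty$, $L^p(\mathbb{T},\mu)$ is the space of measurable $f$ on $\mathbb{T}$ with $\|f\|_{p,\mu}^p=\int_{\mathbb{T}}|f|^p\mu\,d\theta<\infty$, and $\mathcal{H}^p(\mathbb{T},\mu)$ is the space of holomorphic $f$ on $\mathbb{D}$ with $\sup_{0\le r<1}\int_0^{2\pi}|f(re^{i\theta})|^p|g(re^{i\theta})|^2d\theta<\infty$, identified with its (a.e. existing) boundary values, a closed subspace of $L^p(\mathbb{T},\mu)$. The weighted Szegő projection $\mathbf{S}_\mu$ is the orthogonal projection of $L^2(\mathbb{T},\mu)$ onto $\mathcal{H}^2(\mathbb{T},\mu)$; it is given by $\mathbf{S}_\mu f(z)=\int_{\mathbb{T}}S_\mu(z,w)f(w)\mu(w)d\theta$ where $S_\mu(z,w)=\sum_n f_n(z)\overline{f_n(w)}$ for any orthonormal basis $(f_n)$ of $\mathcal{H}^2(\mathbb{T},\mu)$.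 "$\mathbf{S}_\mu$ is bounded on $L^p(\mathbb{T},\mu)$" means there is $C$ with $\|\mathbf{S}_\mu f\|_{p,\mu}\le C\|f\|_{p,\mu}$ for all $f\in L^2(\mathbb{T},\mu)\cap L^p(\mathbb{T},\mu)$. *)

theory Defs
  imports "HOL-Analysis.Analysis"
begin

text \<open>The unit circle is parametrised by \<theta> \<in> [0, 2\<pi>] with arc-length (Lebesgue) measure.
  Functions on the circle are functions f :: complex \<Rightarrow> complex, evaluated at cis \<theta>.\<close>

definition circ_meas :: "real measure" where
  "circ_meas = restrict_space lborel {0..2*pi}"

definition Lp_mu :: "real \<Rightarrow> (complex \<Rightarrow> complex) \<Rightarrow> (complex \<Rightarrow> complex) \<Rightarrow> bool" where
  "Lp_mu p g f \<longleftrightarrow>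
     (\<lambda>\<theta>. f (cis \<theta>)) \<in> borel_measurable circ_meas \<and>
     (\<integral>\<^sup>+ \<theta>. ennreal (cmod (f (cis \<theta>)) powr p * (cmod (g (cis \<theta>)))\<^sup>2) \<partial>circ_meas) < \<infinity>"

text \<open>The norm ||f||_{p,mu} (meaningful for f in L^p(T,mu)).\<close>
definition pnorm_mu :: "real \<Rightarrow> (complex \<Rightarrow> complex) \<Rightarrow> (complex \<Rightarrow> complex) \<Rightarrow> real" where
  "pnorm_mu p g f =
     (enn2real (\<integral>\<^sup>+ \<theta>. ennreal (cmod (f (cis \<theta>)) powr p * (cmod (g (cis \<theta>)))\<^sup>2) \<partial>circ_meas)) powr (1/p)"

definition Hp_mu_hol :: "real \<Rightarrow> (complex \<Rightarrow> complex) \<Rightarrow> (complex \<Rightarrow> complex) \<Rightarrow> bool" where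
  "Hp_mu_hol p g F \<longleftrightarrow> F holomorphic_on ball 0 1 \<and>
     (\<exists>B::real. \<forall>r. 0 \<le> r \<and> r < 1 \<longrightarrow>
        (\<integral>\<^sup>+ \<theta>. ennreal (cmod (F (of_real r * cis \<theta>)) powr p * (cmod (g (of_real r * cis \<theta>)))\<^sup>2) \<partial>circ_meas)
          \<le> ennreal B)"

definition boundary_value :: "(complex \<Rightarrow> complex) \<Rightarrow> (complex \<Rightarrow> complex) \<Rightarrow> bool" where
  "boundary_value F f \<longleftrightarrow>
     (AE \<theta> in circ_meas. ((\<lambda>r. F (of_real r * cis \<theta>)) \<longlongrightarrow> f (cis \<theta>)) (at_left 1))"

definition H2_mu :: "(complex \<Rightarrow> complex) \<Rightarrow> (complex \<Rightarrow> complex) set" where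
  "H2_mu g = {f. Lp_mu 2 g f \<and> (\<exists>F. Hp_mu_hol 2 g F \<and> boundary_value F f)}"

definition is_szego_proj :: "(complex \<Rightarrow> complex) \<Rightarrow> (complex \<Rightarrow> complex) \<Rightarrow> (complex \<Rightarrow> complex) \<Rightarrow> bool" where
  "is_szego_proj g f h \<longleftrightarrow> h \<in> H2_mu g \<and>
     (\<forall>k \<in> H2_mu g. (LINT \<theta>|circ_meas.
        (f (cis \<theta>) - h (cis \<theta>)) * cnj (k (cis \<theta>)) * of_real ((cmod (g (cis \<theta>)))\<^sup>2)) = 0)"

definition szego_bounded :: "real \<Rightarrow> (complex \<Rightarrow> complex) \<Rightarrow> bool" where
  "szego_bounded p g \<longleftrightarrow> (\<exists>C::real. \<forall>f h.
     Lp_mu 2 g f \<and> Lp_mu p g f \<and> is_szego_proj g f h \<longrightarrow>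
       Lp_mu p g h \<and> pnorm_mu p g h \<le> C * pnorm_mu p g f)"

end

theory Submission
  imports Defs "HOL-Complex_Analysis.Complex_Analysis" "HOL-Probability.Probability"
begin

text \<open>Take \<open>g z = (1 - z) powr a\<close> with \<open>a = 1 / (p0 - 2)\<close>. Since \<open>f \<mapsto> f g\<close> maps
  \<open>H\<^sup>2(\<mu>)\<close> onto \<open>H\<^sup>2\<close>, the weighted projection of \<open>f\<close> is \<open>S (f g) / g\<close> with \<open>S\<close> the ordinary
  Szego projection, so it is bounded on \<open>L\<^sup>p(\<mu>)\<close> iff \<open>S\<close> is bounded on \<open>L\<^sup>p\<close> with the power weight
  \<open>\<bar>1 - z\<bar> powr \<alpha>\<close>, \<open>\<alpha> = a (2 - p)\<close>, which happens exactly for \<open>-1 < \<alpha> < p - 1\<close>.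

  Boundedness for \<open>p \<ge> 2\<close>: for even \<open>p = 2k\<close> write the Poisson extension of \<open>u\<close> as \<open>v + cnj w\<close> and
  use that \<open>(v w (1 - z) powr (\<alpha> / k))^k\<close> has mean zero on circles, while its real part controls
  \<open>\<bar>v\<bar> powr p\<close> wherever \<open>v + cnj w\<close> is small. Marcinkiewicz interpolation between \<open>2\<close> and \<open>2k\<close> gives all
  \<open>p \<ge> 2\<close>, duality gives \<open>p < 2\<close>. All bounds are proved on circles of radius \<open>r < 1\<close>, uniformly in \<open>r\<close>,
  and transferred to the boundary by Fatou's lemma.

  Unboundedness: for \<open>p \<ge> p0\<close> the function \<open>(1 - cnj z)^n / g\<close> has projection \<open>1 / g\<close>, which is not in
  \<open>L\<^sup>p(\<mu>)\<close>; for \<open>p \<le> q0\<close> test with \<open>\<bar>q\<bar>\<^sup>2 / g\<close>, where \<open>q\<close> is the partial sum of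
  \<open>\<Sum> z^n / sqrt (n + 1)\<close>, so that \<open>\<bar>q\<bar>\<^sup>2 \<le> 36 / \<bar>1 - z\<bar>\<close> although the mean of \<open>\<bar>q\<bar>\<^sup>2\<close> is a harmonic number.\<close>

subsection \<open>Marcinkiewicz interpolation\<close>

text \<open>The exponent \<alpha> = a (2 - p) of the weight moves with p, so interpolating directly
  between different p would change the measure. Instead \<alpha> is frozen: for -1 < \<alpha> \<le>
  0 the weight is of class A_1, a condition that does not see the exponent, so the bounds at 2 and
  at 2k hold with one and the same weight. For 0 < \<alpha> < p - 1 it is the dual weight, of
  exponent - \<alpha> / (p - 1), that lies in this range; hence the detour through duality, and
  hence the two ends p0 and q0 of a single g are conjugate. On the circle of radius r the weight is
  the modulus of (1 - z) powr \<alpha> at that radius, so that it can be absorbed into a holomorphic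
  function. The price is that every bound carries two weights, one at radius r and one at radius 1.
  The two ends fail differently. At p0 the exponent -1 is not integrable and one function leaves the
  space. The test functions used at q0 have projections that stay in the space, so the growth of
  norms along a sequence has to be compared, and a divergence as slow as that of the harmonic series
  must suffice.\<close>

lemma nn_integral_powr_0:
  assumes "s > (0::real)" "c \<ge> 0"
  shows "(\<integral>\<^sup>+ l. ennreal (if 0 \<le> l \<and> l \<le> c then l powr (s - 1) else 0) \<partial>lborel) = ennreal (c powr s / s)"
proof -
  have "((\<lambda>x. x powr (s - 1)) has_integral (c powr (s - 1 + 1) / (s - 1 + 1))) {0..c}"
    by (rule has_integral_powr_from_0) (use assms in auto)
  from nn_integral_has_integral_lebesgue[OF _ this] have
    "(\<integral>\<^sup>+ l. ennreal (indicator {0..c} l * l powr (s - 1)) \<partial>lborel) = ennreal (c powr s / s)"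
    by simp
  then show ?thesis
    by (subst nn_integral_cong[where v = "\<lambda>l. ennreal (indicator {0..c} l * l powr (s - 1))"])
       (auto simp: indicator_def)
qed

lemma nn_integral_powr_inf:
  assumes "s > (0::real)" "c > 0"
  shows "(\<integral>\<^sup>+ l. ennreal (if c \<le> l then l powr (- s - 1) else 0) \<partial>lborel) = ennreal (c powr (- s) / s)"
proof -
  have "((\<lambda>x. x powr (- s - 1)) has_integral (- (c powr (- s - 1 + 1)) / (- s - 1 + 1))) {c..}"
    by (rule has_integral_powr_to_inf) (use assms in auto)
  from nn_integral_has_integral_lebesgue[OF _ this] have
    "(\<integral>\<^sup>+ l. ennreal (indicator {c..} l * l powr (- s - 1)) \<partial>lborel) = ennreal (c powr (- s) / s)"
    by simp
  then show ?thesis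
    by (subst nn_integral_cong[where v = "\<lambda>l. ennreal (indicator {c..} l * l powr (- s - 1))"])
       (auto simp: indicator_def)
qed

lemma one_le_powr_mult: "1 \<le> l powr (- q) * a powr q" if "0 < l" "l \<le> a" "0 < (q::real)"
proof -
  have "l powr q \<le> a powr q" using that by (intro powr_mono2) auto
  then show ?thesis using that by (simp add: powr_minus field_simps)
qed

text \<open>Strong type at both ends allows a direct argument: cut u at height l, send the large
  part to the p1 bound and the small part to the p2 bound, and integrate over l. The weights on the
  two sides differ because the application has radius r on the left and radius 1 on the
  right.\<close>

lemma marcinkiewicz_interpolation:
  fixes T :: "('a \<Rightarrow> complex) \<Rightarrow> 'a \<Rightarrow> complex"
  assumes sf: "sigma_finite_measure M"
    and Tm: "\<And>u. integrable M u \<Longrightarrow> T u \<in> borel_measurable M"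
    and sub: "\<And>u v t. integrable M u \<Longrightarrow> integrable M v \<Longrightarrow> t \<in> space M \<Longrightarrow>
      cmod (T (\<lambda>t. u t + v t) t) \<le> cmod (T u t) + cmod (T v t)"
    and w1 [measurable]: "w1 \<in> borel_measurable M" and w2 [measurable]: "w2 \<in> borel_measurable M"
    and w0: "\<And>t. 0 \<le> w1 t" "\<And>t. 0 \<le> w2 t"
    and p: "0 < p1" "p1 < p" "p < p2"
    and b1: "\<And>u. integrable M u \<Longrightarrow> (\<integral>\<^sup>+ t. ennreal (cmod (T u t) powr p1 * w2 t) \<partial>M)
      \<le> ennreal A * (\<integral>\<^sup>+ t. ennreal (cmod (u t) powr p1 * w1 t) \<partial>M)"
    and b2: "\<And>u. integrable M u \<Longrightarrow> (\<integral>\<^sup>+ t. ennreal (cmod (T u t) powr p2 * w2 t) \<partial>M)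
      \<le> ennreal B * (\<integral>\<^sup>+ t. ennreal (cmod (u t) powr p2 * w1 t) \<partial>M)"
    and A: "A \<ge> 0" and B: "B \<ge> 0" and u: "integrable M u"
  shows "(\<integral>\<^sup>+ t. ennreal (cmod (T u t) powr p * w2 t) \<partial>M)
    \<le> ennreal (p * 2 powr p * (A / (p - p1) + B / (p2 - p)))
       * (\<integral>\<^sup>+ t. ennreal (cmod (u t) powr p * w1 t) \<partial>M)"
proof -
  interpret sigma_finite_measure M by (rule sf)
  interpret P: pair_sigma_finite M "lborel :: real measure" by unfold_locales
  have [measurable]: "u \<in> borel_measurable M" "T u \<in> borel_measurable M" using u Tm by auto
  \<comment> \<open>Layer cake densities in l. The integral of \<open>g t\<close> is (|T u t| / 2)^p
    / p, the halving paying for the split of u into two pieces; those of \<open>gA t\<close> and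
    \<open>gB t\<close> supply the missing powers p - p1 and p - p2 of |u t|.\<close>
  define g where "g = (\<lambda>t l. if 0 \<le> l \<and> l \<le> cmod (T u t) / 2 then l powr (p - 1) else 0)"
  define gA where "gA = (\<lambda>t l. if 0 \<le> l \<and> l \<le> cmod (u t) then l powr (p - p1 - 1) else 0)"
  define gB where "gB = (\<lambda>t l. if cmod (u t) \<le> l then l powr (- (p2 - p) - 1) else 0)"
  have g0: "0 \<le> g t l" "0 \<le> gA t l" "0 \<le> gB t l" for t l by (auto simp: g_def gA_def gB_def)
  have gm [measurable]: "(\<lambda>x. g (fst x) (snd x)) \<in> borel_measurable (M \<Otimes>\<^sub>M lborel)"
    "(\<lambda>x. gA (fst x) (snd x)) \<in> borel_measurable (M \<Otimes>\<^sub>M lborel)"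
    "(\<lambda>x. gB (fst x) (snd x)) \<in> borel_measurable (M \<Otimes>\<^sub>M lborel)"
    unfolding g_def gA_def gB_def by measurable
  have gm1 [measurable]: "(\<lambda>t. g t l) \<in> borel_measurable M" "(\<lambda>t. gA t l) \<in> borel_measurable M"
    "(\<lambda>t. gB t l) \<in> borel_measurable M" for l
    unfolding g_def gA_def gB_def by measurable
  have gm2 [measurable]: "g t \<in> borel_measurable lborel" "gA t \<in> borel_measurable lborel"
    "gB t \<in> borel_measurable lborel" for t
    unfolding g_def gA_def gB_def by measurable
  let ?U = "\<integral>\<^sup>+ t. ennreal (cmod (u t) powr p * w1 t) \<partial>M"
  have level: "(\<integral>\<^sup>+ t. ennreal (g t l * w2 t) \<partial>M)
     \<le> (\<integral>\<^sup>+ t. ennreal (A * (gA t l * (cmod (u t) powr p1 * w1 t)) + B * (gB t l * (cmod (u t) powr p2 * w1 t))) \<partial>M)" for l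
  proof (cases "l > 0")
    case False
    \<comment> \<open>At l = 0 this rests on the convention \<open>0 powr x = 0\<close>.\<close>
    then have "g t l = 0" for t by (cases "l = 0") (auto simp: g_def)
    then show ?thesis by simp
  next
    case l: True
    \<comment> \<open>Both pieces are dominated by u, so they stay in the domain of integrable
      functions on which T is controlled.\<close>
    define a where "a = (\<lambda>t. if l \<le> cmod (u t) then u t else 0)"
    define b where "b = (\<lambda>t. if l \<le> cmod (u t) then 0 else u t)"
    have [measurable]: "a \<in> borel_measurable M" "b \<in> borel_measurable M"
      unfolding a_def b_def by measurable
    have ia: "integrable M a" and ib: "integrable M b"
      by (rule Bochner_Integration.integrable_bound[OF u]; simp add: a_def b_def)+
    note [measurable] = Tm[OF ia] Tm[OF ib]
    have uab: "u = (\<lambda>t. a t + b t)" by (auto simp: a_def b_def)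
    have "g t l * w2 t \<le> l powr (p - p1 - 1) * (cmod (T a t) powr p1 * w2 t)
        + l powr (- (p2 - p) - 1) * (cmod (T b t) powr p2 * w2 t)" if t: "t \<in> space M" for t
    proof -
      have "g t l \<le> l powr (p - 1) * (l powr (- p1) * cmod (T a t) powr p1 + l powr (- p2) * cmod (T b t) powr p2)"
      proof (cases "0 \<le> l \<and> l \<le> cmod (T u t) / 2")
        case True
        have "cmod (T u t) \<le> cmod (T a t) + cmod (T b t)"
          using sub[OF ia ib t] uab by simp
        with True consider "l \<le> cmod (T a t)" | "l \<le> cmod (T b t)" by linarith
        then have "1 \<le> l powr (- p1) * cmod (T a t) powr p1 + l powr (- p2) * cmod (T b t) powr p2"
        proof cases
          case 1 show ?thesis using one_le_powr_mult[OF l 1, of p1] p by (simp add: add_increasing2)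
        next
          case 2 show ?thesis using one_le_powr_mult[OF l 2, of p2] p by (simp add: add_increasing)
        qed
        then have "l powr (p - 1) * 1 \<le> l powr (p - 1) * (l powr (- p1) * cmod (T a t) powr p1 + l powr (- p2) * cmod (T b t) powr p2)"
          by (intro mult_left_mono) auto
        then show ?thesis using True by (simp add: g_def)
      qed (auto simp: g_def)
      also have "\<dots> = l powr (p - p1 - 1) * cmod (T a t) powr p1 + l powr (- (p2 - p) - 1) * cmod (T b t) powr p2"
      proof -
        have "l powr (p - p1 - 1) = l powr (p - 1) * l powr (- p1)"
          "l powr (- (p2 - p) - 1) = l powr (p - 1) * l powr (- p2)"
          by (simp_all add: algebra_simps flip: powr_add)
        then show ?thesis by (simp add: distrib_left mult.assoc)
      qed
      finally show ?thesis using mult_right_mono[OF _ w0(2)[of t]] by (fastforce simp: algebra_simps)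
    qed
    then have "(\<integral>\<^sup>+ t. ennreal (g t l * w2 t) \<partial>M)
      \<le> (\<integral>\<^sup>+ t. ennreal (l powr (p - p1 - 1)) * ennreal (cmod (T a t) powr p1 * w2 t)
        + ennreal (l powr (- (p2 - p) - 1)) * ennreal (cmod (T b t) powr p2 * w2 t) \<partial>M)"
      by (intro nn_integral_mono) (simp add: w0 flip: ennreal_mult ennreal_plus)
    also have "\<dots> = ennreal (l powr (p - p1 - 1)) * (\<integral>\<^sup>+ t. ennreal (cmod (T a t) powr p1 * w2 t) \<partial>M)
        + ennreal (l powr (- (p2 - p) - 1)) * (\<integral>\<^sup>+ t. ennreal (cmod (T b t) powr p2 * w2 t) \<partial>M)"
      by (simp add: nn_integral_add nn_integral_cmult)
    also have "\<dots> \<le> ennreal (l powr (p - p1 - 1)) * (ennreal A * (\<integral>\<^sup>+ t. ennreal (cmod (a t) powr p1 * w1 t) \<partial>M))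
        + ennreal (l powr (- (p2 - p) - 1)) * (ennreal B * (\<integral>\<^sup>+ t. ennreal (cmod (b t) powr p2 * w1 t) \<partial>M))"
      by (intro add_mono mult_left_mono b1 b2 ia ib) auto
    also have "\<dots> = (\<integral>\<^sup>+ t. ennreal (l powr (p - p1 - 1)) * (ennreal A * ennreal (cmod (a t) powr p1 * w1 t))
        + ennreal (l powr (- (p2 - p) - 1)) * (ennreal B * ennreal (cmod (b t) powr p2 * w1 t)) \<partial>M)"
      by (simp add: nn_integral_add nn_integral_cmult)
    also have "\<dots> \<le> (\<integral>\<^sup>+ t. ennreal (A * (gA t l * (cmod (u t) powr p1 * w1 t)) + B * (gB t l * (cmod (u t) powr p2 * w1 t))) \<partial>M)"
    proof (rule nn_integral_mono)
      fix t
      have "l powr (p - p1 - 1) * (A * (cmod (a t) powr p1 * w1 t)) + l powr (- (p2 - p) - 1) * (B * (cmod (b t) powr p2 * w1 t))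
        \<le> A * (gA t l * (cmod (u t) powr p1 * w1 t)) + B * (gB t l * (cmod (u t) powr p2 * w1 t))"
        using l p A B w0 by (auto simp: gA_def gB_def a_def b_def)
      then show "ennreal (l powr (p - p1 - 1)) * (ennreal A * ennreal (cmod (a t) powr p1 * w1 t))
        + ennreal (l powr (- (p2 - p) - 1)) * (ennreal B * ennreal (cmod (b t) powr p2 * w1 t))
        \<le> ennreal (A * (gA t l * (cmod (u t) powr p1 * w1 t)) + B * (gB t l * (cmod (u t) powr p2 * w1 t)))"
        using w0 A B by (simp add: ennreal_leI flip: ennreal_mult ennreal_plus)
    qed
    finally show ?thesis .
  qed
  define c where "c = p * 2 powr p"
  have c: "c > 0" using p by (simp add: c_def)
  have "(\<integral>\<^sup>+ t. ennreal (cmod (T u t) powr p * w2 t) \<partial>M)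
      = (\<integral>\<^sup>+ t. ennreal c * (\<integral>\<^sup>+ l. ennreal (g t l * w2 t) \<partial>lborel) \<partial>M)"
  proof (rule nn_integral_cong)
    fix t
    have "(\<integral>\<^sup>+ l. ennreal (g t l * w2 t) \<partial>lborel) = (\<integral>\<^sup>+ l. ennreal (g t l) \<partial>lborel) * ennreal (w2 t)"
      using g0 w0 by (simp add: ennreal_mult nn_integral_multc)
    also have "(\<integral>\<^sup>+ l. ennreal (g t l) \<partial>lborel) = ennreal ((cmod (T u t) / 2) powr p / p)"
      unfolding g_def using p by (intro nn_integral_powr_0) auto
    also have "ennreal c * (ennreal ((cmod (T u t) / 2) powr p / p) * ennreal (w2 t))
        = ennreal (c * ((cmod (T u t) / 2) powr p / p * w2 t))"
      using c p w0 by (simp flip: ennreal_mult)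
    also have "c * ((cmod (T u t) / 2) powr p / p * w2 t) = cmod (T u t) powr p * w2 t"
      using p by (simp add: c_def powr_divide)
    finally show "ennreal (cmod (T u t) powr p * w2 t) = ennreal c * (\<integral>\<^sup>+ l. ennreal (g t l * w2 t) \<partial>lborel)"
      by simp
  qed
  also have "\<dots> = ennreal c * (\<integral>\<^sup>+ t. (\<integral>\<^sup>+ l. ennreal (g t l * w2 t) \<partial>lborel) \<partial>M)"
    by (rule nn_integral_cmult) measurable
  also have "(\<integral>\<^sup>+ t. (\<integral>\<^sup>+ l. ennreal (g t l * w2 t) \<partial>lborel) \<partial>M)
      = (\<integral>\<^sup>+ l. (\<integral>\<^sup>+ t. ennreal (g t l * w2 t) \<partial>M) \<partial>lborel)"
    by (rule P.Fubini'[symmetric]) (simp add: split_beta', measurable)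
  also have "\<dots> \<le> (\<integral>\<^sup>+ l. (\<integral>\<^sup>+ t. ennreal (A * (gA t l * (cmod (u t) powr p1 * w1 t))
        + B * (gB t l * (cmod (u t) powr p2 * w1 t))) \<partial>M) \<partial>lborel)"
    by (intro nn_integral_mono level)
  also have "\<dots> = (\<integral>\<^sup>+ t. (\<integral>\<^sup>+ l. ennreal (A * (gA t l * (cmod (u t) powr p1 * w1 t))
        + B * (gB t l * (cmod (u t) powr p2 * w1 t))) \<partial>lborel) \<partial>M)"
    by (rule P.Fubini') (simp add: split_beta', measurable)
  also have "\<dots> \<le> (\<integral>\<^sup>+ t. ennreal (A / (p - p1) + B / (p2 - p)) * ennreal (cmod (u t) powr p * w1 t) \<partial>M)"
  proof (rule nn_integral_mono)
    fix t
    show "(\<integral>\<^sup>+ l. ennreal (A * (gA t l * (cmod (u t) powr p1 * w1 t))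
        + B * (gB t l * (cmod (u t) powr p2 * w1 t))) \<partial>lborel)
      \<le> ennreal (A / (p - p1) + B / (p2 - p)) * ennreal (cmod (u t) powr p * w1 t)"
    \<comment> \<open>For u t = 0 the integral of \<open>gB t\<close> diverges at 0, but the
      integrand then carries the factor 0.\<close>
    proof (cases "u t = 0")
      case False
      then have x: "cmod (u t) > 0" by simp
      have "(\<integral>\<^sup>+ l. ennreal (A * (gA t l * (cmod (u t) powr p1 * w1 t))
        + B * (gB t l * (cmod (u t) powr p2 * w1 t))) \<partial>lborel)
        = (\<integral>\<^sup>+ l. ennreal (A * (cmod (u t) powr p1 * w1 t)) * ennreal (gA t l)
          + ennreal (B * (cmod (u t) powr p2 * w1 t)) * ennreal (gB t l) \<partial>lborel)"
        using A B g0 w0 by (intro nn_integral_cong) (simp add: mult_ac flip: ennreal_mult ennreal_plus)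
      also have "\<dots> = ennreal (A * (cmod (u t) powr p1 * w1 t)) * (\<integral>\<^sup>+ l. ennreal (gA t l) \<partial>lborel)
          + ennreal (B * (cmod (u t) powr p2 * w1 t)) * (\<integral>\<^sup>+ l. ennreal (gB t l) \<partial>lborel)"
        by (simp add: nn_integral_add nn_integral_cmult)
      also have "(\<integral>\<^sup>+ l. ennreal (gA t l) \<partial>lborel) = ennreal (cmod (u t) powr (p - p1) / (p - p1))"
        unfolding gA_def using p by (intro nn_integral_powr_0) auto
      also have "(\<integral>\<^sup>+ l. ennreal (gB t l) \<partial>lborel) = ennreal (cmod (u t) powr (- (p2 - p)) / (p2 - p))"
        unfolding gB_def using p x by (intro nn_integral_powr_inf) auto
      also have "ennreal (A * (cmod (u t) powr p1 * w1 t)) * ennreal (cmod (u t) powr (p - p1) / (p - p1))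
          + ennreal (B * (cmod (u t) powr p2 * w1 t)) * ennreal (cmod (u t) powr (- (p2 - p)) / (p2 - p))
          = ennreal (A * (cmod (u t) powr p1 * w1 t) * (cmod (u t) powr (p - p1) / (p - p1))
            + B * (cmod (u t) powr p2 * w1 t) * (cmod (u t) powr (- (p2 - p)) / (p2 - p)))"
        using A B w0 p by (simp flip: ennreal_mult ennreal_plus)
      also have "A * (cmod (u t) powr p1 * w1 t) * (cmod (u t) powr (p - p1) / (p - p1))
            + B * (cmod (u t) powr p2 * w1 t) * (cmod (u t) powr (- (p2 - p)) / (p2 - p))
          = (A / (p - p1) + B / (p2 - p)) * (cmod (u t) powr p * w1 t)"
      proof -
        have "cmod (u t) powr p = cmod (u t) powr p1 * cmod (u t) powr (p - p1)"
          "cmod (u t) powr p = cmod (u t) powr p2 * cmod (u t) powr (- (p2 - p))"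
          by (simp_all flip: powr_add)
        then show ?thesis by (simp add: distrib_right) (simp add: mult_ac)
      qed
      also have "ennreal \<dots> = ennreal (A / (p - p1) + B / (p2 - p)) * ennreal (cmod (u t) powr p * w1 t)"
        using A B w0 p by (intro ennreal_mult) auto
      finally show ?thesis by simp
    qed simp
  qed
  also have "\<dots> = ennreal (A / (p - p1) + B / (p2 - p)) * ?U"
    by (rule nn_integral_cmult) measurable
  finally have "(\<integral>\<^sup>+ t. ennreal (cmod (T u t) powr p * w2 t) \<partial>M)
    \<le> ennreal c * (ennreal (A / (p - p1) + B / (p2 - p)) * ?U)"
    by (simp add: mult_left_mono)
  also have "\<dots> = ennreal (c * (A / (p - p1) + B / (p2 - p))) * ?U"
    using c A B p by (subst ennreal_mult) (auto simp: mult.assoc)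
  finally show ?thesis by (simp add: c_def)
qed

subsection \<open>Integration over the circle\<close>

lemma space_circ_meas [simp]: "space circ_meas = {0..2*pi}"
  by (simp add: circ_meas_def space_restrict_space)

lemma emeasure_circ_meas: "emeasure circ_meas (space circ_meas) = ennreal (2*pi)"
  by (simp add: circ_meas_def space_restrict_space emeasure_restrict_space)

lemma finite_measure_circ_meas: "finite_measure circ_meas"
  by (rule finite_measureI) (simp add: emeasure_circ_meas del: space_circ_meas)

interpretation circ: finite_measure circ_meas
  by (rule finite_measure_circ_meas)

interpretation circ_pair: pair_sigma_finite circ_meas circ_meas
  by unfold_locales

lemma measure_circ_meas [simp]: "measure circ_meas {0..2*pi} = 2*pi"
  using emeasure_circ_meas by (simp add: measure_def)

lemma measurable_circ_meas_borel [measurable (raw)]: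
  "f \<in> borel_measurable borel \<Longrightarrow> f \<in> borel_measurable circ_meas"
  unfolding circ_meas_def by (rule measurable_restrict_space1) simp

lemma measurable_ident_circ_meas [measurable]: "(\<lambda>t. t) \<in> borel_measurable circ_meas"
  by (rule measurable_circ_meas_borel) simp

lemma circ_meas_integrable_continuous:
  fixes f :: "real \<Rightarrow> 'a::{banach, second_countable_topology}"
  assumes "continuous_on {0..2*pi} f"
  shows "integrable circ_meas f"
  using borel_integrable_atLeastAtMost'[OF assms]
  by (simp add: circ_meas_def integrable_restrict_space set_integrable_def)

lemma circ_meas_has_integral:
  fixes f :: "real \<Rightarrow> complex"
  assumes "continuous_on {0..2*pi} f"
  shows "(f has_integral (LINT t|circ_meas. f t)) {0..2*pi}"
proof -
  note I = borel_integrable_atLeastAtMost'[OF assms]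
  have "(LINT t|circ_meas. f t) = (LINT t:{0..2*pi}|lborel. f t)"
    by (simp add: circ_meas_def integral_restrict_space set_lebesgue_integral_def)
  with set_borel_integral_eq_integral[OF I] show ?thesis
    by (metis has_integral_integral)
qed

text \<open>Both ends of the parameter interval are the point 1, the only point of the circle where
  g vanishes and where quotients by g take the default value 0.\<close>

lemma AE_circ_meas_cis: "AE t in circ_meas. cis t \<noteq> 1"
proof -
  have *: "t = 0 \<or> t = 2*pi" if c: "cis t = 1" "0 \<le> t" "t \<le> 2*pi" for t
  proof -
    have "cos t = 1" using c(1) by (metis cis.sel(1) one_complex.sel(1))
    then obtain n :: int where n: "t = of_int n * 2 * pi"
      unfolding cos_one_2pi_int by blast
    have "0 \<le> real_of_int n * (2*pi)" using n c(2) by (simp add: mult_ac)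
    then have "0 \<le> n" using pi_gt_zero by (simp add: zero_le_mult_iff)
    moreover have "n \<le> 1"
    proof -
      have "real_of_int n * (2*pi) \<le> 1 * (2*pi)" using n c(3) by (simp add: mult_ac)
      then have "real_of_int n \<le> 1" using pi_gt_zero by (subst (asm) mult_le_cancel_right_pos) auto
      then show ?thesis by simp
    qed
    ultimately have "n = 0 \<or> n = 1" by linarith
    then show ?thesis using n by auto
  qed
  have "AE t in lborel. t \<noteq> 0 \<and> t \<noteq> 2*pi"
    using AE_lborel_singleton[of "0::real"] AE_lborel_singleton[of "2*pi"] by eventually_elim auto
  then have "AE t in lborel. t \<in> {0..2*pi} \<longrightarrow> cis t \<noteq> 1"
    by eventually_elim (use * in auto)
  then show ?thesis
    unfolding circ_meas_def by (subst AE_restrict_space_iff) auto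
qed

lemma one_minus_mult_ne_zero: "1 - a * w \<noteq> (0::complex)" if "cmod a < 1" "cmod w \<le> 1"
proof
  assume "1 - a * w = 0"
  then have "cmod a * cmod w = 1" by (metis norm_mult norm_one eq_iff_diff_eq_0)
  moreover have "cmod a * cmod w \<le> cmod a * 1" using that by (intro mult_left_mono) auto
  ultimately show False using that by simp
qed

text \<open>With dw = i w dt on the circle, the Cauchy kernel dw / (i (w - a)) turns into dt / (1 -
  a cnj w), the Szego kernel.\<close>

lemma Cauchy_circ_meas:
  fixes F :: "complex \<Rightarrow> complex"
  assumes contF: "continuous_on (cball 0 1) F" and holF: "F holomorphic_on ball 0 1" and a: "cmod a < 1"
  shows "integrable circ_meas (\<lambda>t. F (cis t) / (1 - a * cis (- t)))"
    "(LINT t|circ_meas. F (cis t) / (1 - a * cis (- t))) = 2 * pi * F a"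
proof -
  let ?f = "\<lambda>t. F (cis t) / (1 - a * cis (- t))"
  have cont: "continuous_on {0..2*pi} ?f"
  proof -
    have "continuous_on {0..2*pi} (\<lambda>t. F (cis t))"
      by (rule continuous_on_compose2[OF contF]) (auto intro!: continuous_intros)
    then show ?thesis
      by (intro continuous_intros) (use one_minus_mult_ne_zero[OF a] in auto)
  qed
  then show "integrable circ_meas ?f" by (rule circ_meas_integrable_continuous)
  have "((\<lambda>u. F u/(u-a)) has_contour_integral (2 * of_real pi * \<i> * F a)) (circlepath 0 1)"
    by (rule Cauchy_integral_circlepath) (use assms in auto)
  then have "((\<lambda>t. F (cis t) / (cis t - a) * \<i> * cis t) has_integral (2 * of_real pi * \<i> * F a)) {0..2*pi}"
    unfolding circlepath_def by (subst (asm) has_contour_integral_part_circlepath_iff) auto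
  then have "((\<lambda>t. F (cis t) / (cis t - a) * \<i> * cis t * (-\<i>)) has_integral (2 * of_real pi * \<i> * F a * (-\<i>))) {0..2*pi}"
    by (rule has_integral_mult_left)
  also have "(\<lambda>t. F (cis t) / (cis t - a) * \<i> * cis t * (-\<i>)) = ?f"
  proof
    fix t
    have "cis t - a = cis t * (1 - a * cis (-t))"
      by (simp add: algebra_simps cis_mult)
    then show "F (cis t) / (cis t - a) * \<i> * cis t * (-\<i>) = ?f t"
      by (simp add: divide_simps mult.assoc)
  qed
  finally have "(?f has_integral (2 * pi * F a)) {0..2*pi}" by (simp add: mult_ac)
  with circ_meas_has_integral[OF cont] show "(LINT t|circ_meas. ?f t) = 2 * pi * F a"
    by (rule has_integral_unique)
qed

corollary mean_value_circ_meas: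
  fixes F :: "complex \<Rightarrow> complex"
  assumes "continuous_on (cball 0 1) F" "F holomorphic_on ball 0 1"
  shows "integrable circ_meas (\<lambda>t. F (cis t))" "(LINT t|circ_meas. F (cis t)) = 2 * pi * F 0"
  using Cauchy_circ_meas[OF assms, of 0] by simp_all

subsection \<open>Cauchy and Poisson integrals\<close>

text \<open>The Cauchy-Szego integral of a function of the angle, to be evaluated only inside the
  disc; the projection on the circle is recovered from it by radial limits.\<close>

definition szego :: "(real \<Rightarrow> complex) \<Rightarrow> complex \<Rightarrow> complex" where
  "szego u z = (LINT t|circ_meas. u t / (1 - z * cis (- t))) / (2 * pi)"

text \<open>This is the Poisson kernel (1 - |z|^2) / |1 - z cnj w|^2 at w = cis t. Written through
  the Cauchy kernel, it splits at once into an analytic and a coanalytic part.\<close>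

definition pker :: "complex \<Rightarrow> real \<Rightarrow> real" where
  "pker z t = 2 * Re (1 / (1 - z * cis (- t))) - 1"

lemma cmod_one_minus_ge: "1 - r \<le> cmod (1 - z * w)" if "cmod z \<le> r" "cmod w \<le> 1"
proof -
  have "cmod z * cmod w \<le> r * 1" using that order_trans[OF norm_ge_zero that(1)] by (intro mult_mono) auto
  then have "cmod (z * w) \<le> r" by (simp add: norm_mult)
  with norm_triangle_ineq2[of 1 "z * w"] show ?thesis by simp
qed

lemma cauchy_kernel_bound: "cmod (1 / (1 - z * cis (- t))) \<le> 1 / (1 - r)" if "cmod z \<le> r" "r < 1"
  using cmod_one_minus_ge[OF that(1), of "cis (-t)"] that by (simp add: norm_divide divide_simps)

lemma measurable_kernel [measurable]: "(\<lambda>t. 1 / (1 - z * cis (- t))) \<in> borel_measurable circ_meas" 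
  by (intro measurable_circ_meas_borel borel_measurable_divide borel_measurable_const borel_measurable_diff
      borel_measurable_times borel_measurable_continuous_onI continuous_intros)

lemma pker_bounds:
  assumes "cmod z \<le> r" "r < 1"
  shows "0 \<le> pker z t" "pker z t \<le> 2 / (1 - r)"
proof -
  define x where "x = z * cis (-t)"
  have x: "cmod x < 1" using assms by (simp add: x_def norm_mult)
  then have ne: "1 - x \<noteq> 0" by auto
  have "(cmod x)\<^sup>2 \<le> 1" using x by (simp add: power_le_one)
  then have "(cmod (1 - x))\<^sup>2 \<le> 2 * Re (1 - x)"
    unfolding cmod_power2 by (simp add: power2_eq_square algebra_simps)
  then have "1 \<le> 2 * (Re (1 - x) / (cmod (1 - x))\<^sup>2)"
    using ne by (simp add: field_simps)
  also have "Re (1 - x) / (cmod (1 - x))\<^sup>2 = Re (1 / (1 - x))"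
    by (simp add: Re_divide cmod_power2)
  finally show "0 \<le> pker z t" by (simp add: pker_def x_def)
  have "Re (1 / (1 - z * cis (- t))) \<le> 1 / (1 - r)"
    using complex_Re_le_cmod cauchy_kernel_bound[OF assms] by (meson order_trans)
  then show "pker z t \<le> 2 / (1 - r)" by (simp add: pker_def)
qed

lemma measurable_pker [measurable]: "pker z \<in> borel_measurable circ_meas"
  unfolding pker_def[abs_def] using measurable_kernel by measurable

lemma integrable_szego_kernel:
  assumes "integrable circ_meas u" "cmod z < 1"
  shows "integrable circ_meas (\<lambda>t. u t / (1 - z * cis (- t)))"
proof (rule Bochner_Integration.integrable_bound)
  show "integrable circ_meas (\<lambda>t. u t * of_real (1 / (1 - cmod z)))"
    using assms(1) by (rule integrable_mult_left)
  have "(\<lambda>t. u t * (1 / (1 - z * cis (- t)))) \<in> borel_measurable circ_meas"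
    using assms(1) measurable_kernel by measurable
  then show "(\<lambda>t. u t / (1 - z * cis (- t))) \<in> borel_measurable circ_meas" by simp
  show "AE t in circ_meas. cmod (u t / (1 - z * cis (- t))) \<le> cmod (u t * of_real (1 / (1 - cmod z)))"
  proof (rule AE_I2)
    fix t
    have "cmod (u t) * cmod (1 / (1 - z * cis (- t))) \<le> cmod (u t) * (1 / (1 - cmod z))"
      by (intro mult_left_mono cauchy_kernel_bound) (use assms in auto)
    then show "cmod (u t / (1 - z * cis (- t))) \<le> cmod (u t * of_real (1 / (1 - cmod z)))"
      using assms(2) by (simp only: norm_divide norm_mult norm_of_real) simp
  qed
qed

text \<open>The geometric series of the kernel integrates term by term to a power series whose
  coefficients are the Fourier coefficients of u of nonnegative index.\<close>

lemma szego_holomorphic: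
  assumes u: "integrable circ_meas u"
  shows "szego u holomorphic_on ball 0 1"
proof (rule power_series_holomorphic)
  fix z :: complex assume "z \<in> ball 0 1"
  then have z: "cmod z < 1" by simp
  let ?f = "\<lambda>n t. u t * cis (- t) ^ n * z ^ n"
  have um[measurable]: "u \<in> borel_measurable circ_meas" using u by simp
  have cm: "(\<lambda>t. cis (- t)) \<in> borel_measurable circ_meas"
    by (intro measurable_circ_meas_borel borel_measurable_continuous_onI continuous_intros)
  have nf: "norm (?f n t) = cmod (u t) * cmod z ^ n" for n t
    by (simp add: norm_mult norm_power)
  have i: "integrable circ_meas (?f n)" for n
  proof (rule Bochner_Integration.integrable_bound)
    show "integrable circ_meas (\<lambda>t. u t * z ^ n)" using u by simp
    show "?f n \<in> borel_measurable circ_meas" using um cm by measurable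
  qed (simp add: norm_mult norm_power)
  have sn: "summable (\<lambda>n. cmod (u t) * cmod z ^ n)" for t
    using z by (intro summable_mult summable_geometric) simp
  have "(\<lambda>n. LINT t|circ_meas. ?f n t) sums (LINT t|circ_meas. (\<Sum>n. ?f n t))"
  proof (rule sums_integral[OF i])
    show "AE t in circ_meas. summable (\<lambda>n. norm (?f n t))"
      using sn by (simp add: nf)
    show "summable (\<lambda>n. LINT t|circ_meas. norm (?f n t))"
      using z u by (simp add: nf summable_mult summable_geometric)
  qed
  also have "(\<lambda>t. \<Sum>n. ?f n t) = (\<lambda>t. u t / (1 - z * cis (- t)))"
  proof
    fix t
    have "cmod (z * cis (-t)) < 1" using z by (simp add: norm_mult)
    then have "(\<lambda>n. u t * (z * cis (-t)) ^ n) sums (u t * (1 / (1 - z * cis (- t))))"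
      by (intro sums_mult geometric_sums)
    then show "(\<Sum>n. ?f n t) = u t / (1 - z * cis (- t))"
      by (simp add: sums_iff power_mult_distrib mult_ac)
  qed
  finally have "(\<lambda>n. (LINT t|circ_meas. ?f n t) / (2 * pi)) sums szego u z"
    unfolding szego_def by (rule sums_divide)
  then show "(\<lambda>n. (LINT t|circ_meas. u t * cis (- t) ^ n) / (2 * pi) * (z - 0) ^ n) sums szego u z"
    by (simp add: power_mult_distrib)
qed

text \<open>The kernel is k + cnj k - 1 with k the Cauchy kernel. The constant -1 is absorbed by
  making the coanalytic part vanish at 0, which later gives a product with mean zero.\<close>

lemma szego_poisson:
  assumes u: "integrable circ_meas u" and z: "cmod z < 1"
  shows "szego u z + cnj (szego (\<lambda>t. cnj (u t)) z - szego (\<lambda>t. cnj (u t)) 0)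
       = (LINT t|circ_meas. of_real (pker z t) * u t) / (2 * pi)"
proof -
  have cu: "integrable circ_meas (\<lambda>t. cnj (u t))" using u by simp
  have k: "of_real (pker z t) * u t
      = u t / (1 - z * cis (- t)) + cnj (cnj (u t) / (1 - z * cis (- t)) - cnj (u t) / (1 - 0 * cis (- t)))" for t
  proof -
    have "of_real (pker z t) = 1 / (1 - z * cis (- t)) + cnj (1 / (1 - z * cis (- t))) - 1"
      unfolding pker_def by (simp only: complex_add_cnj of_real_diff of_real_1)
    then show ?thesis by (simp only: complex_cnj_diff complex_cnj_divide complex_cnj_cnj) (simp add: algebra_simps)
  qed
  note i = integrable_szego_kernel[OF u z] integrable_szego_kernel[OF cu z] integrable_szego_kernel[OF cu, of 0, simplified norm_zero, OF zero_less_one]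
  have "(LINT t|circ_meas. of_real (pker z t) * u t)
     = (LINT t|circ_meas. u t / (1 - z * cis (- t))) + cnj ((LINT t|circ_meas. cnj (u t) / (1 - z * cis (- t)))
        - (LINT t|circ_meas. cnj (u t) / (1 - 0 * cis (- t))))"
  proof -
    have "(LINT t|circ_meas. of_real (pker z t) * u t)
       = (LINT t|circ_meas. u t / (1 - z * cis (- t)))
       + (LINT t|circ_meas. cnj (cnj (u t) / (1 - z * cis (- t)) - cnj (u t) / (1 - 0 * cis (- t))))"
      unfolding k
      by (rule Bochner_Integration.integral_add[OF i(1)], rule integrable_cnj,
          rule Bochner_Integration.integrable_diff[OF i(2) i(3)])
    also have "(LINT t|circ_meas. cnj (cnj (u t) / (1 - z * cis (- t)) - cnj (u t) / (1 - 0 * cis (- t))))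
       = cnj (LINT t|circ_meas. cnj (u t) / (1 - z * cis (- t)) - cnj (u t) / (1 - 0 * cis (- t)))"
      by (rule Bochner_Integration.integral_cnj)
    also have "(LINT t|circ_meas. cnj (u t) / (1 - z * cis (- t)) - cnj (u t) / (1 - 0 * cis (- t)))
       = (LINT t|circ_meas. cnj (u t) / (1 - z * cis (- t))) - (LINT t|circ_meas. cnj (u t) / (1 - 0 * cis (- t)))"
      by (rule Bochner_Integration.integral_diff[OF i(2) i(3)])
    finally show ?thesis .
  qed
  then show ?thesis
    unfolding szego_def by (simp add: add_divide_distrib diff_divide_distrib)
qed

subsection \<open>Power weights\<close>

text \<open>For 0 \<le> r < 1 this is continuous and positive whatever \<alpha> is, so integrals at
  such radii cause no trouble; r = 1 is the true weight, with the default value 0 at the point 1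
  even for negative \<alpha>.\<close>

definition wt :: "real \<Rightarrow> real \<Rightarrow> real \<Rightarrow> real" where
  "wt \<alpha> r t = cmod (1 - of_real r * cis t) powr \<alpha>"

lemma wt_nonneg [simp]: "0 \<le> wt \<alpha> r t"
  by (simp add: wt_def)

lemma measurable_wt [measurable]: "wt \<alpha> r \<in> borel_measurable circ_meas"
  unfolding wt_def[abs_def]
  by (rule measurable_circ_meas_borel) 
   (intro powr_real_measurable borel_measurable_const borel_measurable_continuous_onI continuous_intros)

lemma Re_one_minus_pos: "0 < Re (1 - of_real r * z)" if "0 \<le> r" "r < 1" "cmod z \<le> 1"
proof -
  have "Re (of_real r * z) \<le> cmod (of_real r * z)" by (rule complex_Re_le_cmod)
  also have "\<dots> \<le> r * 1" using that by (simp add: norm_mult mult_left_le)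
  finally show ?thesis using that by simp
qed

lemma one_minus_of_real_ne_zero: "1 - of_real r * z \<noteq> 0" if "0 \<le> r" "r < 1" "cmod z \<le> 1"
  using Re_one_minus_pos[OF that] by (metis less_irrefl zero_complex.sel(1))

lemma wt_pos: "0 < wt \<alpha> r t" if "0 \<le> r" "r < 1"
proof -
  have "1 - of_real r * cis t \<noteq> 0"
    using Re_one_minus_pos[OF that, of "cis t"] by (metis norm_cis order_refl less_irrefl zero_complex.sel(1))
  then show ?thesis by (simp add: wt_def)
qed

text \<open>On the right half plane the argument of z is below pi / 2 in modulus, so that of the
  power stays within |\<alpha>| pi / 2, where the cosine is decreasing in the modulus.\<close>

lemma cos_powr_le_Re_powr:
  assumes "0 < Re z" "\<bar>\<alpha>\<bar> \<le> 1"
  shows "cos (\<alpha> * pi / 2) * cmod z powr \<alpha> \<le> Re (z powr of_real \<alpha>)"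
proof -
  have z: "z \<noteq> 0" using assms(1) by auto
  define y where "y = \<alpha> * Im (Ln z)"
  have "\<bar>y\<bar> \<le> \<bar>\<alpha>\<bar> * (pi / 2)" unfolding y_def abs_mult
    using Re_Ln_pos_lt_imp[OF assms(1)] by (intro mult_left_mono) auto
  moreover have "\<bar>\<alpha>\<bar> * (pi / 2) \<le> pi" using mult_right_mono[OF assms(2), of "pi/2"] by simp
  ultimately have "cos (\<bar>\<alpha>\<bar> * (pi / 2)) \<le> cos \<bar>y\<bar>" by (intro cos_monotone_0_pi_le) auto
  moreover have "cos (\<bar>\<alpha>\<bar> * (pi / 2)) = cos (\<alpha> * pi / 2)" by (cases "\<alpha> \<ge> 0") auto
  moreover have "Re (z powr of_real \<alpha>) = cmod z powr \<alpha> * cos y"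
    using z by (simp add: powr_def Re_exp y_def)
  ultimately show ?thesis
    by (metis cos_abs_real mult.commute mult_left_mono powr_ge_zero)
qed

lemma cos_half_pos: "0 < cos (\<alpha> * pi / 2)" if "\<bar>\<alpha>\<bar> < 1"
proof (rule cos_gt_zero_pi)
  have "\<bar>\<alpha>\<bar> * pi < 1 * pi" using that by (intro mult_strict_right_mono) auto
  then have "\<bar>\<alpha> * pi\<bar> < pi" by (simp add: abs_mult)
  then show "- (pi / 2) < \<alpha> * pi / 2" "\<alpha> * pi / 2 < pi / 2" by linarith+
qed

text \<open>The coanalytic half of \<open>szego_poisson\<close> drops out: the Cauchy integral of
  cnj F is constant, by the mean value property of F w / (1 - cnj z w).\<close>

lemma poisson_holomorphic:
  fixes F :: "complex \<Rightarrow> complex"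
  assumes contF: "continuous_on (cball 0 1) F" and holF: "F holomorphic_on ball 0 1" and a: "cmod a < 1"
  shows "(LINT t|circ_meas. of_real (pker a t) * F (cis t)) = 2 * pi * F a"
proof -
  note i = mean_value_circ_meas(1)[OF contF holF]
  have "szego (\<lambda>t. cnj (F (cis t))) z = cnj (F 0)" if z: "cmod z < 1" for z
  proof -
    have nz: "1 - cnj z * w \<noteq> 0" if "cmod w \<le> 1" for w
      using one_minus_mult_ne_zero[of "cnj z" w] z that by simp
    have "(LINT t|circ_meas. cnj (F (cis t)) / (1 - z * cis (- t)))
       = (LINT t|circ_meas. cnj (F (cis t) / (1 - cnj z * cis t)))"
      by (simp add: cis_cnj)
    also have "\<dots> = cnj (LINT t|circ_meas. F (cis t) / (1 - cnj z * cis t))"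
      by (rule Bochner_Integration.integral_cnj)
    also have "(LINT t|circ_meas. F (cis t) / (1 - cnj z * cis t)) = 2 * pi * (F 0 / (1 - cnj z * 0))"
      by (rule mean_value_circ_meas(2)[of "\<lambda>w. F w / (1 - cnj z * w)"])
         (use nz in \<open>auto intro!: continuous_intros holomorphic_intros contF holF\<close>)
    finally show ?thesis by (simp add: szego_def)
  qed
  moreover have "szego (\<lambda>t. F (cis t)) a = F a"
    unfolding szego_def Cauchy_circ_meas(2)[OF contF holF a] by simp
  ultimately have "F a = (LINT t|circ_meas. of_real (pker a t) * F (cis t)) / (2 * pi)"
    using szego_poisson[OF i a] a by simp
  then show ?thesis by simp
qed

section \<open>Poisson averages of power weights\<close>

lemma integrable_pker_mult:
  fixes f :: "real \<Rightarrow> 'a::{real_normed_field, second_countable_topology, banach}"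
  assumes "integrable circ_meas f" "cmod z < 1"
  shows "integrable circ_meas (\<lambda>t. of_real (pker z t) * f t)"
proof (rule Bochner_Integration.integrable_bound)
  show "integrable circ_meas (\<lambda>t. of_real (2 / (1 - cmod z)) * f t)"
    using assms(1) by (rule integrable_mult_right)
  show "(\<lambda>t. of_real (pker z t) * f t) \<in> borel_measurable circ_meas"
    using assms(1) by measurable
  show "AE t in circ_meas. norm (of_real (pker z t) * f t) \<le> norm (of_real (2 / (1 - cmod z)) * f t)"
  proof (rule AE_I2)
    fix t
    have "\<bar>pker z t\<bar> \<le> \<bar>2 / (1 - cmod z)\<bar>" using pker_bounds[OF order_refl assms(2), of t] by linarith
    then show "norm (of_real (pker z t) * f t) \<le> norm (of_real (2 / (1 - cmod z)) * f t)"
      unfolding norm_mult norm_of_real by (rule mult_right_mono) simp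
  qed
qed

lemma poisson_one: "(LINT t|circ_meas. pker z t) = 2 * pi" if "cmod z < 1"
proof -
  have "complex_of_real (LINT t|circ_meas. pker z t) = 2 * pi"
    using poisson_holomorphic[of "\<lambda>_. 1" z] that by (simp flip: integral_complex_of_real)
  then show ?thesis using of_real_eq_iff by blast
qed

text \<open>Replacing z by \<rho> z moves the point by 1 - \<rho>, which is itself at most |1 -
  \<rho> z|; hence the factor 2, uniform up to \<rho> = 1.\<close>

lemma cmod_one_minus_le: "cmod (1 - z) \<le> 2 * cmod (1 - of_real \<rho> * z)" if "0 \<le> \<rho>" "\<rho> \<le> 1" "cmod z = 1"
proof -
  have "1 - \<rho> \<le> cmod (1 - of_real \<rho> * z)"
    using cmod_one_minus_ge[of "of_real \<rho>" \<rho> z] that by simp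
  moreover have "cmod (1 - z) \<le> cmod (1 - of_real \<rho> * z) + cmod (of_real (1 - \<rho>) * z)"
    by (rule order_trans[OF _ norm_triangle_ineq4]) (simp add: algebra_simps)
  moreover have "cmod (of_real (1 - \<rho>) * z) = 1 - \<rho>" using that unfolding norm_mult norm_of_real by simp
  ultimately show ?thesis by simp
qed

lemma wt_integrable:
  assumes "0 \<le> r" "r < 1" shows "integrable circ_meas (wt \<alpha> r)"
  unfolding wt_def[abs_def]
  by (intro circ_meas_integrable_continuous continuous_intros)
     (metis norm_eq_zero one_minus_of_real_ne_zero[OF assms] norm_cis order_refl)

text \<open>The weight \<open>|1 - z| powr \<alpha>\<close> is an \<open>A\<^sub>1\<close> weight because it is comparable to the positive
  harmonic function \<open>Re ((1 - z) powr \<alpha>)\<close>.\<close>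

lemma poisson_wt_bound:
  assumes al: "-1 < \<alpha>" "\<alpha> \<le> 0" and r: "0 \<le> r" "r < 1" and s: "cis s \<noteq> 1"
  shows "(LINT t|circ_meas. pker (r * cis s) t * wt \<alpha> r t)
    \<le> 2 * pi * 2 powr (- \<alpha>) / cos (\<alpha> * pi / 2) * wt \<alpha> 1 s"
proof -
  define d where "d = cos (\<alpha> * pi / 2)"
  have d: "d > 0" unfolding d_def using al by (intro cos_half_pos) auto
  define F :: "complex \<Rightarrow> complex" where "F = (\<lambda>z. (1 - of_real r * z) powr of_real \<alpha>)"
  have np: "1 - of_real r * z \<notin> \<real>\<^sub>\<le>\<^sub>0" if "cmod z \<le> 1" for z
    using Re_one_minus_pos[OF r that] by (auto simp: complex_nonpos_Reals_iff)
  have F: "continuous_on (cball 0 1) F" "F holomorphic_on ball 0 1"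
    unfolding F_def using np
    by (auto intro!: holomorphic_on_imp_continuous_on holomorphic_intros simp del: complex_nonpos_Reals_iff)
  have a: "cmod (r * cis s) < 1" using r by (simp add: norm_mult)
  note iF = mean_value_circ_meas(1)[OF F]
  have "(LINT t|circ_meas. pker (r * cis s) t * (d * wt \<alpha> r t))
      \<le> (LINT t|circ_meas. pker (r * cis s) t * Re (F (cis t)))"
  proof (rule integral_mono)
    show "integrable circ_meas (\<lambda>t. pker (r * cis s) t * (d * wt \<alpha> r t))"
      using integrable_pker_mult[OF integrable_mult_right[OF wt_integrable[OF r]] a] by simp
    show "integrable circ_meas (\<lambda>t. pker (r * cis s) t * Re (F (cis t)))"
      using integrable_pker_mult[OF integrable_Re[OF iF] a] by simp
    show "pker (r * cis s) t * (d * wt \<alpha> r t) \<le> pker (r * cis s) t * Re (F (cis t))" for t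
      unfolding d_def wt_def F_def
      by (intro mult_left_mono cos_powr_le_Re_powr Re_one_minus_pos pker_bounds[OF order_refl a])
         (use al r in auto)
  qed
  also have "\<dots> = Re (LINT t|circ_meas. of_real (pker (r * cis s) t) * F (cis t))"
    using integrable_pker_mult[OF iF a] by (simp flip: integral_Re)
  also have "\<dots> = 2 * pi * Re (F (r * cis s))"
    using poisson_holomorphic[OF F a] by (simp add: Re_divide)
  \<comment> \<open>F already contains one factor r and is evaluated at r cis s, so the radius
    becomes r^2. Since \<alpha> \<le> 0, the comparison of distances with radius 1 reverses under
    the power and costs 2 powr (- \<alpha>).\<close>
  also have "\<dots> \<le> 2 * pi * (cmod (1 - of_real (r * r) * cis s) powr \<alpha>)"
    by (intro mult_left_mono order_trans[OF complex_Re_le_cmod])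
       (auto simp: F_def norm_powr_real_powr' mult.assoc)
  also have "\<dots> \<le> 2 * pi * (2 powr (- \<alpha>) * wt \<alpha> 1 s)"
  proof (intro mult_left_mono)
    have "cmod (1 - cis s) \<le> 2 * cmod (1 - of_real (r * r) * cis s)"
      by (rule cmod_one_minus_le) (use r in \<open>auto simp: mult_le_one\<close>)
    then have "(2 * cmod (1 - of_real (r * r) * cis s)) powr \<alpha> \<le> cmod (1 - cis s) powr \<alpha>"
      using s al by (intro powr_mono2') auto
    then show "cmod (1 - of_real (r * r) * cis s) powr \<alpha> \<le> 2 powr (- \<alpha>) * wt \<alpha> 1 s"
      by (simp add: wt_def powr_mult powr_minus field_simps)
  qed auto
  finally have "d * (LINT t|circ_meas. pker (r * cis s) t * wt \<alpha> r t) \<le> 2 * pi * (2 powr (- \<alpha>) * wt \<alpha> 1 s)"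
    by (simp add: mult.left_commute)
  then show ?thesis using d unfolding d_def by (simp add: field_simps)
qed

text \<open>After Fubini the average runs over the evaluation point; the symmetry turns it back into
  a Poisson integral.\<close>

lemma pker_sym: "pker (of_real r * cis s) t = pker (of_real r * cis t) s"
proof -
  have "of_real r * cis s * cis (- t) = cnj (of_real r * cis t * cis (- s))"
    by (simp add: cis_cnj mult_ac)
  then have "1 / (1 - of_real r * cis s * cis (- t)) = cnj (1 / (1 - of_real r * cis t * cis (- s)))"
    by (simp only: complex_cnj_divide complex_cnj_diff complex_cnj_one)
  then show ?thesis unfolding pker_def by (simp only: cnj.sel(1))
qed

text \<open>The Poisson kernel divided by 2 pi is a probability density, and an even power is convex
  on the whole line, so Jensen's inequality applies to |u|.\<close>

lemma poisson_jensen: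
  assumes u: "integrable circ_meas u" and un: "integrable circ_meas (\<lambda>t. cmod (u t) ^ n)"
    and n: "even n" and z: "cmod z < 1"
  shows "cmod ((LINT t|circ_meas. of_real (pker z t) * u t) / (2 * pi)) ^ n
    \<le> (LINT t|circ_meas. pker z t * cmod (u t) ^ n) / (2 * pi)"
proof -
  define N where "N = density circ_meas (\<lambda>t. ennreal (pker z t / (2 * pi)))"
  have [measurable]: "u \<in> borel_measurable circ_meas" using u by simp
  have p0: "0 \<le> pker z t / (2 * pi)" for t using pker_bounds(1)[OF order_refl z] by simp
  have ip: "integrable circ_meas (pker z)"
    using integrable_pker_mult[of "\<lambda>_. 1::real" z] z by simp
  have "emeasure N (space N) = (\<integral>\<^sup>+ t. ennreal (pker z t / (2 * pi)) \<partial>circ_meas)"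
    unfolding N_def by (simp add: emeasure_density del: space_circ_meas cong: nn_integral_cong)
  also have "\<dots> = ennreal (LINT t|circ_meas. pker z t / (2 * pi))"
    by (intro nn_integral_eq_integral) (use ip p0 in auto)
  also have "\<dots> = 1" using poisson_one[OF z] by simp
  finally interpret N: prob_space N by (rule prob_spaceI)
  have iN: "integrable N f \<longleftrightarrow> integrable circ_meas (\<lambda>t. pker z t / (2 * pi) * f t)"
    and lN: "integral\<^sup>L N f = (LINT t|circ_meas. pker z t / (2 * pi) * f t)"
    if "f \<in> borel_measurable circ_meas" for f :: "real \<Rightarrow> real"
    unfolding N_def using that p0 by (auto simp: integrable_real_density integral_real_density)
  have i1: "integrable circ_meas (\<lambda>t. pker z t * cmod (u t))"
    using integrable_pker_mult[of "\<lambda>t. cmod (u t)" z] u z by simp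
  have i2: "integrable circ_meas (\<lambda>t. pker z t * cmod (u t) ^ n)"
    using integrable_pker_mult[OF un z] by simp
  have "cmod ((LINT t|circ_meas. of_real (pker z t) * u t) / (2 * pi))
      \<le> (LINT t|circ_meas. cmod (of_real (pker z t) * u t)) / (2 * pi)"
    by (simp add: norm_divide divide_right_mono integral_norm_bound)
  also have "\<dots> = (LINT t|circ_meas. pker z t * cmod (u t)) / (2 * pi)"
    using pker_bounds(1)[OF order_refl z] by (simp add: norm_mult)
  also have "\<dots> = (LINT t|N. cmod (u t))" by (subst lN) simp_all
  finally have "cmod ((LINT t|circ_meas. of_real (pker z t) * u t) / (2 * pi)) ^ n \<le> (LINT t|N. cmod (u t)) ^ n"
    by (intro power_mono) auto
  also have "\<dots> \<le> (LINT t|N. cmod (u t) ^ n)"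
    by (rule N.jensens_inequality[where q = "\<lambda>x. x ^ n" and I = UNIV])
       (use i1 i2 convex_power_even[OF n] in \<open>simp_all add: iN\<close>)
  also have "\<dots> = (LINT t|circ_meas. pker z t * cmod (u t) ^ n) / (2 * pi)"
    by (subst lN) simp_all
  finally show ?thesis .
qed

subsection \<open>The weighted bound for even exponents\<close>

text \<open>The sign of \<open>Re ((x y)^k)\<close> is favourable where \<open>x + \<omega> cnj y\<close> is small, because there
  \<open>x y\<close> is close to \<open>- \<omega> \<bar>x\<bar>\<^sup>2\<close>.\<close>

lemma riesz_pointwise_inequality:
  fixes d :: real and k :: nat
  assumes d: "0 < d"
  shows "\<exists>C>0. \<forall>x y \<omega>. cmod \<omega> = 1 \<and> d \<le> Re (\<omega> ^ k) \<longrightarrow>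
    d / 2 * cmod x ^ (2 * k) \<le> (-1) ^ k * Re ((x * y) ^ k) + C * cmod (x + \<omega> * cnj y) ^ (2 * k)"
proof -
  have "((\<lambda>t::complex. (1 - t) ^ k) \<longlongrightarrow> (1 - 0) ^ k) (nhds 0)"
    by (intro tendsto_intros filterlim_ident)
  then have "eventually (\<lambda>t::complex. dist ((1 - t) ^ k) ((1 - 0) ^ k) < d / 2) (nhds 0)"
    using d by (intro tendstoD) auto
  then have "\<exists>\<delta>>0. \<forall>t::complex. dist t 0 < \<delta> \<longrightarrow> dist ((1 - t) ^ k) ((1 - 0) ^ k) < d / 2"
    unfolding eventually_nhds_metric .
  then obtain \<eta>0 where "\<eta>0 > 0"
    and e0: "\<And>t::complex. dist t 0 < \<eta>0 \<Longrightarrow> dist ((1 - t) ^ k) ((1 - 0) ^ k) < d / 2"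
    by blast
  define \<eta> where "\<eta> = \<eta>0 / 2"
  have eta: "\<eta> > 0" using \<open>\<eta>0 > 0\<close> by (simp add: \<eta>_def)
  \<comment> \<open>C serves the region where e = x + \<omega> cnj y is not small against x: there
    |x| \<le> |e| / \<eta> and |y| \<le> (1 / \<eta> + 1) |e|, and both terms are bounded by powers
    of |e|.\<close>
  define C where "C = ((1 / \<eta>) * (1 / \<eta> + 1)) ^ k + d / 2 * (1 / \<eta>) ^ (2 * k)"
  have C: "C > 0" unfolding C_def using eta d by (intro add_nonneg_pos) (auto intro!: zero_less_power)
  show ?thesis
  proof (intro exI[of _ C] conjI C allI impI)
    fix x y \<omega> :: complex
    assume as: "cmod \<omega> = 1 \<and> d \<le> Re (\<omega> ^ k)"
    define e where "e = x + \<omega> * cnj y"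
    have ww: "\<omega> * cnj \<omega> = 1" using as by (simp add: complex_norm_square[symmetric])
    have "\<omega> * cnj e = \<omega> * cnj x + (\<omega> * cnj \<omega>) * y" by (simp add: e_def algebra_simps)
    \<comment> \<open>Solving for y shows x y = - \<omega> |x|^2 (1 - t) with t = cnj e / cnj x. For
      small t the k-th power of 1 - t is within d / 2 of 1, so half of the lower bound d on Re
      (\<omega> ^ k) survives.\<close>
    then have y: "y = \<omega> * (cnj e - cnj x)" by (simp add: ww algebra_simps)
    show "d / 2 * cmod x ^ (2 * k) \<le> (-1) ^ k * Re ((x * y) ^ k) + C * cmod e ^ (2 * k)"
    proof (cases "x \<noteq> 0 \<and> cmod e \<le> \<eta> * cmod x")
      case True
      define t where "t = cnj e / cnj x"
      have "cmod t \<le> \<eta>" using True by (simp add: t_def norm_divide divide_simps)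
      then have t: "cmod ((1 - t) ^ k - 1) < d / 2" using eta e0[of t] by (simp add: \<eta>_def dist_norm)
      have ct: "cnj e = cnj x * t" using True by (simp add: t_def)
      have "x * y = \<omega> * (x * cnj x) * (t - 1)" unfolding y ct by (simp add: algebra_simps)
      also have "x * cnj x = of_real ((cmod x)\<^sup>2)" by (rule complex_norm_square[symmetric])
      finally have "x * y = - (of_real ((cmod x)\<^sup>2) * (\<omega> * (1 - t)))" by (simp add: algebra_simps)
      then have "(x * y) ^ k = (-1) ^ k * (of_real ((cmod x)\<^sup>2) * (\<omega> * (1 - t))) ^ k"
        by (metis power_minus)
      also have "\<dots> = (-1) ^ k * (of_real (cmod x ^ (2 * k)) * (\<omega> ^ k * (1 - t) ^ k))"
        by (simp add: power_mult_distrib power_mult)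
      finally have "(x * y) ^ k = (-1) ^ k * (of_real (cmod x ^ (2 * k)) * (\<omega> ^ k * (1 - t) ^ k))" .
      then have "Re ((x * y) ^ k) = (-1) ^ k * (cmod x ^ (2 * k) * Re (\<omega> ^ k * (1 - t) ^ k))"
        by (cases "even k") simp_all
      then have eq: "(-1) ^ k * Re ((x * y) ^ k) = cmod x ^ (2 * k) * Re (\<omega> ^ k * (1 - t) ^ k)"
        by (cases "even k") simp_all
      have "\<bar>Re (\<omega> ^ k * ((1 - t) ^ k - 1))\<bar> \<le> cmod (\<omega> ^ k * ((1 - t) ^ k - 1))" by (rule abs_Re_le_cmod)
      also have "\<dots> < d / 2" using t as by (simp add: norm_mult norm_power)
      finally have "\<bar>Re (\<omega> ^ k * (1 - t) ^ k) - Re (\<omega> ^ k)\<bar> < d / 2"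
        by (simp add: right_diff_distrib del: times_complex.sel)
      then have "d / 2 \<le> Re (\<omega> ^ k * (1 - t) ^ k)" using as by linarith
      then have "d / 2 * cmod x ^ (2 * k) \<le> (-1) ^ k * Re ((x * y) ^ k)"
        unfolding eq by (subst mult.commute) (intro mult_left_mono, auto)
      then show ?thesis using C by (simp add: add_increasing2)
    next
      case False
      then have xe: "cmod x \<le> 1 / \<eta> * cmod e"
        using eta by (cases "x = 0") (auto simp: field_simps)
      have "cmod y \<le> cmod e + cmod x" unfolding y norm_mult using as norm_triangle_ineq4[of "cnj e" "cnj x"] by simp
      also have "\<dots> \<le> (1 / \<eta> + 1) * cmod e" using xe by (simp add: algebra_simps)
      finally have "cmod x * cmod y \<le> (1 / \<eta> * cmod e) * ((1 / \<eta> + 1) * cmod e)"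
        using xe eta by (intro mult_mono) auto
      also have "\<dots> = ((1 / \<eta>) * (1 / \<eta> + 1)) * cmod e ^ 2" by (simp add: power2_eq_square)
      finally have "cmod ((x * y) ^ k) \<le> (((1 / \<eta>) * (1 / \<eta> + 1)) * cmod e ^ 2) ^ k"
        unfolding norm_power norm_mult by (intro power_mono) auto
      also have "\<dots> = ((1 / \<eta>) * (1 / \<eta> + 1)) ^ k * cmod e ^ (2 * k)"
        by (simp only: power_mult_distrib power_mult)
      finally have 1: "\<bar>Re ((x * y) ^ k)\<bar> \<le> ((1 / \<eta>) * (1 / \<eta> + 1)) ^ k * cmod e ^ (2 * k)"
        using abs_Re_le_cmod order_trans by blast
      have "cmod x ^ (2 * k) \<le> (1 / \<eta> * cmod e) ^ (2 * k)" using xe by (intro power_mono) auto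
      also have "\<dots> = (1 / \<eta>) ^ (2 * k) * cmod e ^ (2 * k)" by (rule power_mult_distrib)
      finally have "d / 2 * cmod x ^ (2 * k) \<le> d / 2 * (1 / \<eta>) ^ (2 * k) * cmod e ^ (2 * k)"
        using d by simp
      moreover have "- \<bar>Re ((x * y) ^ k)\<bar> \<le> (-1) ^ k * Re ((x * y) ^ k)"
        by (cases "even k") simp_all
      ultimately show ?thesis using 1 unfolding C_def distrib_right by linarith
    qed
  qed
qed

lemma measurable_cis_comp [measurable (raw)]:
  "f \<in> borel_measurable N \<Longrightarrow> (\<lambda>x. cis (f x)) \<in> borel_measurable N"
  by (rule measurable_compose[of f N borel cis borel])
     (auto intro!: borel_measurable_continuous_onI continuous_intros)

lemma measurable_fst_circ [measurable]: "fst \<in> borel_measurable (circ_meas \<Otimes>\<^sub>M circ_meas)"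
  by (rule measurable_compose[OF measurable_fst measurable_ident_circ_meas])

lemma measurable_snd_circ [measurable]: "snd \<in> borel_measurable (circ_meas \<Otimes>\<^sub>M circ_meas)"
  by (rule measurable_compose[OF measurable_snd measurable_ident_circ_meas])

lemma wt_one_ge: "2 powr \<alpha> \<le> wt \<alpha> 1 t" if "\<alpha> \<le> 0" "cis t \<noteq> 1"
proof -
  have "cmod (1 - cis t) \<le> 2" using norm_triangle_ineq4[of 1 "cis t"] by simp
  then show ?thesis unfolding wt_def using that by (intro powr_mono2') auto
qed

lemma nn_integral_le_wt:
  assumes "\<alpha> \<le> 0" and [measurable]: "f \<in> borel_measurable circ_meas" and f: "\<And>t. 0 \<le> f t"
  shows "(\<integral>\<^sup>+ t. ennreal (f t) \<partial>circ_meas)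
    \<le> ennreal (2 powr (- \<alpha>)) * (\<integral>\<^sup>+ t. ennreal (f t * wt \<alpha> 1 t) \<partial>circ_meas)"
proof -
  have "(\<integral>\<^sup>+ t. ennreal (f t) \<partial>circ_meas)
      \<le> (\<integral>\<^sup>+ t. ennreal (2 powr (- \<alpha>)) * ennreal (f t * wt \<alpha> 1 t) \<partial>circ_meas)"
  proof (rule nn_integral_mono_AE, use AE_circ_meas_cis in eventually_elim)
    case (elim t)
    have "f t * (2 powr (- \<alpha>) * 2 powr \<alpha>) \<le> f t * (2 powr (- \<alpha>) * wt \<alpha> 1 t)"
      using wt_one_ge[OF assms(1) elim] f by (intro mult_left_mono) auto
    then have "f t \<le> 2 powr (- \<alpha>) * (f t * wt \<alpha> 1 t)" by (simp add: powr_minus mult_ac)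
    then show ?case by (subst ennreal_mult[symmetric]) (auto intro!: ennreal_leI mult_nonneg_nonneg f)
  qed
  then show ?thesis by (simp add: nn_integral_cmult)
qed

lemma nn_integral_poisson_wt:
  assumes al: "-1 < \<alpha>" "\<alpha> \<le> 0" and r: "0 \<le> r" "r < 1" and s: "cis s \<noteq> 1"
  shows "(\<integral>\<^sup>+ t. ennreal (pker (r * cis t) s * wt \<alpha> r t) \<partial>circ_meas)
    \<le> ennreal (2 * pi * 2 powr (- \<alpha>) / cos (\<alpha> * pi / 2) * wt \<alpha> 1 s)"
proof -
  have a: "cmod (r * cis s) < 1" using r by (simp add: norm_mult)
  have "(\<integral>\<^sup>+ t. ennreal (pker (r * cis t) s * wt \<alpha> r t) \<partial>circ_meas)
      = (\<integral>\<^sup>+ t. ennreal (pker (r * cis s) t * wt \<alpha> r t) \<partial>circ_meas)"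
    by (simp add: pker_sym)
  also have "\<dots> = ennreal (LINT t|circ_meas. pker (r * cis s) t * wt \<alpha> r t)"
    using integrable_pker_mult[OF wt_integrable[OF r] a] pker_bounds(1)[OF order_refl a]
    by (intro nn_integral_eq_integral) auto
  also have "\<dots> \<le> ennreal (2 * pi * 2 powr (- \<alpha>) / cos (\<alpha> * pi / 2) * wt \<alpha> 1 s)"
    by (intro ennreal_leI poisson_wt_bound assms)
  finally show ?thesis .
qed

lemma continuous_circle_of_holomorphic:
  assumes "F holomorphic_on ball 0 1" "0 \<le> r" "r < 1"
  shows "continuous_on {0..2*pi} (\<lambda>t. F (of_real r * cis t))"
  by (rule continuous_on_compose2[OF holomorphic_on_imp_continuous_on[OF assms(1)]])
     (use assms in \<open>auto intro!: continuous_intros simp: norm_mult\<close>)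

lemma continuous_wt: "continuous_on {0..2*pi} (wt \<alpha> r)" if "0 \<le> r" "r < 1"
  unfolding wt_def[abs_def]
  by (intro continuous_intros) (metis norm_eq_zero one_minus_of_real_ne_zero[OF that] norm_cis order_refl)

text \<open>For even exponents \<open>2k\<close> the function \<open>(V W)^k\<close> is holomorphic and vanishes at \<open>0\<close>,
  where \<open>V\<close>, \<open>W\<close> are the analytic and coanalytic parts of \<open>u\<close> times \<open>(1 - z) powr (\<alpha> / (2k))\<close>.\<close>

lemma szego_le_poisson_even:
  assumes k: "k \<ge> 1" and al: "\<bar>\<alpha>\<bar> < 1"
  shows "\<exists>C>0. \<forall>r (u :: real \<Rightarrow> complex). 0 \<le> r \<and> r < 1 \<and> integrable circ_meas u \<longrightarrow>
    (LINT t|circ_meas. cmod (szego u (r * cis t)) ^ (2 * k) * wt \<alpha> r t)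
    \<le> C * (LINT t|circ_meas.
      cmod ((LINT s|circ_meas. of_real (pker (r * cis t) s) * u s) / (2 * pi)) ^ (2 * k) * wt \<alpha> r t)"
proof -
  define d where "d = cos (\<alpha> * pi / 2)"
  have d: "d > 0" unfolding d_def using al by (rule cos_half_pos)
  obtain C where C: "C > 0" and key: "\<And>x y \<omega>. cmod \<omega> = 1 \<Longrightarrow> d \<le> Re (\<omega> ^ k) \<Longrightarrow>
    d / 2 * cmod x ^ (2 * k) \<le> (-1) ^ k * Re ((x * y) ^ k) + C * cmod (x + \<omega> * cnj y) ^ (2 * k)"
    using riesz_pointwise_inequality[OF d, of k] by blast
  show ?thesis
  proof (intro exI[of _ "C * 2 / d"] conjI allI impI)
    show "C * 2 / d > 0" using C d by simp
    fix r :: real and u :: "real \<Rightarrow> complex"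
    assume as: "0 \<le> r \<and> r < 1 \<and> integrable circ_meas u"
    then have r: "0 \<le> r" "r < 1" and u: "integrable circ_meas u" by auto
    have cu: "integrable circ_meas (\<lambda>t. cnj (u t))" using u by (rule integrable_cnj)
    define v where "v = szego u"
    define w where "w = (\<lambda>z. szego (\<lambda>t. cnj (u t)) z - szego (\<lambda>t. cnj (u t)) 0)"
    \<comment> \<open>The exponent is chosen so that |\<psi>|^(2k) is the weight on the circle of
      radius r.\<close>
    define \<psi> :: "complex \<Rightarrow> complex" where "\<psi> = (\<lambda>z. (1 - z) powr of_real (\<alpha> / (2 * k)))"
    define P where "P = (\<lambda>t. (LINT s|circ_meas. of_real (pker (r * cis t) s) * u s) / (2 * pi))"
    have v: "v holomorphic_on ball 0 1" and w: "w holomorphic_on ball 0 1"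
      unfolding v_def w_def by (intro holomorphic_intros szego_holomorphic u cu)+
    have rp: "0 < Re (1 - z)" if "cmod z < 1" for z
      using that complex_Re_le_cmod[of z] by simp
    then have nz: "1 - z \<notin> \<real>\<^sub>\<le>\<^sub>0" if "cmod z < 1" for z
      using that by (force simp: complex_nonpos_Reals_iff)
    have psi: "\<psi> holomorphic_on ball 0 1"
      unfolding \<psi>_def using nz by (auto intro!: holomorphic_intros simp del: complex_nonpos_Reals_iff)
    define H where "H = (\<lambda>z. (v z * \<psi> z * (w z * \<psi> z)) ^ k)"
    have H: "H holomorphic_on ball 0 1" unfolding H_def by (intro holomorphic_intros v w psi)
    have rc: "cmod (r * cis t) < 1" for t using r by (simp add: norm_mult)
    have Hr: "(\<lambda>z. H (of_real r * z)) holomorphic_on cball 0 1"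
    proof (rule holomorphic_on_compose_gen[OF _ H, unfolded o_def])
      show "(*) (complex_of_real r) ` cball 0 1 \<subseteq> ball 0 1"
      proof clarsimp
        fix z :: complex assume "cmod z \<le> 1"
        then have "r * cmod z \<le> r * 1" using r by (intro mult_left_mono) auto
        then show "cmod (complex_of_real r * z) < 1" using r by (simp add: norm_mult)
      qed
    qed (intro holomorphic_intros)
    \<comment> \<open>Mean value property of H on the circle of radius r; H vanishes at 0 because w
      does and k \<ge> 1.\<close>
    have "(LINT t|circ_meas. H (of_real r * cis t)) = 2 * pi * H (of_real r * 0)"
      using mean_value_circ_meas(2)[of "\<lambda>z. H (of_real r * z)"] Hr
      by (meson ball_subset_cball holomorphic_on_imp_continuous_on holomorphic_on_subset)
    then have H0: "(LINT t|circ_meas. H (of_real r * cis t)) = 0"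
      using k by (simp add: H_def w_def)
    have cont: "continuous_on {0..2*pi} (\<lambda>t. F (of_real r * cis t))" if "F holomorphic_on ball 0 1" for F
      using that r by (rule continuous_circle_of_holomorphic)
    have P: "P t = v (r * cis t) + cnj (w (r * cis t))" for t
      unfolding P_def v_def w_def by (rule szego_poisson[OF u rc, symmetric])
    have pw: "d / 2 * (cmod (v (r * cis t)) ^ (2 * k) * wt \<alpha> r t)
        \<le> (-1) ^ k * Re (H (r * cis t)) + C * (cmod (P t) ^ (2 * k) * wt \<alpha> r t)" for t
    proof -
      define z where "z = of_real r * cis t"
      have z1: "1 - z \<noteq> 0" unfolding z_def by (rule one_minus_of_real_ne_zero[OF r]) simp
      have psi0: "\<psi> z \<noteq> 0" using z1 by (simp add: \<psi>_def)
      have psin: "cmod (\<psi> z) ^ (2 * k) = wt \<alpha> r t"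
      proof -
        have "cmod (\<psi> z) ^ (2 * k) = (cmod (1 - z) powr (\<alpha> / (2 * k))) ^ (2 * k)"
          by (simp add: \<psi>_def norm_powr_real_powr')
        also have "\<dots> = cmod (1 - z) powr \<alpha>" using k z1 by (simp add: powr_power)
        finally show ?thesis by (simp add: wt_def z_def)
      qed
      have psip: "\<psi> z ^ (2 * k) = (1 - z) powr of_real \<alpha>"
      proof -
        have "\<psi> z ^ (2 * k) = exp (of_nat (2 * k) * (of_real (\<alpha> / (2 * k)) * Ln (1 - z)))"
          using z1 unfolding exp_of_nat_mult by (simp add: \<psi>_def powr_def)
        also have "of_nat (2 * k) * (of_real (\<alpha> / (2 * k)) * Ln (1 - z)) = of_real \<alpha> * Ln (1 - z)"
          using k by simp
        finally show ?thesis using z1 by (simp add: powr_def)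
      qed
      \<comment> \<open>Multiplying P = v + cnj w by \<psi> gives v \<psi> + \<omega> cnj (w
        \<psi>), so the phase of \<psi> has to be carried along. Its k-th power is the phase of (1 -
        z) powr \<alpha>, whose real part is at least d.\<close>
      define \<omega> where "\<omega> = \<psi> z / cnj (\<psi> z)"
      have om1: "cmod \<omega> = 1" using psi0 by (simp add: \<omega>_def norm_divide)
      have "\<omega> = \<psi> z ^ 2 / of_real (cmod (\<psi> z) ^ 2)"
        unfolding complex_norm_square using psi0 by (simp add: \<omega>_def power2_eq_square)
      then have "\<omega> ^ k = \<psi> z ^ (2 * k) / of_real (cmod (\<psi> z) ^ (2 * k))"
        by (simp add: power_divide power_mult)
      then have "Re (\<omega> ^ k) = Re ((1 - z) powr of_real \<alpha>) / cmod (1 - z) powr \<alpha>"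
        unfolding psin psip by (simp add: wt_def z_def)
      moreover have "d * cmod (1 - z) powr \<alpha> \<le> Re ((1 - z) powr of_real \<alpha>)"
        unfolding d_def using al rp rc by (intro cos_powr_le_Re_powr) (auto simp: z_def simp del: minus_complex.sel)
      moreover have "0 < cmod (1 - z) powr \<alpha>" using z1 by simp
      ultimately have om2: "d \<le> Re (\<omega> ^ k)" by (simp only: pos_le_divide_eq)
      have "v z * \<psi> z + \<omega> * cnj (w z * \<psi> z) = P t * \<psi> z"
        unfolding P z_def[symmetric] using psi0 by (simp add: \<omega>_def algebra_simps)
      then show ?thesis
        using key[OF om1 om2, of "v z * \<psi> z" "w z * \<psi> z"]
        by (simp add: norm_mult power_mult_distrib psin H_def flip: z_def)
    qed
    have c1: "continuous_on {0..2*pi} (\<lambda>t. cmod (v (r * cis t)) ^ (2 * k) * wt \<alpha> r t)"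
      by (intro continuous_intros cont[OF v] continuous_wt r)
    have c2: "continuous_on {0..2*pi} (\<lambda>t. Re (H (r * cis t)))"
      by (intro continuous_intros cont[OF H])
    have c3: "continuous_on {0..2*pi} (\<lambda>t. cmod (P t) ^ (2 * k) * wt \<alpha> r t)"
      unfolding P by (intro continuous_intros cont[OF v] cont[OF w] continuous_wt r)
    note i = c1[THEN circ_meas_integrable_continuous] c2[THEN circ_meas_integrable_continuous]
      c3[THEN circ_meas_integrable_continuous]
    have "(LINT t|circ_meas. d / 2 * (cmod (v (r * cis t)) ^ (2 * k) * wt \<alpha> r t))
        \<le> (LINT t|circ_meas. (-1) ^ k * Re (H (r * cis t)) + C * (cmod (P t) ^ (2 * k) * wt \<alpha> r t))"
      using i by (intro integral_mono pw) auto
    also have "\<dots> = (-1) ^ k * (LINT t|circ_meas. Re (H (r * cis t)))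
        + C * (LINT t|circ_meas. cmod (P t) ^ (2 * k) * wt \<alpha> r t)"
      using i by (subst Bochner_Integration.integral_add) auto
    also have "(LINT t|circ_meas. Re (H (r * cis t))) = 0"
      using H0 Bochner_Integration.integral_Re[OF circ_meas_integrable_continuous[OF cont[OF H]]] by simp
    finally show "(LINT t|circ_meas. cmod (szego u (r * cis t)) ^ (2 * k) * wt \<alpha> r t)
      \<le> C * 2 / d * (LINT t|circ_meas.
      cmod ((LINT s|circ_meas. of_real (pker (r * cis t) s) * u s) / (2 * pi)) ^ (2 * k) * wt \<alpha> r t)"
      using d by (simp add: field_simps v_def P_def)
  qed
qed

lemma measurable_pker_pair [measurable]:
  "(\<lambda>x. pker (of_real r * cis (fst x)) (snd x)) \<in> borel_measurable (circ_meas \<Otimes>\<^sub>M circ_meas)"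
  unfolding pker_def by measurable

lemma measurable_pker_fst [measurable]: "(\<lambda>t. pker (of_real r * cis t) s) \<in> borel_measurable circ_meas"
  unfolding pker_def by measurable

text \<open>For \<alpha> \<le> 0 the weight is bounded below, so finite weighted norm places u in
  L^1, where its Cauchy integral makes sense.\<close>

lemma integrable_of_wt:
  assumes "\<alpha> \<le> 0" "p \<ge> 1" and [measurable]: "u \<in> borel_measurable circ_meas"
    and fin: "(\<integral>\<^sup>+ t. ennreal (cmod (u t) powr p * wt \<alpha> 1 t) \<partial>circ_meas) < \<infinity>"
  shows "integrable circ_meas u" "integrable circ_meas (\<lambda>t. cmod (u t) powr p)"
proof -
  have "(\<integral>\<^sup>+ t. ennreal (cmod (u t) powr p) \<partial>circ_meas)
      \<le> ennreal (2 powr (- \<alpha>)) * (\<integral>\<^sup>+ t. ennreal (cmod (u t) powr p * wt \<alpha> 1 t) \<partial>circ_meas)"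
    by (rule nn_integral_le_wt) (use assms in auto)
  also have "\<dots> < \<infinity>" using fin by (simp add: ennreal_mult_less_top)
  finally show i: "integrable circ_meas (\<lambda>t. cmod (u t) powr p)"
    by (intro integrableI_bounded) auto
  show "integrable circ_meas u"
  proof (rule Bochner_Integration.integrable_bound)
    show "integrable circ_meas (\<lambda>t. 1 + cmod (u t) powr p)" using i by simp
    have "x \<le> 1 + x powr p" if "x \<ge> 0" for x :: real
    proof (cases "x \<le> 1")
      case False
      then have "x powr 1 \<le> x powr p" using assms(2) by (intro powr_mono) auto
      then show ?thesis using False by simp
    qed (use that in \<open>auto intro: add_increasing2\<close>)
    then show "AE t in circ_meas. norm (u t) \<le> norm (1 + cmod (u t) powr p)"
      by (intro AE_I2) (auto intro: order_trans)
  qed simp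
qed

text \<open>Jensen moves the power inside the Poisson integral, Fubini moves the Poisson kernel onto
  the weight at radius r, and the A_1 bound returns the weight at radius 1.\<close>

lemma szego_bound_even:
  assumes k: "k \<ge> 1" and al: "-1 < \<alpha>" "\<alpha> \<le> 0"
  shows "\<exists>C>0. \<forall>r (u :: real \<Rightarrow> complex). 0 \<le> r \<and> r < 1 \<and> u \<in> borel_measurable circ_meas \<longrightarrow>
    (\<integral>\<^sup>+ t. ennreal (cmod (szego u (of_real r * cis t)) powr real (2 * k) * wt \<alpha> r t) \<partial>circ_meas)
    \<le> ennreal C * (\<integral>\<^sup>+ t. ennreal (cmod (u t) powr real (2 * k) * wt \<alpha> 1 t) \<partial>circ_meas)"
proof -
  have pw: "x powr real (2 * k) = x ^ (2 * k)" if "x \<ge> 0" for x :: real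
    using that k by (intro powr_realpow') auto
  obtain C where C: "C > 0" and key: "\<And>r (u :: real \<Rightarrow> complex). 0 \<le> r \<Longrightarrow> r < 1 \<Longrightarrow> integrable circ_meas u \<Longrightarrow>
    (LINT t|circ_meas. cmod (szego u (of_real r * cis t)) ^ (2 * k) * wt \<alpha> r t)
    \<le> C * (LINT t|circ_meas.
      cmod ((LINT s|circ_meas. of_real (pker (of_real r * cis t) s) * u s) / (2 * pi)) ^ (2 * k) * wt \<alpha> r t)"
    using szego_le_poisson_even[OF k, of \<alpha>] al by auto
  define K where "K = 2 * pi * 2 powr (- \<alpha>) / cos (\<alpha> * pi / 2)"
  have K: "K > 0" unfolding K_def using cos_half_pos[of \<alpha>] al by simp
  show ?thesis
  proof (intro exI[of _ "C * K"] conjI allI impI)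
    show "C * K > 0" using C K by simp
    fix r :: real and u :: "real \<Rightarrow> complex"
    assume as: "0 \<le> r \<and> r < 1 \<and> u \<in> borel_measurable circ_meas"
    then have r: "0 \<le> r" "r < 1" and [measurable]: "u \<in> borel_measurable circ_meas" by auto
    let ?U = "\<integral>\<^sup>+ t. ennreal (cmod (u t) powr real (2 * k) * wt \<alpha> 1 t) \<partial>circ_meas"
    show "(\<integral>\<^sup>+ t. ennreal (cmod (szego u (of_real r * cis t)) powr real (2 * k) * wt \<alpha> r t) \<partial>circ_meas)
      \<le> ennreal (C * K) * ?U"
    proof (cases "?U = \<infinity>")
      case True
      then show ?thesis using C K by (simp add: ennreal_mult_top)
    next
      case False
      then have fin: "?U < \<infinity>" by (simp add: less_top)
      have k2: "1 \<le> real (2 * k)" using k by simp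
      note u = integrable_of_wt(1)[OF al(2) k2 _ fin, simplified]
      have un: "integrable circ_meas (\<lambda>t. cmod (u t) ^ (2 * k))"
        using integrable_of_wt(2)[OF al(2) k2 _ fin] by (simp add: pw del: of_nat_mult)
      have rc: "cmod (of_real r * cis t) < 1" for t using r by (simp add: norm_mult)
      have cont: "continuous_on {0..2*pi} (\<lambda>t. F (of_real r * cis t))" if "F holomorphic_on ball 0 1" for F
        using that r by (rule continuous_circle_of_holomorphic)
      define P where "P = (\<lambda>t. (LINT s|circ_meas. of_real (pker (of_real r * cis t) s) * u s) / (2 * pi))"
      have P: "P t = szego u (of_real r * cis t)
          + cnj (szego (\<lambda>t. cnj (u t)) (of_real r * cis t) - szego (\<lambda>t. cnj (u t)) 0)" for t
        unfolding P_def by (rule szego_poisson[OF u rc, symmetric])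
      note h = szego_holomorphic[OF u] szego_holomorphic[OF integrable_cnj[OF u]]
      have i1: "integrable circ_meas (\<lambda>t. cmod (szego u (of_real r * cis t)) ^ (2 * k) * wt \<alpha> r t)"
        by (intro circ_meas_integrable_continuous continuous_intros cont h continuous_wt r)
      have i2: "integrable circ_meas (\<lambda>t. cmod (P t) ^ (2 * k) * wt \<alpha> r t)"
        unfolding P by (intro circ_meas_integrable_continuous continuous_intros cont h continuous_wt r)
      have "(\<integral>\<^sup>+ t. ennreal (cmod (szego u (of_real r * cis t)) powr real (2 * k) * wt \<alpha> r t) \<partial>circ_meas)
          = ennreal (LINT t|circ_meas. cmod (szego u (of_real r * cis t)) ^ (2 * k) * wt \<alpha> r t)"
        unfolding pw[OF norm_ge_zero] using i1 by (intro nn_integral_eq_integral) auto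
      also have "\<dots> \<le> ennreal (C * (LINT t|circ_meas. cmod (P t) ^ (2 * k) * wt \<alpha> r t))"
        unfolding P_def by (intro ennreal_leI key r u)
      also have "\<dots> = ennreal C * (\<integral>\<^sup>+ t. ennreal (cmod (P t) ^ (2 * k) * wt \<alpha> r t) \<partial>circ_meas)"
        using i2 C by (subst nn_integral_eq_integral) (auto simp: ennreal_mult' intro!: integral_nonneg)
      also have "(\<integral>\<^sup>+ t. ennreal (cmod (P t) ^ (2 * k) * wt \<alpha> r t) \<partial>circ_meas)
          \<le> (\<integral>\<^sup>+ t. (\<integral>\<^sup>+ s. ennreal (pker (of_real r * cis t) s * cmod (u s) ^ (2 * k) * wt \<alpha> r t) \<partial>circ_meas) \<partial>circ_meas)"
      proof (rule nn_integral_mono)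
        fix t
        note ip = integrable_pker_mult[OF un rc[of t], simplified]
        have "cmod (P t) ^ (2 * k) \<le> (LINT s|circ_meas. pker (of_real r * cis t) s * cmod (u s) ^ (2 * k)) / (2 * pi)"
          unfolding P_def by (rule poisson_jensen[OF u un _ rc]) simp
        \<comment> \<open>The factor 1 / (2 pi) is discarded, as only the finiteness of the constant
          matters.\<close>
        also have "\<dots> \<le> (LINT s|circ_meas. pker (of_real r * cis t) s * cmod (u s) ^ (2 * k)) / 1"
          using pi_ge_two pker_bounds(1)[OF order_refl rc[of t]]
          by (intro divide_left_mono integral_nonneg) auto
        finally have "cmod (P t) ^ (2 * k) * wt \<alpha> r t
          \<le> (LINT s|circ_meas. pker (of_real r * cis t) s * cmod (u s) ^ (2 * k) * wt \<alpha> r t)"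
          by (simp add: mult_right_mono)
        then show "ennreal (cmod (P t) ^ (2 * k) * wt \<alpha> r t)
          \<le> (\<integral>\<^sup>+ s. ennreal (pker (of_real r * cis t) s * cmod (u s) ^ (2 * k) * wt \<alpha> r t) \<partial>circ_meas)"
          using ip pker_bounds(1)[OF order_refl rc[of t]]
          by (subst nn_integral_eq_integral) (auto intro: ennreal_leI)
      qed
      also have "\<dots> = (\<integral>\<^sup>+ s. (\<integral>\<^sup>+ t. ennreal (pker (of_real r * cis t) s * cmod (u s) ^ (2 * k) * wt \<alpha> r t) \<partial>circ_meas) \<partial>circ_meas)"
        by (rule circ_pair.Fubini'[symmetric]) measurable
      also have "\<dots> \<le> (\<integral>\<^sup>+ s. ennreal K * ennreal (cmod (u s) powr real (2 * k) * wt \<alpha> 1 s) \<partial>circ_meas)"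
      proof (rule nn_integral_mono_AE, use AE_circ_meas_cis in eventually_elim)
        case (elim s)
        have "(\<integral>\<^sup>+ t. ennreal (pker (of_real r * cis t) s * cmod (u s) ^ (2 * k) * wt \<alpha> r t) \<partial>circ_meas)
            = (\<integral>\<^sup>+ t. ennreal (cmod (u s) ^ (2 * k)) * ennreal (pker (of_real r * cis t) s * wt \<alpha> r t) \<partial>circ_meas)"
          using pker_bounds(1)[OF order_refl rc] by (intro nn_integral_cong) (simp add: ac_simps flip: ennreal_mult)
        also have "\<dots> = ennreal (cmod (u s) ^ (2 * k)) * (\<integral>\<^sup>+ t. ennreal (pker (of_real r * cis t) s * wt \<alpha> r t) \<partial>circ_meas)"
          by (rule nn_integral_cmult) measurable
        also have "\<dots> \<le> ennreal (cmod (u s) ^ (2 * k)) * ennreal (K * wt \<alpha> 1 s)"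
          unfolding K_def by (intro mult_left_mono nn_integral_poisson_wt al r elim) simp
        also have "\<dots> = ennreal K * ennreal (cmod (u s) powr real (2 * k) * wt \<alpha> 1 s)"
          using K unfolding pw[OF norm_ge_zero] by (simp add: ac_simps flip: ennreal_mult)
        finally show ?case .
      qed
      also have "\<dots> = ennreal K * ?U" by (rule nn_integral_cmult) measurable
      finally show ?thesis using C K by (simp add: ennreal_mult mult.assoc mult_left_mono)
    qed
  qed
qed

subsection \<open>The weighted bound for general exponents\<close>

lemma szego_add:
  assumes "integrable circ_meas u" "integrable circ_meas v" "cmod z < 1"
  shows "szego (\<lambda>t. u t + v t) z = szego u z + szego v z"
  using Bochner_Integration.integral_add[OF integrable_szego_kernel[OF assms(1,3)] integrable_szego_kernel[OF assms(2,3)]]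
  by (simp add: szego_def add_divide_distrib)

lemma continuous_szego_circle:
  assumes "integrable circ_meas u" "0 \<le> r" "r < 1"
  shows "continuous_on {0..2*pi} (\<lambda>t. szego u (of_real r * cis t))"
  using szego_holomorphic[OF assms(1)] assms(2,3) by (rule continuous_circle_of_holomorphic)

lemma measurable_continuous_circ:
  fixes f :: "real \<Rightarrow> 'a::{banach, second_countable_topology}"
  assumes "continuous_on {0..2*pi} f"
  shows "f \<in> borel_measurable circ_meas"
  using circ_meas_integrable_continuous[OF assms] by simp

text \<open>Both endpoint bounds are taken at the same \<alpha>, so this is interpolation of one
  operator between fixed measures. The case p = 2 is separate because interpolation needs p strictly
  between the ends.\<close>

lemma szego_bound_ge_2:
  assumes p: "p \<ge> 2" and al: "-1 < \<alpha>" "\<alpha> \<le> 0"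
  shows "\<exists>C>0. \<forall>r (u :: real \<Rightarrow> complex). 0 \<le> r \<and> r < 1 \<and> u \<in> borel_measurable circ_meas \<longrightarrow>
    (\<integral>\<^sup>+ t. ennreal (cmod (szego u (of_real r * cis t)) powr p * wt \<alpha> r t) \<partial>circ_meas)
    \<le> ennreal C * (\<integral>\<^sup>+ t. ennreal (cmod (u t) powr p * wt \<alpha> 1 t) \<partial>circ_meas)"
proof (cases "p = 2")
  case True
  then show ?thesis using szego_bound_even[OF order_refl al] by simp
next
  case False
  with p have p2: "p > 2" by simp
  define k where "k = nat \<lceil>p\<rceil>"
  have kp: "p < real (2 * k)" "k \<ge> 1" unfolding k_def using p2 by (auto, linarith+)
  obtain A where A: "A > 0" and bA: "\<And>r (u :: real \<Rightarrow> complex). 0 \<le> r \<Longrightarrow> r < 1 \<Longrightarrow> u \<in> borel_measurable circ_meas \<Longrightarrow>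
    (\<integral>\<^sup>+ t. ennreal (cmod (szego u (of_real r * cis t)) powr 2 * wt \<alpha> r t) \<partial>circ_meas)
    \<le> ennreal A * (\<integral>\<^sup>+ t. ennreal (cmod (u t) powr 2 * wt \<alpha> 1 t) \<partial>circ_meas)"
    using szego_bound_even[OF order_refl al] by auto
  obtain B where B: "B > 0" and bB: "\<And>r (u :: real \<Rightarrow> complex). 0 \<le> r \<Longrightarrow> r < 1 \<Longrightarrow> u \<in> borel_measurable circ_meas \<Longrightarrow>
    (\<integral>\<^sup>+ t. ennreal (cmod (szego u (of_real r * cis t)) powr real (2 * k) * wt \<alpha> r t) \<partial>circ_meas)
    \<le> ennreal B * (\<integral>\<^sup>+ t. ennreal (cmod (u t) powr real (2 * k) * wt \<alpha> 1 t) \<partial>circ_meas)"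
    using szego_bound_even[OF kp(2) al] by blast
  define C where "C = p * 2 powr p * (A / (p - 2) + B / (real (2 * k) - p))"
  have C: "C > 0" unfolding C_def using A B p2 kp by (intro mult_pos_pos add_pos_pos divide_pos_pos) auto
  show ?thesis
  proof (intro exI[of _ C] conjI C allI impI)
    fix r :: real and u :: "real \<Rightarrow> complex"
    assume "0 \<le> r \<and> r < 1 \<and> u \<in> borel_measurable circ_meas"
    then have r: "0 \<le> r" "r < 1" and um: "u \<in> borel_measurable circ_meas" by auto
    let ?U = "\<integral>\<^sup>+ t. ennreal (cmod (u t) powr p * wt \<alpha> 1 t) \<partial>circ_meas"
    show "(\<integral>\<^sup>+ t. ennreal (cmod (szego u (of_real r * cis t)) powr p * wt \<alpha> r t) \<partial>circ_meas) \<le> ennreal C * ?U"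
    proof (cases "?U = \<infinity>")
      case True
      then show ?thesis using C by (simp add: ennreal_mult_top)
    next
      case False
      then have u: "integrable circ_meas u"
        using p2 by (intro integrable_of_wt(1)[OF al(2) _ um, of p]) (auto simp: less_top)
      show ?thesis
        unfolding C_def
      proof (rule marcinkiewicz_interpolation[where T = "\<lambda>u t. szego u (of_real r * cis t)", OF circ.sigma_finite_measure_axioms])
        fix v :: "real \<Rightarrow> complex"
        assume v: "integrable circ_meas v"
        show "(\<lambda>t. szego v (of_real r * cis t)) \<in> borel_measurable circ_meas"
          by (intro measurable_continuous_circ continuous_szego_circle v r)
        show "(\<integral>\<^sup>+ t. ennreal (cmod (szego v (of_real r * cis t)) powr 2 * wt \<alpha> r t) \<partial>circ_meas)
          \<le> ennreal A * (\<integral>\<^sup>+ t. ennreal (cmod (v t) powr 2 * wt \<alpha> 1 t) \<partial>circ_meas)"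
          by (rule bA[OF r borel_measurable_integrable[OF v]])
        show "(\<integral>\<^sup>+ t. ennreal (cmod (szego v (of_real r * cis t)) powr real (2 * k) * wt \<alpha> r t) \<partial>circ_meas)
          \<le> ennreal B * (\<integral>\<^sup>+ t. ennreal (cmod (v t) powr real (2 * k) * wt \<alpha> 1 t) \<partial>circ_meas)"
          by (rule bB[OF r borel_measurable_integrable[OF v]])
      qed (use r p2 kp A B u in \<open>auto simp: szego_add norm_mult norm_triangle_ineq\<close>)
    qed
  qed
qed

section \<open>Duality for exponents below 2\<close>

lemma integrable_circ_bounded:
  fixes k :: "real \<Rightarrow> complex"
  assumes "k \<in> borel_measurable circ_meas" "\<And>t. t \<in> {0..2*pi} \<Longrightarrow> cmod (k t) \<le> B"
  shows "integrable circ_meas k"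
  by (rule circ.integrable_const_bound[of _ B]) (use assms in auto)

text \<open>The kernel 1 / (1 - r cis (t - s)) is Hermitian in s and t. Boundedness of k and r < 1
  give the domination that Fubini requires.\<close>

lemma szego_selfadjoint:
  fixes u k :: "real \<Rightarrow> complex"
  assumes u: "integrable circ_meas u" and km: "k \<in> borel_measurable circ_meas"
    and kb: "\<And>t. t \<in> {0..2*pi} \<Longrightarrow> cmod (k t) \<le> B" and r: "0 \<le> r" "r < 1"
  shows "(LINT t|circ_meas. szego u (of_real r * cis t) * cnj (k t))
       = (LINT s|circ_meas. u s * cnj (szego k (of_real r * cis s)))"
proof -
  have [measurable]: "u \<in> borel_measurable circ_meas" "k \<in> borel_measurable circ_meas" using u km by auto
  let ?f = "\<lambda>t s. u s / (1 - of_real r * cis t * cis (- s)) * cnj (k t)"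
  have iu: "integrable (circ_meas \<Otimes>\<^sub>M circ_meas) (\<lambda>x. u (snd x))"
  proof (rule circ_pair.Fubini_integrable)
    show "(\<lambda>x. u (snd x)) \<in> borel_measurable (circ_meas \<Otimes>\<^sub>M circ_meas)" by measurable
  qed (use u in auto)
  have B: "0 \<le> B" using order_trans[OF norm_ge_zero kb[of 0]] by simp
  have ip: "integrable (circ_meas \<Otimes>\<^sub>M circ_meas) (case_prod ?f)"
  proof (rule Bochner_Integration.integrable_bound[OF integrable_mult_left[OF iu, of "of_real (B / (1 - r))"]])
    show "case_prod ?f \<in> borel_measurable (circ_meas \<Otimes>\<^sub>M circ_meas)"
    proof -
      have [measurable]: "(\<lambda>x. cis (- snd x)) \<in> borel_measurable (circ_meas \<Otimes>\<^sub>M circ_meas)"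
        "(\<lambda>x. cis (fst x)) \<in> borel_measurable (circ_meas \<Otimes>\<^sub>M circ_meas)"
        by (intro measurable_cis_comp borel_measurable_uminus measurable_snd_circ measurable_fst_circ)+
      have [measurable]: "(\<lambda>x. cnj (k (fst x))) \<in> borel_measurable (circ_meas \<Otimes>\<^sub>M circ_meas)"
        by (rule measurable_compose[OF measurable_compose[OF measurable_fst km]])
           (auto intro!: borel_measurable_continuous_onI continuous_intros)
      show ?thesis unfolding split_beta' by measurable
    qed
    show "AE x in circ_meas \<Otimes>\<^sub>M circ_meas. norm (case_prod ?f x) \<le> norm (u (snd x) * of_real (B / (1 - r)))"
    proof (rule AE_I2)
      fix x :: "real \<times> real" assume "x \<in> space (circ_meas \<Otimes>\<^sub>M circ_meas)"
      then have t: "fst x \<in> {0..2*pi}" by (auto simp: space_pair_measure)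
      have "cmod (u (snd x)) * cmod (1 / (1 - of_real r * cis (fst x) * cis (- snd x))) * cmod (k (fst x))
          \<le> cmod (u (snd x)) * (1 / (1 - r)) * B"
        using kb[OF t] r B by (intro mult_mono mult_left_mono cauchy_kernel_bound) (auto simp: norm_mult)
      also have "\<dots> = norm (u (snd x) * of_real (B / (1 - r)))"
        unfolding norm_mult norm_of_real using r B by simp
      finally show "norm (case_prod ?f x) \<le> norm (u (snd x) * of_real (B / (1 - r)))"
        by (simp add: split_beta' norm_mult norm_divide)
    qed
  qed
  have kk: "cnj (k t / (1 - of_real r * cis s * cis (- t))) = cnj (k t) / (1 - of_real r * cis t * cis (- s))" for s t
    by (simp add: cis_cnj mult_ac)
  have l: "szego u (of_real r * cis t) * cnj (k t) = (LINT s|circ_meas. ?f t s) / (2 * pi)" for t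
    unfolding szego_def integral_mult_left_zero by simp
  have "(LINT t|circ_meas. szego u (of_real r * cis t) * cnj (k t))
      = (LINT t|circ_meas. (LINT s|circ_meas. ?f t s)) / (2 * pi)"
    unfolding l by (rule integral_divide_zero)
  also have "(LINT t|circ_meas. (LINT s|circ_meas. ?f t s)) = (LINT s|circ_meas. (LINT t|circ_meas. ?f t s))"
    by (rule circ_pair.Fubini_integral[OF ip, symmetric])
  also have "(\<lambda>s. LINT t|circ_meas. ?f t s) = (\<lambda>s. u s * cnj (LINT t|circ_meas. k t / (1 - of_real r * cis s * cis (- t))))"
  proof
    fix s
    have "(LINT t|circ_meas. ?f t s) = (LINT t|circ_meas. u s * cnj (k t / (1 - of_real r * cis s * cis (- t))))"
      unfolding kk by simp
    then show "(LINT t|circ_meas. ?f t s) = u s * cnj (LINT t|circ_meas. k t / (1 - of_real r * cis s * cis (- t)))"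
      unfolding integral_mult_right_zero Bochner_Integration.integral_cnj .
  qed
  also have "(LINT s|circ_meas. u s * cnj (LINT t|circ_meas. k t / (1 - of_real r * cis s * cis (- t)))) / (2 * pi)
      = (LINT s|circ_meas. u s * cnj (LINT t|circ_meas. k t / (1 - of_real r * cis s * cis (- t))) / (2 * pi))"
    by (rule integral_divide_zero[symmetric])
  also have "\<dots> = (LINT s|circ_meas. u s * cnj (szego k (of_real r * cis s)))"
    unfolding szego_def by simp
  finally show ?thesis .
qed

text \<open>Duality for the unweighted pairing: v = S u is tested against its extremal function k, S
  is moved onto k, and S k is controlled at the conjugate exponent q > 2 with the dual weight
  \<beta> in (-1, 0]. Moving S also exchanges the radii of the two weights, so here radius r sits on
  the side of u.\<close>

lemma szego_bound_lt_2:
  assumes p: "1 < p" "p < 2" and al: "0 \<le> \<alpha>" "\<alpha> < p - 1"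
  shows "\<exists>C>0. \<forall>r (u :: real \<Rightarrow> complex). 0 \<le> r \<and> r < 1 \<and> integrable circ_meas u \<longrightarrow>
    (\<integral>\<^sup>+ t. ennreal (cmod (szego u (of_real r * cis t)) powr p * wt \<alpha> 1 t) \<partial>circ_meas)
    \<le> ennreal C * (\<integral>\<^sup>+ t. ennreal (cmod (u t) powr p * wt \<alpha> r t) \<partial>circ_meas)"
proof -
  define q where "q = p / (p - 1)"
  define \<beta> where "\<beta> = - \<alpha> / (p - 1)"
  have q: "q > 2" "1 / p + 1 / q = 1" "q * (p - 1) = p" using p by (auto simp: q_def field_simps)
  have be: "-1 < \<beta>" "\<beta> \<le> 0" using p al by (auto simp: \<beta>_def field_simps)
  have "\<alpha> * q + \<beta> = \<alpha> * ((p - 1) / (p - 1))"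
    unfolding q_def \<beta>_def diff_divide_distrib by (simp add: right_diff_distrib)
  then have aq: "\<alpha> * q + \<beta> = \<alpha>" using p by simp
  have aq': "\<alpha> * (- q / p) = \<beta>" using p by (simp add: q_def \<beta>_def field_simps)
  obtain C0 where C0: "C0 > 0" and bC: "\<And>r (u :: real \<Rightarrow> complex). 0 \<le> r \<Longrightarrow> r < 1 \<Longrightarrow> u \<in> borel_measurable circ_meas \<Longrightarrow>
    (\<integral>\<^sup>+ t. ennreal (cmod (szego u (of_real r * cis t)) powr q * wt \<beta> r t) \<partial>circ_meas)
    \<le> ennreal C0 * (\<integral>\<^sup>+ t. ennreal (cmod (u t) powr q * wt \<beta> 1 t) \<partial>circ_meas)"
    using szego_bound_ge_2[of q, OF _ be] q by fastforce
  \<comment> \<open>Young's inequality is scaled by \<tau> so that the term with S k contributes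
    exactly half of the left-hand side.\<close>
  define \<tau> where "\<tau> = (2 * C0 / q) powr (1 / q)"
  have tau: "\<tau> > 0" using C0 q by (simp add: \<tau>_def)
  have tauq: "\<tau> powr (- q) / q * C0 = 1 / 2"
    using C0 q by (simp add: \<tau>_def powr_powr powr_minus field_simps)
  define C where "C = 2 * \<tau> powr p / p"
  have C: "C > 0" using tau p by (simp add: C_def)
  show ?thesis
  proof (intro exI[of _ C] conjI C allI impI)
    fix r :: real and u :: "real \<Rightarrow> complex"
    assume "0 \<le> r \<and> r < 1 \<and> integrable circ_meas u"
    then have r: "0 \<le> r" "r < 1" and u: "integrable circ_meas u" by auto
    have um [measurable]: "u \<in> borel_measurable circ_meas" using u by simp
    define v where "v = (\<lambda>t. szego u (of_real r * cis t))"
    have contv: "continuous_on {0..2*pi} v" unfolding v_def by (intro continuous_szego_circle u r)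
    have [measurable]: "v \<in> borel_measurable circ_meas" using contv by (rule measurable_continuous_circ)
    \<comment> \<open>The extremal function of Hoelder's inequality: v cnj k is the integrand |v|^p
      wt, and so is |k|^q times the dual weight, because \<alpha> q + \<beta> = \<alpha>.\<close>
    define k where "k = (\<lambda>t. v t * of_real (cmod (v t) powr (p - 2) * wt \<alpha> 1 t))"
    have km [measurable]: "k \<in> borel_measurable circ_meas" unfolding k_def by measurable
    have ck: "cmod (k t) = cmod (v t) powr (p - 1) * wt \<alpha> 1 t" for t
    proof (cases "v t = 0")
      case False
      have "cmod (v t) * cmod (v t) powr (p - 2) = cmod (v t) powr 1 * cmod (v t) powr (p - 2)" by simp
      also have "\<dots> = cmod (v t) powr (p - 1)" unfolding powr_add[symmetric] by simp
      finally show ?thesis by (simp add: k_def norm_mult mult.assoc[symmetric])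
    qed (simp add: k_def)
    have vk: "v t * cnj (k t) = of_real (cmod (v t) powr p * wt \<alpha> 1 t)" for t
    proof (cases "v t = 0")
      case False
      have "(cmod (v t))\<^sup>2 * cmod (v t) powr (p - 2) = cmod (v t) powr 2 * cmod (v t) powr (p - 2)"
        using False by (simp add: powr_numeral)
      also have "\<dots> = cmod (v t) powr p" unfolding powr_add[symmetric] by simp
      finally have "cmod (v t) powr p * wt \<alpha> 1 t = (cmod (v t))\<^sup>2 * (cmod (v t) powr (p - 2) * wt \<alpha> 1 t)"
        by (simp add: mult.assoc[symmetric])
      then have "of_real (cmod (v t) powr p * wt \<alpha> 1 t)
        = of_real ((cmod (v t))\<^sup>2) * complex_of_real (cmod (v t) powr (p - 2) * wt \<alpha> 1 t)"
        by (simp only: of_real_mult)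
      then show ?thesis unfolding complex_norm_square k_def complex_cnj_mult complex_cnj_complex_of_real
        by (simp only: mult.assoc)
    qed (simp add: k_def)
    have kq: "cmod (k t) powr q * wt \<beta> 1 t = cmod (v t) powr p * wt \<alpha> 1 t" for t
    proof -
      have "wt \<alpha> 1 t powr q * wt \<beta> 1 t = wt \<alpha> 1 t"
        unfolding wt_def powr_powr powr_add[symmetric] aq ..
      moreover have "cmod (k t) powr q = cmod (v t) powr p * wt \<alpha> 1 t powr q"
        unfolding ck using q(3) by (simp add: powr_mult powr_powr mult.commute)
      ultimately show ?thesis by (simp add: mult.assoc)
    qed
    obtain Bv where Bv: "\<And>t. t \<in> {0..2*pi} \<Longrightarrow> cmod (v t) \<le> Bv"
      using compact_imp_bounded[OF compact_continuous_image[OF contv compact_Icc]] unfolding bounded_iff by blast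
    have wb: "wt \<alpha> 1 t \<le> 2 powr \<alpha>" for t
      unfolding wt_def using norm_triangle_ineq4[of 1 "cis t"] al by (intro powr_mono2) auto
    have kb: "cmod (k t) \<le> Bv powr (p - 1) * 2 powr \<alpha>" if "t \<in> {0..2*pi}" for t
      unfolding ck using Bv[OF that] wb p by (intro mult_mono powr_mono2) auto
    have ik: "integrable circ_meas k" using km kb by (rule integrable_circ_bounded)
    have ix: "integrable circ_meas (\<lambda>t. cmod (v t) powr p * wt \<alpha> 1 t)"
    proof (rule circ.integrable_const_bound[of _ "Bv powr p * 2 powr \<alpha>"])
      show "AE t in circ_meas. norm (cmod (v t) powr p * wt \<alpha> 1 t) \<le> Bv powr p * 2 powr \<alpha>"
        using Bv wb p by (intro AE_I2) (auto intro!: mult_mono powr_mono2)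
    qed measurable
    define x where "x = (LINT t|circ_meas. cmod (v t) powr p * wt \<alpha> 1 t)"
    have x0: "x \<ge> 0" unfolding x_def by (intro Bochner_Integration.integral_nonneg) auto
    have X: "(\<integral>\<^sup>+ t. ennreal (cmod (v t) powr p * wt \<alpha> 1 t) \<partial>circ_meas) = ennreal x"
      unfolding x_def by (intro nn_integral_eq_integral ix) auto
    let ?Y = "\<integral>\<^sup>+ t. ennreal (cmod (u t) powr p * wt \<alpha> r t) \<partial>circ_meas"
    define S where "S = (\<lambda>s. szego k (of_real r * cis s))"
    have [measurable]: "S \<in> borel_measurable circ_meas"
      unfolding S_def by (intro measurable_continuous_circ continuous_szego_circle ik r)
    have "complex_of_real x = (LINT t|circ_meas. v t * cnj (k t))"
      unfolding x_def vk by (rule integral_complex_of_real[symmetric])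
    also have "\<dots> = (LINT s|circ_meas. u s * cnj (S s))"
      unfolding v_def S_def by (rule szego_selfadjoint[OF u km kb r])
    finally have "ennreal (cmod (complex_of_real x)) = ennreal (cmod (LINT s|circ_meas. u s * cnj (S s)))"
      by simp
    \<comment> \<open>If the product were not integrable, its integral would be 0 by convention, and
      then x = 0.\<close>
    then have "ennreal x \<le> (\<integral>\<^sup>+ s. ennreal (cmod (u s * cnj (S s))) \<partial>circ_meas)"
      using x0 integral_norm_bound_ennreal[of circ_meas "\<lambda>s. u s * cnj (S s)"]
      by (cases "integrable circ_meas (\<lambda>s. u s * cnj (S s))") (auto simp: not_integrable_integral_eq)
    also have "\<dots> \<le> (\<integral>\<^sup>+ s. ennreal (\<tau> powr p / p) * ennreal (cmod (u s) powr p * wt \<alpha> r s)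
        + ennreal (\<tau> powr (- q) / q) * ennreal (cmod (S s) powr q * wt \<beta> r s) \<partial>circ_meas)"
    proof (rule nn_integral_mono)
      fix s
      \<comment> \<open>The weight is split between the two factors: its power 1/p goes to u, its
        power -1/p to S, and raising the latter to the power q produces exactly the weight of
        exponent \<beta>.\<close>
      define W where "W = wt \<alpha> r s"
      have W: "W > 0" unfolding W_def by (rule wt_pos[OF r])
      have "cmod (u s) * cmod (S s) = (\<tau> * cmod (u s) * W powr (1 / p)) * (1 / \<tau> * cmod (S s) * W powr (- 1 / p))"
        using tau W by (simp add: powr_minus)
      also have "\<dots> \<le> (\<tau> * cmod (u s) * W powr (1 / p)) powr p / p + (1 / \<tau> * cmod (S s) * W powr (- 1 / p)) powr q / q"
        using p q tau by (intro Youngs_inequality) auto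
      also have "(\<tau> * cmod (u s) * W powr (1 / p)) powr p = \<tau> powr p * (cmod (u s) powr p * W)"
        using tau W p by (simp add: powr_mult powr_powr)
      also have "(1 / \<tau> * cmod (S s) * W powr (- 1 / p)) powr q = \<tau> powr (- q) * (cmod (S s) powr q * W powr (- q / p))"
        using tau W p by (simp add: powr_mult powr_powr powr_divide powr_minus field_simps)
      also have "W powr (- q / p) = wt \<beta> r s"
        unfolding W_def wt_def powr_powr aq' ..
      finally show "ennreal (cmod (u s * cnj (S s))) \<le> ennreal (\<tau> powr p / p) * ennreal (cmod (u s) powr p * wt \<alpha> r s)
        + ennreal (\<tau> powr (- q) / q) * ennreal (cmod (S s) powr q * wt \<beta> r s)"
        using p q by (simp add: norm_mult W_def ennreal_leI flip: ennreal_mult ennreal_plus)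
    qed
    also have "\<dots> = ennreal (\<tau> powr p / p) * ?Y
        + ennreal (\<tau> powr (- q) / q) * (\<integral>\<^sup>+ s. ennreal (cmod (S s) powr q * wt \<beta> r s) \<partial>circ_meas)"
      by (simp add: nn_integral_add nn_integral_cmult)
    also have "\<dots> \<le> ennreal (\<tau> powr p / p) * ?Y
        + ennreal (\<tau> powr (- q) / q) * (ennreal C0 * (\<integral>\<^sup>+ t. ennreal (cmod (k t) powr q * wt \<beta> 1 t) \<partial>circ_meas))"
      unfolding S_def by (intro add_left_mono mult_left_mono bC r km) auto
    also have "\<dots> = ennreal (\<tau> powr p / p) * ?Y + ennreal (1 / 2 * x)"
      unfolding kq X tauq[symmetric] using C0 q x0 by (simp flip: ennreal_mult add: mult.assoc)
    finally have main: "ennreal x \<le> ennreal (\<tau> powr p / p) * ?Y + ennreal (1 / 2 * x)" .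
    \<comment> \<open>Half of x is absorbed on the left. This is legitimate because x is a real
      number: v is continuous on the parameter interval and the weight is bounded for \<alpha> \<ge>
      0.\<close>
    have "ennreal x \<le> ennreal C * ?Y"
    proof (cases "?Y = \<infinity>")
      case True
      then show ?thesis using C by (simp add: ennreal_mult_top)
    next
      case False
      then obtain y where y: "?Y = ennreal y" "y \<ge> 0" by (cases ?Y) auto
      have "ennreal x \<le> ennreal (\<tau> powr p / p * y + 1 / 2 * x)"
        using main p x0 y by (simp flip: ennreal_mult ennreal_plus)
      then have "x \<le> \<tau> powr p / p * y + 1 / 2 * x" using x0 y p by (subst (asm) ennreal_le_iff) auto
      then have "x \<le> C * y" by (simp add: C_def)
      then show ?thesis using y C by (simp flip: ennreal_mult add: ennreal_leI)
    qed
    then show "(\<integral>\<^sup>+ t. ennreal (cmod (szego u (of_real r * cis t)) powr p * wt \<alpha> 1 t) \<partial>circ_meas) \<le> ennreal C * ?Y"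
      unfolding X[symmetric] v_def .
  qed
qed

subsection \<open>Boundary values of functions in the Hardy space\<close>

lemma integrable_of_L2:
  fixes f :: "real \<Rightarrow> complex"
  assumes [measurable]: "f \<in> borel_measurable circ_meas"
    and b: "(\<integral>\<^sup>+ t. ennreal ((cmod (f t))\<^sup>2) \<partial>circ_meas) < \<infinity>"
  shows "integrable circ_meas (\<lambda>t. (cmod (f t))\<^sup>2)" "integrable circ_meas f"
proof -
  show i: "integrable circ_meas (\<lambda>t. (cmod (f t))\<^sup>2)"
    using b by (intro integrableI_bounded) auto
  show "integrable circ_meas f"
  proof (rule Bochner_Integration.integrable_bound)
    show "integrable circ_meas (\<lambda>t. 1 + (cmod (f t))\<^sup>2)" using i by simp
    have "x \<le> 1 + x\<^sup>2" for x :: real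
    proof -
      have "2 * x \<le> 1 + x\<^sup>2" using zero_le_power2[of "x - 1"] by (simp add: power2_eq_square algebra_simps)
      then show ?thesis using zero_le_power2[of x] by linarith
    qed
    then show "AE t in circ_meas. norm (f t) \<le> norm (1 + (cmod (f t))\<^sup>2)"
      by (intro AE_I2) (auto intro: order_trans)
  qed simp
qed

text \<open>A bound in L^2 gives uniform integrability: x \<le> min x K + x^2 / K, where the first
  term converges by domination and the second is uniformly small for large K.\<close>

lemma L2_bounded_AE_tendsto_L1:
  fixes f :: "nat \<Rightarrow> real \<Rightarrow> complex"
  assumes fm [measurable]: "\<And>n. f n \<in> borel_measurable circ_meas" and Fm [measurable]: "F \<in> borel_measurable circ_meas"
    and lim: "AE t in circ_meas. (\<lambda>n. f n t) \<longlonglongrightarrow> F t"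
    and B: "\<And>n. (\<integral>\<^sup>+ t. ennreal ((cmod (f n t))\<^sup>2) \<partial>circ_meas) \<le> ennreal B"
  shows "integrable circ_meas F" "(\<lambda>n. LINT t|circ_meas. cmod (f n t - F t)) \<longlonglongrightarrow> 0"
proof -
  have "(\<integral>\<^sup>+ t. ennreal ((cmod (F t))\<^sup>2) \<partial>circ_meas) = (\<integral>\<^sup>+ t. liminf (\<lambda>n. ennreal ((cmod (f n t))\<^sup>2)) \<partial>circ_meas)"
  proof (rule nn_integral_cong_AE, use lim in eventually_elim)
    case (elim t)
    then have "(\<lambda>n. ennreal ((cmod (f n t))\<^sup>2)) \<longlonglongrightarrow> ennreal ((cmod (F t))\<^sup>2)"
      by (intro tendsto_intros)
    then show ?case by (intro lim_imp_Liminf[symmetric]) auto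
  qed
  also have "\<dots> \<le> liminf (\<lambda>n. \<integral>\<^sup>+ t. ennreal ((cmod (f n t))\<^sup>2) \<partial>circ_meas)"
    by (rule nn_integral_liminf) measurable
  also have "\<dots> \<le> ennreal B"
    using B by (intro Liminf_le) (auto intro: always_eventually)
  finally have FB: "(\<integral>\<^sup>+ t. ennreal ((cmod (F t))\<^sup>2) \<partial>circ_meas) \<le> ennreal B" .
  have fin: "x < \<infinity>" if "x \<le> ennreal B" for x using that by (rule le_less_trans) simp
  note iF = integrable_of_L2[OF Fm fin[OF FB]] and ifn = integrable_of_L2[OF fm fin[OF B]]
  show "integrable circ_meas F" by (rule iF(2))
  define b where "b = max B 0"
  have LB: "(LINT t|circ_meas. (cmod (h t))\<^sup>2) \<le> b"
    if "(\<integral>\<^sup>+ t. ennreal ((cmod (h t))\<^sup>2) \<partial>circ_meas) \<le> ennreal B" "integrable circ_meas (\<lambda>t. (cmod (h t))\<^sup>2)" for h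
  proof -
    have "ennreal (LINT t|circ_meas. (cmod (h t))\<^sup>2) \<le> ennreal b"
      using that(1) by (subst nn_integral_eq_integral[symmetric, OF that(2)]) (auto simp: b_def max_def ennreal_neg)
    then show ?thesis by (subst (asm) ennreal_le_iff) (auto simp: b_def)
  qed
  show "(\<lambda>n. LINT t|circ_meas. cmod (f n t - F t)) \<longlonglongrightarrow> 0"
  proof (rule LIMSEQ_I)
    fix e :: real assume e: "e > 0"
    \<comment> \<open>The tail is at most 4 b / K \<le> e / 2; the summand 1 keeps K positive when b
      = 0.\<close>
    define K where "K = (8 * b + 1) / e"
    have K: "K > 0" using e by (simp add: K_def b_def add_nonneg_pos)
    have "(\<lambda>n. LINT t|circ_meas. min (cmod (f n t - F t)) K) \<longlonglongrightarrow> (LINT t|circ_meas. 0)"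
    proof (rule integral_dominated_convergence[where w = "\<lambda>_. K"])
      show "AE t in circ_meas. (\<lambda>n. min (cmod (f n t - F t)) K) \<longlonglongrightarrow> 0"
        using lim
      proof eventually_elim
        case (elim t)
        then have "(\<lambda>n. min (cmod (f n t - F t)) K) \<longlonglongrightarrow> min (cmod (F t - F t)) K"
          by (intro tendsto_intros)
        then show ?case using K by simp
      qed
      show "AE t in circ_meas. norm (min (cmod (f n t - F t)) K) \<le> K" for n using K by (intro AE_I2) auto
    qed auto
    then obtain N where N: "\<And>n. n \<ge> N \<Longrightarrow> \<bar>LINT t|circ_meas. min (cmod (f n t - F t)) K\<bar> < e / 2"
      using e by (fastforce dest!: LIMSEQ_D[where r = "e/2"])
    show "\<exists>no. \<forall>n\<ge>no. norm ((LINT t|circ_meas. cmod (f n t - F t)) - 0) < e"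
    proof (intro exI[of _ N] allI impI)
      fix n assume n: "n \<ge> N"
      have i1: "integrable circ_meas (\<lambda>t. cmod (f n t - F t))" using ifn(2)[of n] iF(2) by simp
      have i2: "integrable circ_meas (\<lambda>t. min (cmod (f n t - F t)) K)"
        by (rule Bochner_Integration.integrable_bound[OF i1]) (use K in auto)
      have i3: "integrable circ_meas (\<lambda>t. (2 / K) * ((cmod (f n t))\<^sup>2 + (cmod (F t))\<^sup>2))"
        using ifn(1)[of n] iF(1) by simp
      have "(LINT t|circ_meas. cmod (f n t - F t))
        \<le> (LINT t|circ_meas. min (cmod (f n t - F t)) K + (2 / K) * ((cmod (f n t))\<^sup>2 + (cmod (F t))\<^sup>2))"
      proof (rule integral_mono[OF i1 Bochner_Integration.integrable_add[OF i2 i3]])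
        fix t
        define x where "x = cmod (f n t - F t)"
        have "x \<le> cmod (f n t) + cmod (F t)" unfolding x_def by (rule norm_triangle_ineq4)
        then have "x\<^sup>2 \<le> (cmod (f n t) + cmod (F t))\<^sup>2" unfolding x_def by (intro power_mono) auto
        also have "\<dots> \<le> 2 * ((cmod (f n t))\<^sup>2 + (cmod (F t))\<^sup>2)"
          using zero_le_power2[of "cmod (f n t) - cmod (F t)"] by (simp add: power2_eq_square algebra_simps)
        finally have x2: "x\<^sup>2 / K \<le> (2 / K) * ((cmod (f n t))\<^sup>2 + (cmod (F t))\<^sup>2)"
          using K by (simp add: divide_simps)
        have "x \<le> min x K + x\<^sup>2 / K"
        proof (cases "x \<le> K")
          case False
          then have "K * x \<le> x * x" using K by (intro mult_right_mono) auto
          then have "x \<le> x\<^sup>2 / K" using K by (simp add: power2_eq_square field_simps)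
          then show ?thesis using False K by simp
        qed (use K in auto)
        with x2 show "x \<le> min x K + (2 / K) * ((cmod (f n t))\<^sup>2 + (cmod (F t))\<^sup>2)" by linarith
      qed
      also have "\<dots> = (LINT t|circ_meas. min (cmod (f n t - F t)) K)
          + (2 / K) * ((LINT t|circ_meas. (cmod (f n t))\<^sup>2) + (LINT t|circ_meas. (cmod (F t))\<^sup>2))"
        using i2 i3 ifn(1)[of n] iF(1) by (simp add: Bochner_Integration.integral_add)
      also have "\<dots> < e / 2 + (2 / K) * (b + b)"
        using N[OF n] K LB[OF B ifn(1)] LB[OF FB iF(1)]
        by (intro add_less_le_mono mult_left_mono add_mono) auto
      also have "\<dots> \<le> e / 2 + e / 2"
        using e by (auto simp: K_def b_def field_simps)
      finally show "norm ((LINT t|circ_meas. cmod (f n t - F t)) - 0) < e"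
        by (simp add: Bochner_Integration.integral_nonneg)
    qed
  qed
qed

lemma L2_bounded_AE_tendsto_weak:
  fixes f :: "nat \<Rightarrow> real \<Rightarrow> complex"
  assumes fm: "\<And>n. f n \<in> borel_measurable circ_meas" and Fm: "F \<in> borel_measurable circ_meas"
    and lim: "AE t in circ_meas. (\<lambda>n. f n t) \<longlonglongrightarrow> F t"
    and B: "\<And>n. (\<integral>\<^sup>+ t. ennreal ((cmod (f n t))\<^sup>2) \<partial>circ_meas) \<le> ennreal B"
    and \<phi> [measurable]: "\<phi> \<in> borel_measurable circ_meas" and K: "\<And>t. cmod (\<phi> t) \<le> K"
  shows "(\<lambda>n. LINT t|circ_meas. f n t * \<phi> t) \<longlonglongrightarrow> (LINT t|circ_meas. F t * \<phi> t)"
proof -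
  note L = L2_bounded_AE_tendsto_L1[OF fm Fm lim B]
  have ifn: "integrable circ_meas (f n)" for n
    using le_less_trans[OF B ennreal_less_top] by (intro integrable_of_L2(2) fm) auto
  have ip: "integrable circ_meas (\<lambda>t. h t * \<phi> t)" if h: "integrable circ_meas h" for h
  proof (rule Bochner_Integration.integrable_bound[OF integrable_mult_left[OF h, of "of_real K"]])
    show "(\<lambda>t. h t * \<phi> t) \<in> borel_measurable circ_meas" using h by measurable
    show "AE t in circ_meas. norm (h t * \<phi> t) \<le> norm (h t * of_real K)"
      using K by (intro AE_I2) (auto simp: norm_mult intro!: mult_left_mono intro: order_trans[OF _ abs_ge_self])
  qed
  have K0: "0 \<le> K" using order_trans[OF norm_ge_zero K] .
  show ?thesis
  proof (rule LIM_zero_cancel, rule Lim_null_comparison)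
    show "(\<lambda>n. (LINT t|circ_meas. cmod (f n t - F t)) * K) \<longlonglongrightarrow> 0"
      using tendsto_mult_left_zero[OF L(2)] .
    show "\<forall>\<^sub>F n in sequentially. norm ((LINT t|circ_meas. f n t * \<phi> t) - (LINT t|circ_meas. F t * \<phi> t))
      \<le> (LINT t|circ_meas. cmod (f n t - F t)) * K"
    proof (rule always_eventually, rule allI)
      fix n
      have "(LINT t|circ_meas. f n t * \<phi> t) - (LINT t|circ_meas. F t * \<phi> t)
          = (LINT t|circ_meas. (f n t - F t) * \<phi> t)"
        by (simp only: left_diff_distrib Bochner_Integration.integral_diff[OF ip[OF ifn] ip[OF L(1)]])
      also have "norm \<dots> \<le> (LINT t|circ_meas. norm ((f n t - F t) * \<phi> t))"
        by (rule integral_norm_bound)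
      also have "\<dots> \<le> (LINT t|circ_meas. cmod (f n t - F t) * K)"
      proof (rule integral_mono)
        show "integrable circ_meas (\<lambda>t. norm ((f n t - F t) * \<phi> t))"
          using ifn[of n] L(1) by (intro integrable_norm ip) auto
        show "integrable circ_meas (\<lambda>t. cmod (f n t - F t) * K)"
          using ifn[of n] L(1) by auto
        show "norm ((f n t - F t) * \<phi> t) \<le> cmod (f n t - F t) * K" for t
          unfolding norm_mult by (intro mult_left_mono K) simp
      qed
      finally show "norm ((LINT t|circ_meas. f n t * \<phi> t) - (LINT t|circ_meas. F t * \<phi> t))
        \<le> (LINT t|circ_meas. cmod (f n t - F t)) * K" by simp
    qed
  qed
qed

text \<open>Fatou's lemma and dominated convergence are applied along this sequence of
  radii.\<close>

definition rad :: "nat \<Rightarrow> real" where "rad n = 1 - 1 / real (n + 2)"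

lemma rad_bounds: "0 \<le> rad n" "rad n < 1"
  by (auto simp: rad_def field_simps)

lemma rad_tendsto: "filterlim rad (at_left 1) sequentially"
proof -
  have "rad \<longlonglongrightarrow> 1 - 0"
    unfolding rad_def by (intro tendsto_diff tendsto_const LIMSEQ_ignore_initial_segment[OF lim_1_over_n])
  then show ?thesis
    unfolding filterlim_at using rad_bounds by (auto intro!: always_eventually less_imp_neq)
qed

text \<open>The dilates of G are holomorphic on the closed disc, so they satisfy Cauchy's formula
  and have no Fourier coefficients of negative index; both facts survive the limit because the test
  functions are bounded.\<close>

lemma hardy_boundary_integral:
  assumes G: "G holomorphic_on ball 0 1" and Gs: "Gs \<in> borel_measurable circ_meas"
    and B: "\<And>r. 0 \<le> r \<Longrightarrow> r < 1 \<Longrightarrow> (\<integral>\<^sup>+ t. ennreal ((cmod (G (of_real r * cis t)))\<^sup>2) \<partial>circ_meas) \<le> ennreal B"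
    and lim: "AE t in circ_meas. ((\<lambda>r. G (of_real r * cis t)) \<longlongrightarrow> Gs t) (at_left 1)"
  shows "integrable circ_meas Gs"
    and "\<And>a. cmod a < 1 \<Longrightarrow> szego Gs a = G a"
    and "\<And>j. (LINT t|circ_meas. Gs t * cis t ^ Suc j) = 0"
proof -
  define f where "f = (\<lambda>n t. G (of_real (rad n) * cis t))"
  have fm: "f n \<in> borel_measurable circ_meas" for n
    unfolding f_def by (intro measurable_continuous_circ continuous_circle_of_holomorphic G rad_bounds)
  have fl: "AE t in circ_meas. (\<lambda>n. f n t) \<longlonglongrightarrow> Gs t"
    using lim unfolding f_def by eventually_elim (erule filterlim_compose[OF _ rad_tendsto])
  have fB: "(\<integral>\<^sup>+ t. ennreal ((cmod (f n t))\<^sup>2) \<partial>circ_meas) \<le> ennreal B" for n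
    unfolding f_def by (intro B rad_bounds)
  have rc: "cmod (of_real (rad n) * z) < 1" if "cmod z \<le> 1" for n z
  proof -
    have "rad n * cmod z \<le> rad n * 1" using that rad_bounds[of n] by (intro mult_left_mono) auto
    then show ?thesis using rad_bounds[of n] by (simp add: norm_mult)
  qed
  have Gr: "(\<lambda>z. G (of_real (rad n) * z)) holomorphic_on cball 0 1" for n
    by (rule holomorphic_on_compose_gen[OF _ G, unfolded o_def]) (use rc in \<open>auto intro!: holomorphic_intros\<close>)
  have Gc: "continuous_on (cball 0 1) (\<lambda>z. G (of_real (rad n) * z))"
    and Gb: "(\<lambda>z. G (of_real (rad n) * z)) holomorphic_on ball 0 1" for n
    using Gr[of n] by (auto intro: holomorphic_on_imp_continuous_on holomorphic_on_subset)
  show "integrable circ_meas Gs" by (rule L2_bounded_AE_tendsto_L1(1)[OF fm Gs fl fB])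
  show "szego Gs a = G a" if a: "cmod a < 1" for a
  proof -
    have l1: "(\<lambda>n. LINT t|circ_meas. f n t * (1 / (1 - a * cis (- t)))) \<longlonglongrightarrow> (LINT t|circ_meas. Gs t * (1 / (1 - a * cis (- t))))"
      by (rule L2_bounded_AE_tendsto_weak[OF fm Gs fl fB]) (use a in \<open>auto intro!: cauchy_kernel_bound measurable_kernel\<close>)
    have l2: "(LINT t|circ_meas. f n t * (1 / (1 - a * cis (- t)))) = 2 * pi * G (of_real (rad n) * a)" for n
      using Cauchy_circ_meas(2)[OF Gc Gb a] by (simp add: f_def)
    have l3: "(\<lambda>n. 2 * pi * G (of_real (rad n) * a)) \<longlonglongrightarrow> 2 * pi * G (of_real 1 * a)"
    proof (intro tendsto_intros isCont_tendsto_compose[of _ G])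
      show "isCont G (of_real 1 * a)"
        using a holomorphic_on_imp_continuous_on[OF G] by (simp add: continuous_on_eq_continuous_at)
      show "rad \<longlonglongrightarrow> 1" using rad_tendsto by (simp add: filterlim_at)
    qed
    have "(LINT t|circ_meas. Gs t * (1 / (1 - a * cis (- t)))) = 2 * pi * G (of_real 1 * a)"
      using l1 l3 unfolding l2 by (rule LIMSEQ_unique)
    then show ?thesis by (simp add: szego_def)
  qed
  show "(LINT t|circ_meas. Gs t * cis t ^ Suc j) = 0" for j
  proof -
    have "(\<lambda>n. LINT t|circ_meas. f n t * cis t ^ Suc j) \<longlonglongrightarrow> (LINT t|circ_meas. Gs t * cis t ^ Suc j)"
    proof (rule L2_bounded_AE_tendsto_weak[OF fm Gs fl fB])
      show "(\<lambda>t. cis t ^ Suc j) \<in> borel_measurable circ_meas"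
        by (intro measurable_continuous_circ continuous_intros)
      show "cmod (cis t ^ Suc j) \<le> 1" for t by (simp add: norm_power norm_mult)
    qed
    moreover have "(LINT t|circ_meas. f n t * cis t ^ Suc j) = 0" for n
    proof -
      have "(LINT t|circ_meas. f n t * cis t ^ Suc j) = 2 * pi * (G (of_real (rad n) * 0) * 0 ^ Suc j)"
        unfolding f_def
        by (rule mean_value_circ_meas(2)[of "\<lambda>z. G (of_real (rad n) * z) * z ^ Suc j"])
          (intro continuous_intros holomorphic_intros Gc Gb)+
      then show ?thesis by simp
    qed
    ultimately have "(\<lambda>n. 0) \<longlonglongrightarrow> (LINT t|circ_meas. Gs t * cis t ^ Suc j)" by simp
    then show ?thesis by (simp add: LIMSEQ_const_iff)
  qed
qed

subsection \<open>The weight\<close>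

text \<open>The principal branch is harmless, since 1 - z has positive real part on the disc. At z =
  1 the convention for powers of 0 gives the value 0, the continuous extension for a > 0.\<close>

definition gpow :: "real \<Rightarrow> complex \<Rightarrow> complex" where
  "gpow a z = (1 - z) powr of_real a"

lemma gpow_holomorphic: "gpow a holomorphic_on ball 0 1"
proof -
  have "1 - z \<notin> \<real>\<^sub>\<le>\<^sub>0" if "z \<in> ball 0 1" for z :: complex
    using that complex_Re_le_cmod[of z] by (auto simp: complex_nonpos_Reals_iff)
  then show ?thesis
    unfolding gpow_def[abs_def] by (auto intro!: holomorphic_intros simp del: complex_nonpos_Reals_iff)
qed

lemma gpow_nonzero: "gpow a z \<noteq> 0" if "z \<noteq> 1"
  using that by (simp add: gpow_def)

lemma cmod_gpow: "cmod (gpow a z) = cmod (1 - z) powr a"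
  by (simp add: gpow_def norm_powr_real_powr')

lemma gpow_continuous:
  assumes "a > 0" shows "continuous_on (cball 0 1) (gpow a)"
  unfolding gpow_def[abs_def]
proof (rule continuous_on_powr_complex)
  show "cball 0 1 \<subseteq> {z. 0 \<le> Re (1 - z) \<or> Im (1 - z) \<noteq> 0}"
  proof
    fix z :: complex assume "z \<in> cball 0 1"
    then have "Re z \<le> 1" using complex_Re_le_cmod[of z] by simp
    then show "z \<in> {z. 0 \<le> Re (1 - z) \<or> Im (1 - z) \<noteq> 0}" by simp
  qed
qed (use assms in \<open>auto intro!: continuous_intros\<close>)

lemma continuous_boundary:
  assumes "continuous_on (cball 0 1) F"
  shows "continuous_on {0..2*pi} (\<lambda>t. F (cis t))"
  by (rule continuous_on_compose2[OF assms]) (auto intro!: continuous_intros)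

lemma radial_limit_continuous:
  assumes "continuous_on (cball 0 1) F"
  shows "((\<lambda>r. F (of_real r * cis t)) \<longlongrightarrow> F (cis t)) (at_left 1)"
proof -
  have "((\<lambda>r. of_real r * cis t) \<longlongrightarrow> of_real 1 * cis t) (at_left (1::real))"
    by (intro tendsto_intros)
  moreover have "eventually (\<lambda>r. of_real r * cis t \<in> cball 0 1) (at_left (1::real))"
    using eventually_at_left_real[of 0 1] by (rule eventually_mono) (auto simp: norm_mult)
  ultimately show ?thesis
    using continuous_on_tendsto_compose[OF assms, of "\<lambda>r. of_real r * cis t" "of_real 1 * cis t"] by simp
qed

definition pull :: "real \<Rightarrow> (complex \<Rightarrow> complex) \<Rightarrow> real \<Rightarrow> complex" where
  "pull a f t = f (cis t) * gpow a (cis t)"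

lemma measurable_pull:
  assumes "a > 0" "(\<lambda>t. f (cis t)) \<in> borel_measurable circ_meas"
  shows "pull a f \<in> borel_measurable circ_meas"
  unfolding pull_def[abs_def]
  by (intro borel_measurable_times assms(2) measurable_continuous_circ continuous_boundary gpow_continuous assms(1))

text \<open>Of |g|^2 the part |g|^p goes into |f g|^p, which leaves |1 - z| to the power 2 a - a
  p.\<close>

lemma weight_pull:
  assumes "cis t \<noteq> 1"
  shows "cmod (f (cis t)) powr p * (cmod (gpow a (cis t)))\<^sup>2 = cmod (pull a f t) powr p * wt (a * (2 - p)) 1 t"
proof -
  define c where "c = cmod (1 - cis t)"
  have c: "c > 0" using assms by (simp add: c_def)
  have "(c powr a)\<^sup>2 = c powr (a * p) * c powr (a * (2 - p))"
    using c by (simp add: power2_eq_square algebra_simps flip: powr_add)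
  then show ?thesis
    by (simp add: pull_def norm_mult cmod_gpow powr_mult powr_powr wt_def c_def[symmetric] mult.assoc)
qed

lemma nn_integral_pull:
  "(\<integral>\<^sup>+ t. ennreal (cmod (f (cis t)) powr p * (cmod (gpow a (cis t)))\<^sup>2) \<partial>circ_meas)
   = (\<integral>\<^sup>+ t. ennreal (cmod (pull a f t) powr p * wt (a * (2 - p)) 1 t) \<partial>circ_meas)"
  by (rule nn_integral_cong_AE, use AE_circ_meas_cis in eventually_elim) (simp add: weight_pull)

lemma nn_integral_pull_2:
  "(\<integral>\<^sup>+ t. ennreal (cmod (f (cis t)) powr 2 * (cmod (gpow a (cis t)))\<^sup>2) \<partial>circ_meas)
   = (\<integral>\<^sup>+ t. ennreal ((cmod (pull a f t))\<^sup>2) \<partial>circ_meas)"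
  by (rule nn_integral_cong_AE, use AE_circ_meas_cis in eventually_elim)
     (simp add: pull_def norm_mult power_mult_distrib)

text \<open>The product G of the holomorphic extension with g lies in the ordinary H^2. The
  conclusions collect what the later arguments use about members of the weighted space.\<close>

lemma H2_mu_boundary:
  assumes a: "a > 0" and k: "k \<in> H2_mu (gpow a)"
  obtains G where "AE t in circ_meas. ((\<lambda>r. G (of_real r * cis t)) \<longlongrightarrow> pull a k t) (at_left 1)"
    and "integrable circ_meas (pull a k)" and "\<And>z. cmod z < 1 \<Longrightarrow> szego (pull a k) z = G z"
    and "\<And>j. (LINT t|circ_meas. pull a k t * cis t ^ Suc j) = 0"
proof -
  obtain F where Lp: "Lp_mu 2 (gpow a) k" and F: "Hp_mu_hol 2 (gpow a) F" and bv: "boundary_value F k"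
    using k by (auto simp: H2_mu_def)
  define G where "G = (\<lambda>z. F z * gpow a z)"
  have G: "G holomorphic_on ball 0 1"
    unfolding G_def using F by (intro holomorphic_intros gpow_holomorphic) (simp add: Hp_mu_hol_def)
  obtain B where B: "\<And>r. 0 \<le> r \<Longrightarrow> r < 1 \<Longrightarrow>
      (\<integral>\<^sup>+ t. ennreal (cmod (F (of_real r * cis t)) powr 2 * (cmod (gpow a (of_real r * cis t)))\<^sup>2) \<partial>circ_meas) \<le> ennreal B"
    using F by (auto simp: Hp_mu_hol_def)
  have m: "pull a k \<in> borel_measurable circ_meas"
    using Lp by (intro measurable_pull a) (simp add: Lp_mu_def)
  have lim: "AE t in circ_meas. ((\<lambda>r. G (of_real r * cis t)) \<longlongrightarrow> pull a k t) (at_left 1)"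
    using bv[unfolded boundary_value_def]
  proof eventually_elim
    case (elim t)
    then show ?case
      unfolding G_def pull_def by (intro tendsto_mult radial_limit_continuous gpow_continuous a)
  qed
  have GB: "(\<integral>\<^sup>+ t. ennreal ((cmod (G (of_real r * cis t)))\<^sup>2) \<partial>circ_meas) \<le> ennreal B" if "0 \<le> r" "r < 1" for r
    using B[OF that] by (simp add: G_def norm_mult power_mult_distrib)
  show thesis
    by (rule that[OF lim]) (rule hardy_boundary_integral[OF G m GB lim]; assumption)+
qed

text \<open>In |\<phi> / g|^2 |g|^2 the zero of g cancels, leaving a bounded function. These
  quotients serve both as test functions that determine the projection and as explicit projections
  in the counterexamples.\<close>

lemma H2_mu_quotient:
  assumes a: "a > 0" and cont: "continuous_on (cball 0 1) \<phi>" and hol: "\<phi> holomorphic_on ball 0 1"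
  shows "(\<lambda>z. \<phi> z / gpow a z) \<in> H2_mu (gpow a)"
proof -
  have nz: "gpow a z \<noteq> 0" if "cmod z < 1" for z using that by (intro gpow_nonzero) auto
  obtain B where B: "\<And>z. z \<in> cball 0 1 \<Longrightarrow> cmod (\<phi> z) \<le> B"
    using compact_imp_bounded[OF compact_continuous_image[OF cont compact_cball]] unfolding bounded_iff by blast
  have bd: "(\<integral>\<^sup>+ t. ennreal (h t) \<partial>circ_meas) \<le> ennreal (B\<^sup>2 * (2 * pi))" if "\<And>t. h t \<le> B\<^sup>2" for h
  proof -
    have "(\<integral>\<^sup>+ t. ennreal (h t) \<partial>circ_meas) \<le> (\<integral>\<^sup>+ t. ennreal (B\<^sup>2) \<partial>circ_meas)"
      using that by (intro nn_integral_mono ennreal_leI)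
    also have "\<dots> = ennreal (B\<^sup>2 * (2 * pi))"
      using emeasure_circ_meas by (simp add: ennreal_mult)
    finally show ?thesis .
  qed
  have le: "cmod (\<phi> z / gpow a z) powr 2 * (cmod (gpow a z))\<^sup>2 \<le> B\<^sup>2" if "cmod z \<le> 1" for z
  proof (cases "gpow a z = 0")
    case False
    have "(cmod (\<phi> z))\<^sup>2 \<le> B\<^sup>2" using B[of z] that by (intro power_mono) auto
    then show ?thesis using False by (simp add: norm_divide power_divide)
  qed simp
  have "(\<lambda>t. \<phi> (cis t) / gpow a (cis t)) \<in> borel_measurable circ_meas"
    by (intro borel_measurable_divide measurable_continuous_circ continuous_boundary cont gpow_continuous a)
  then have "Lp_mu 2 (gpow a) (\<lambda>z. \<phi> z / gpow a z)"
    unfolding Lp_mu_def using le by (auto intro!: le_less_trans[OF bd])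
  moreover have "Hp_mu_hol 2 (gpow a) (\<lambda>z. \<phi> z / gpow a z)"
    unfolding Hp_mu_hol_def
  proof (intro conjI exI[of _ "B\<^sup>2 * (2 * pi)"] allI impI)
    show "(\<lambda>z. \<phi> z / gpow a z) holomorphic_on ball 0 1"
      using nz by (intro holomorphic_intros hol gpow_holomorphic) auto
    fix r :: real assume "0 \<le> r \<and> r < 1"
    then show "(\<integral>\<^sup>+ t. ennreal (cmod (\<phi> (of_real r * cis t) / gpow a (of_real r * cis t)) powr 2
        * (cmod (gpow a (of_real r * cis t)))\<^sup>2) \<partial>circ_meas) \<le> ennreal (B\<^sup>2 * (2 * pi))"
      by (intro bd le) (simp add: norm_mult)
  qed
  moreover have "boundary_value (\<lambda>z. \<phi> z / gpow a z) (\<lambda>z. \<phi> z / gpow a z)"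
    unfolding boundary_value_def using AE_circ_meas_cis
  proof eventually_elim
    case (elim t)
    then show ?case
      by (intro tendsto_divide radial_limit_continuous cont gpow_continuous a gpow_nonzero)
  qed
  ultimately show ?thesis unfolding H2_mu_def by blast
qed

text \<open>Orthogonality of f - h to the Cauchy kernel divided by g says that f g and h g have the
  same Cauchy integral at every z of the disc. For h g this integral is the H^2 function G, whose
  radial limits are h g.\<close>

lemma szego_proj_radial_limit:
  assumes a: "a > 0" and f: "Lp_mu 2 (gpow a) f" and proj: "is_szego_proj (gpow a) f h"
  shows "integrable circ_meas (pull a f)" "pull a h \<in> borel_measurable circ_meas"
    "AE t in circ_meas. ((\<lambda>r. szego (pull a f) (of_real r * cis t)) \<longlongrightarrow> pull a h t) (at_left 1)"
proof -
  have hH: "h \<in> H2_mu (gpow a)" using proj by (simp add: is_szego_proj_def)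
  obtain G where lim: "AE t in circ_meas. ((\<lambda>r. G (of_real r * cis t)) \<longlongrightarrow> pull a h t) (at_left 1)"
    and ih: "integrable circ_meas (pull a h)" and Gh: "\<And>z. cmod z < 1 \<Longrightarrow> szego (pull a h) z = G z"
    using H2_mu_boundary[OF a hH] by metis
  have mf: "pull a f \<in> borel_measurable circ_meas"
    using f by (intro measurable_pull a) (simp add: Lp_mu_def)
  have "(\<integral>\<^sup>+ t. ennreal ((cmod (pull a f t))\<^sup>2) \<partial>circ_meas) < \<infinity>"
    using f nn_integral_pull_2[of f a] by (simp add: Lp_mu_def)
  then show i: "integrable circ_meas (pull a f)" by (rule integrable_of_L2(2)[OF mf])
  show "pull a h \<in> borel_measurable circ_meas" using ih by simp
  have eq: "szego (pull a f) z = G z" if z: "cmod z < 1" for z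
  proof -
    have div: "(x - y) * (1 / d / cnj c) * (c * cnj c) = x * c / d - y * c / d" if "c \<noteq> 0" for x y c d :: complex
      using that by (cases "d = 0") (simp_all add: field_simps)
    define k where "k = (\<lambda>\<zeta>. (1 / (1 - cnj z * \<zeta>)) / gpow a \<zeta>)"
    have nz: "1 - cnj z * \<zeta> \<noteq> 0" if "cmod \<zeta> \<le> 1" for \<zeta>
      using one_minus_mult_ne_zero[of "cnj z" \<zeta>] z that by simp
    have "k \<in> H2_mu (gpow a)"
      unfolding k_def by (rule H2_mu_quotient[OF a]) (use nz in \<open>auto intro!: continuous_intros holomorphic_intros\<close>)
    then have "(LINT t|circ_meas. (f (cis t) - h (cis t)) * cnj (k (cis t)) * of_real ((cmod (gpow a (cis t)))\<^sup>2)) = 0"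
      using proj by (simp add: is_szego_proj_def)
    also have "(LINT t|circ_meas. (f (cis t) - h (cis t)) * cnj (k (cis t)) * of_real ((cmod (gpow a (cis t)))\<^sup>2))
      = (LINT t|circ_meas. pull a f t / (1 - z * cis (- t)) - pull a h t / (1 - z * cis (- t)))"
    proof (rule integral_cong_AE)
      show "AE t in circ_meas. (f (cis t) - h (cis t)) * cnj (k (cis t)) * of_real ((cmod (gpow a (cis t)))\<^sup>2)
        = pull a f t / (1 - z * cis (- t)) - pull a h t / (1 - z * cis (- t))"
        using AE_circ_meas_cis
      proof eventually_elim
        case (elim t)
        then have g: "gpow a (cis t) \<noteq> 0" by (rule gpow_nonzero)
        have "cnj (k (cis t)) = 1 / (1 - z * cis (- t)) / cnj (gpow a (cis t))"
          by (simp add: k_def cis_cnj)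
        then show ?case
          unfolding complex_norm_square pull_def using div[OF g] by simp
      qed
    next
      have fm: "(\<lambda>t. f (cis t)) \<in> borel_measurable circ_meas" "(\<lambda>t. h (cis t)) \<in> borel_measurable circ_meas"
        using f hH by (auto simp: Lp_mu_def H2_mu_def)
      have gm: "(\<lambda>t. gpow a (cis t)) \<in> borel_measurable circ_meas"
        by (intro measurable_continuous_circ continuous_boundary gpow_continuous a)
      have "(\<lambda>t. cnj (k (cis t))) = (\<lambda>t. 1 / (1 - z * cis (- t)) / cnj (gpow a (cis t)))"
        by (simp add: k_def cis_cnj)
      also have "\<dots> \<in> borel_measurable circ_meas"
        by (intro borel_measurable_divide measurable_kernel measurable_continuous_circ continuous_on_cnj
            continuous_boundary gpow_continuous a)
      finally show "(\<lambda>t. (f (cis t) - h (cis t)) * cnj (k (cis t)) * of_real ((cmod (gpow a (cis t)))\<^sup>2)) \<in> borel_measurable circ_meas"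
        using fm gm by measurable
      show "(\<lambda>t. pull a f t / (1 - z * cis (- t)) - pull a h t / (1 - z * cis (- t))) \<in> borel_measurable circ_meas"
        using integrable_szego_kernel[OF i z] integrable_szego_kernel[OF ih z] by simp
    qed
    also have "\<dots> = (LINT t|circ_meas. pull a f t / (1 - z * cis (- t))) - (LINT t|circ_meas. pull a h t / (1 - z * cis (- t)))"
      by (rule Bochner_Integration.integral_diff[OF integrable_szego_kernel[OF i z] integrable_szego_kernel[OF ih z]])
    finally have "szego (pull a f) z = szego (pull a h) z" by (simp add: szego_def)
    then show ?thesis using Gh[OF z] by simp
  qed
  have ev: "eventually (\<lambda>r. szego (pull a f) (of_real r * cis t) = G (of_real r * cis t)) (at_left (1::real))" for t
    using eventually_at_left_real[of 0 1] by (rule eventually_mono) (auto simp: norm_mult intro!: eq)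
  show "AE t in circ_meas. ((\<lambda>r. szego (pull a f) (of_real r * cis t)) \<longlongrightarrow> pull a h t) (at_left 1)"
    using lim by eventually_elim (simp add: tendsto_cong[OF ev])
qed

subsection \<open>Boundedness\<close>

lemma szego_boundedI:
  assumes p: "p > 0" and C: "C \<ge> 0"
    and le: "\<And>f h. Lp_mu 2 g f \<Longrightarrow> Lp_mu p g f \<Longrightarrow> is_szego_proj g f h \<Longrightarrow>
      (\<integral>\<^sup>+ t. ennreal (cmod (h (cis t)) powr p * (cmod (g (cis t)))\<^sup>2) \<partial>circ_meas)
      \<le> ennreal C * (\<integral>\<^sup>+ t. ennreal (cmod (f (cis t)) powr p * (cmod (g (cis t)))\<^sup>2) \<partial>circ_meas)"
  shows "szego_bounded p g"
  unfolding szego_bounded_def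
proof (intro exI[of _ "C powr (1 / p)"] allI impI)
  fix f h :: "complex \<Rightarrow> complex"
  assume as: "Lp_mu 2 g f \<and> Lp_mu p g f \<and> is_szego_proj g f h"
  let ?I = "\<lambda>f. \<integral>\<^sup>+ t. ennreal (cmod (f (cis t)) powr p * (cmod (g (cis t)))\<^sup>2) \<partial>circ_meas"
  have I: "?I h \<le> ennreal C * ?I f" using as by (intro le) auto
  have fin: "?I f < \<infinity>" using as by (simp add: Lp_mu_def)
  have fin2: "ennreal C * ?I f < \<infinity>" using fin by (simp add: ennreal_mult_less_top)
  have "Lp_mu p g h"
    using as le_less_trans[OF I fin2] by (auto simp: Lp_mu_def is_szego_proj_def H2_mu_def)
  moreover have "enn2real (?I h) \<le> C * enn2real (?I f)"
    using enn2real_mono[OF I] fin2 C by (simp add: enn2real_mult)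
  then have "enn2real (?I h) powr (1 / p) \<le> (C * enn2real (?I f)) powr (1 / p)"
    using p by (intro powr_mono2) auto
  then have "pnorm_mu p g h \<le> C powr (1 / p) * pnorm_mu p g f"
    using C by (simp add: pnorm_mu_def powr_mult)
  ultimately show "Lp_mu p g h \<and> pnorm_mu p g h \<le> C powr (1 / p) * pnorm_mu p g f" by blast
qed

lemma wt_rad_tendsto:
  assumes "cis t \<noteq> 1"
  shows "(\<lambda>n. wt \<alpha> (rad n) t) \<longlonglongrightarrow> wt \<alpha> 1 t"
proof -
  have "rad \<longlonglongrightarrow> 1" using rad_tendsto by (simp add: filterlim_at)
  then have "(\<lambda>n. cmod (1 - of_real (rad n) * cis t)) \<longlonglongrightarrow> cmod (1 - of_real 1 * cis t)"
    by (intro tendsto_intros)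
  then show ?thesis unfolding wt_def using assms by (intro tendsto_powr tendsto_const) auto
qed

text \<open>The weights w n are left open because the bound for p \<ge> 2 supplies the weight at
  radius \<open>rad n\<close> and the bound for p < 2 the weight at radius 1.\<close>

lemma szego_radial_fatou:
  assumes p: "p \<ge> 1" and u: "integrable circ_meas u" 
    and lim: "AE t in circ_meas. ((\<lambda>r. szego u (of_real r * cis t)) \<longlongrightarrow> v t) (at_left 1)"
    and wm [measurable]: "\<And>n. w n \<in> borel_measurable circ_meas"
    and wl: "AE t in circ_meas. (\<lambda>n. w n t) \<longlonglongrightarrow> wt \<alpha> 1 t"
  shows "(\<integral>\<^sup>+ t. ennreal (cmod (v t) powr p * wt \<alpha> 1 t) \<partial>circ_meas)
    \<le> liminf (\<lambda>n. \<integral>\<^sup>+ t. ennreal (cmod (szego u (of_real (rad n) * cis t)) powr p * w n t) \<partial>circ_meas)"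
proof -
  have m [measurable]: "(\<lambda>t. szego u (of_real (rad n) * cis t)) \<in> borel_measurable circ_meas" for n
    by (intro measurable_continuous_circ continuous_szego_circle u rad_bounds)
  have "(\<integral>\<^sup>+ t. ennreal (cmod (v t) powr p * wt \<alpha> 1 t) \<partial>circ_meas)
      = (\<integral>\<^sup>+ t. liminf (\<lambda>n. ennreal (cmod (szego u (of_real (rad n) * cis t)) powr p * w n t)) \<partial>circ_meas)"
  proof (rule nn_integral_cong_AE, use lim wl in eventually_elim)
    case (elim t)
    have l: "(\<lambda>n. szego u (of_real (rad n) * cis t)) \<longlonglongrightarrow> v t"
      by (rule filterlim_compose[OF elim(1) rad_tendsto])
    have "(\<lambda>n. cmod (szego u (of_real (rad n) * cis t)) powr p) \<longlonglongrightarrow> cmod (v t) powr p"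
      using p by (intro tendsto_powr' tendsto_norm[OF l] tendsto_const) auto
    then have "(\<lambda>n. ennreal (cmod (szego u (of_real (rad n) * cis t)) powr p * w n t)) \<longlonglongrightarrow> ennreal (cmod (v t) powr p * wt \<alpha> 1 t)"
      using elim(2) by (intro tendsto_ennrealI tendsto_mult)
    then show ?case by (intro lim_imp_Liminf[symmetric]) auto
  qed
  also have "\<dots> \<le> liminf (\<lambda>n. \<integral>\<^sup>+ t. ennreal (cmod (szego u (of_real (rad n) * cis t)) powr p * w n t) \<partial>circ_meas)"
    by (rule nn_integral_liminf) measurable
  finally show ?thesis .
qed

lemma szego_bounded_ge_2:
  assumes a: "a > 0" and p: "p \<ge> 2" "a * (p - 2) < 1"
  shows "szego_bounded p (gpow a)"
proof -
  define \<alpha> where "\<alpha> = a * (2 - p)"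
  have al: "-1 < \<alpha>" "\<alpha> \<le> 0" using a p by (auto simp: \<alpha>_def algebra_simps mult_le_0_iff)
  obtain C where C: "C > 0" and b: "\<And>r (u :: real \<Rightarrow> complex). 0 \<le> r \<Longrightarrow> r < 1 \<Longrightarrow> u \<in> borel_measurable circ_meas \<Longrightarrow>
    (\<integral>\<^sup>+ t. ennreal (cmod (szego u (of_real r * cis t)) powr p * wt \<alpha> r t) \<partial>circ_meas)
    \<le> ennreal C * (\<integral>\<^sup>+ t. ennreal (cmod (u t) powr p * wt \<alpha> 1 t) \<partial>circ_meas)"
    using szego_bound_ge_2[OF p(1) al] by blast
  show ?thesis
  proof (rule szego_boundedI[of p C])
    fix f h assume f: "Lp_mu 2 (gpow a) f" and proj: "is_szego_proj (gpow a) f h"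
    note s = szego_proj_radial_limit[OF a f proj]
    have "(\<integral>\<^sup>+ t. ennreal (cmod (pull a h t) powr p * wt \<alpha> 1 t) \<partial>circ_meas)
      \<le> liminf (\<lambda>n. \<integral>\<^sup>+ t. ennreal (cmod (szego (pull a f) (of_real (rad n) * cis t)) powr p * wt \<alpha> (rad n) t) \<partial>circ_meas)"
      using p AE_circ_meas_cis by (intro szego_radial_fatou s) (auto elim!: eventually_mono intro: wt_rad_tendsto)
    also have "\<dots> \<le> ennreal C * (\<integral>\<^sup>+ t. ennreal (cmod (pull a f t) powr p * wt \<alpha> 1 t) \<partial>circ_meas)"
      using s(1) by (intro Liminf_le) (auto intro!: always_eventually b rad_bounds)
    finally show "(\<integral>\<^sup>+ t. ennreal (cmod (h (cis t)) powr p * (cmod (gpow a (cis t)))\<^sup>2) \<partial>circ_meas)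
      \<le> ennreal C * (\<integral>\<^sup>+ t. ennreal (cmod (f (cis t)) powr p * (cmod (gpow a (cis t)))\<^sup>2) \<partial>circ_meas)"
      unfolding nn_integral_pull \<alpha>_def .
  qed (use p C in auto)
qed

lemma szego_bounded_lt_2:
  assumes a: "a > 0" and p: "1 < p" "p < 2" "a * (2 - p) < p - 1"
  shows "szego_bounded p (gpow a)"
proof -
  define \<alpha> where "\<alpha> = a * (2 - p)"
  have al: "0 \<le> \<alpha>" "\<alpha> < p - 1" using a p by (auto simp: \<alpha>_def)
  obtain C where C: "C > 0" and b: "\<And>r (u :: real \<Rightarrow> complex). 0 \<le> r \<Longrightarrow> r < 1 \<Longrightarrow> integrable circ_meas u \<Longrightarrow>
    (\<integral>\<^sup>+ t. ennreal (cmod (szego u (of_real r * cis t)) powr p * wt \<alpha> 1 t) \<partial>circ_meas)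
    \<le> ennreal C * (\<integral>\<^sup>+ t. ennreal (cmod (u t) powr p * wt \<alpha> r t) \<partial>circ_meas)"
    using szego_bound_lt_2[OF p(1,2) al] by blast
  show ?thesis
  proof (rule szego_boundedI[of p C])
    fix f h assume f: "Lp_mu 2 (gpow a) f" and proj: "is_szego_proj (gpow a) f h"
    note s = szego_proj_radial_limit[OF a f proj]
    have um [measurable]: "pull a f \<in> borel_measurable circ_meas" using s(1) by simp
    let ?U = "\<lambda>r. \<integral>\<^sup>+ t. ennreal (cmod (pull a f t) powr p * wt \<alpha> r t) \<partial>circ_meas"
    have U2: "(\<integral>\<^sup>+ t. ennreal ((cmod (pull a f t))\<^sup>2) \<partial>circ_meas) < \<infinity>"
      using f nn_integral_pull_2[of f a] by (simp add: Lp_mu_def)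
    \<comment> \<open>Here the right-hand side still depends on the radius, and its convergence
      needs a majorant. Since p < 2, |f g|^p \<le> 1 + |f g|^2, integrable as f lies in L^2(\<mu>);
      since \<alpha> \<ge> 0, the weights are at most 2 powr \<alpha>.\<close>
    have dom: "cmod (pull a f t) powr p * wt \<alpha> (rad n) t \<le> (1 + (cmod (pull a f t))\<^sup>2) * 2 powr \<alpha>" for t n
    proof (intro mult_mono)
      have x: "x powr p \<le> 1 + x\<^sup>2" if "x \<ge> 0" for x :: real
      proof (cases "x \<le> 1")
        case True
        then have "x powr p \<le> 1 powr p" using that p by (intro powr_mono2) auto
        then show ?thesis by (simp add: add_increasing2)
      next
        case False
        then have "x powr p \<le> x powr 2" using p by (intro powr_mono) auto
        then show ?thesis using False by simp
      qed
      then show "cmod (pull a f t) powr p \<le> 1 + (cmod (pull a f t))\<^sup>2" by simp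
      have "cmod (1 - of_real (rad n) * cis t) \<le> 1 + cmod (of_real (rad n) * cis t)"
        by (rule order_trans[OF norm_triangle_ineq4]) simp
      also have "\<dots> \<le> 2" using rad_bounds[of n] by (simp add: norm_mult)
      finally show "wt \<alpha> (rad n) t \<le> 2 powr \<alpha>" unfolding wt_def using al by (intro powr_mono2) auto
    qed auto
    have Ulim: "(\<lambda>n. ?U (rad n)) \<longlonglongrightarrow> ?U 1"
    proof (rule nn_integral_dominated_convergence[where w = "\<lambda>t. ennreal ((1 + (cmod (pull a f t))\<^sup>2) * 2 powr \<alpha>)"])
      have "integrable circ_meas (\<lambda>t. (1 + (cmod (pull a f t))\<^sup>2) * 2 powr \<alpha>)"
        using integrable_of_L2(1)[OF um U2] by simp
      then show "(\<integral>\<^sup>+ t. ennreal ((1 + (cmod (pull a f t))\<^sup>2) * 2 powr \<alpha>) \<partial>circ_meas) < \<infinity>"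
        by (subst nn_integral_eq_integral) auto
      show "AE t in circ_meas. (\<lambda>n. ennreal (cmod (pull a f t) powr p * wt \<alpha> (rad n) t))
          \<longlonglongrightarrow> ennreal (cmod (pull a f t) powr p * wt \<alpha> 1 t)"
        using AE_circ_meas_cis by eventually_elim (intro tendsto_ennrealI tendsto_mult tendsto_const wt_rad_tendsto)
    qed (use dom in \<open>auto intro!: ennreal_leI\<close>)
    have "(\<integral>\<^sup>+ t. ennreal (cmod (pull a h t) powr p * wt \<alpha> 1 t) \<partial>circ_meas)
      \<le> liminf (\<lambda>n. \<integral>\<^sup>+ t. ennreal (cmod (szego (pull a f) (of_real (rad n) * cis t)) powr p * wt \<alpha> 1 t) \<partial>circ_meas)"
      using p by (intro szego_radial_fatou s) auto
    also have "\<dots> \<le> liminf (\<lambda>n. ennreal C * ?U (rad n))"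
      by (intro Liminf_mono always_eventually allI b rad_bounds s)
    also have "\<dots> = ennreal C * ?U 1"
      by (intro lim_imp_Liminf ennreal_tendsto_cmult Ulim) auto
    finally show "(\<integral>\<^sup>+ t. ennreal (cmod (h (cis t)) powr p * (cmod (gpow a (cis t)))\<^sup>2) \<partial>circ_meas)
      \<le> ennreal C * (\<integral>\<^sup>+ t. ennreal (cmod (f (cis t)) powr p * (cmod (gpow a (cis t)))\<^sup>2) \<partial>circ_meas)"
      unfolding nn_integral_pull \<alpha>_def .
  qed (use p C in auto)
qed

subsection \<open>Unboundedness for large exponents\<close>

lemma cis_minus_power_integral: "(LINT t|circ_meas. cis (- t) ^ Suc j) = 0"
proof -
  have "(LINT t|circ_meas. cis (- t) ^ Suc j) = (LINT t|circ_meas. cnj (cis t ^ Suc j))"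
    by (simp add: cis_cnj)
  also have "\<dots> = cnj (LINT t|circ_meas. cis t ^ Suc j)" by (rule Bochner_Integration.integral_cnj)
  also have "(LINT t|circ_meas. cis t ^ Suc j) = 2 * pi * (0 :: complex) ^ Suc j"
    by (rule mean_value_circ_meas(2)[of "\<lambda>z. z ^ Suc j"]) (intro continuous_intros holomorphic_intros)+
  finally show ?thesis by simp
qed

text \<open>Polynomials in cnj z without constant term are orthogonal to H^2, so projecting U / g
  erases them and keeps \<phi> / g. The \<open>Suc\<close> enforces exponents at least 1; the index
  type is free because both single indices and pairs occur.\<close>

lemma szego_proj_of_sum:
  fixes d :: "'i \<Rightarrow> complex" and e :: "'i \<Rightarrow> nat"
  assumes a: "a > 0" and I: "finite I"
    and cont: "continuous_on (cball 0 1) \<phi>" and hol: "\<phi> holomorphic_on ball 0 1"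
  defines "U \<equiv> \<lambda>z. \<phi> z + (\<Sum>i\<in>I. d i * cnj z ^ Suc (e i))"
  shows "Lp_mu 2 (gpow a) (\<lambda>z. U z / gpow a z)"
    and "is_szego_proj (gpow a) (\<lambda>z. U z / gpow a z) (\<lambda>z. \<phi> z / gpow a z)"
proof -
  let ?f = "\<lambda>z. U z / gpow a z" and ?h = "\<lambda>z. \<phi> z / gpow a z"
  have contU: "continuous_on {0..2*pi} (\<lambda>t. U (cis t))"
    unfolding U_def by (intro continuous_intros continuous_boundary cont)
  have mg: "(\<lambda>t. gpow a (cis t)) \<in> borel_measurable circ_meas"
    by (intro measurable_continuous_circ continuous_boundary gpow_continuous a)
  have mU: "(\<lambda>t. U (cis t)) \<in> borel_measurable circ_meas" by (rule measurable_continuous_circ[OF contU])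
  have "(\<integral>\<^sup>+ t. ennreal (cmod (?f (cis t)) powr 2 * (cmod (gpow a (cis t)))\<^sup>2) \<partial>circ_meas)
      = (\<integral>\<^sup>+ t. ennreal ((cmod (U (cis t)))\<^sup>2) \<partial>circ_meas)"
    by (rule nn_integral_cong_AE, use AE_circ_meas_cis in eventually_elim)
       (simp add: norm_divide power_divide gpow_nonzero)
  also have "\<dots> = ennreal (LINT t|circ_meas. (cmod (U (cis t)))\<^sup>2)"
    by (intro nn_integral_eq_integral circ_meas_integrable_continuous continuous_intros contU) auto
  finally show "Lp_mu 2 (gpow a) ?f"
    unfolding Lp_mu_def using mU mg by (auto intro: borel_measurable_divide)
  show "is_szego_proj (gpow a) ?f ?h"
    unfolding is_szego_proj_def
  proof (intro conjI ballI)
    show "?h \<in> H2_mu (gpow a)" by (rule H2_mu_quotient[OF a cont hol])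
    fix k assume k: "k \<in> H2_mu (gpow a)"
    have ik: "integrable circ_meas (pull a k)" and k0: "\<And>j. (LINT t|circ_meas. pull a k t * cis t ^ Suc j) = 0"
      using H2_mu_boundary[OF a k] by metis+
    have ij: "integrable circ_meas (\<lambda>t. pull a k t * cis t ^ Suc j)" for j
    proof (rule Bochner_Integration.integrable_bound[OF ik])
      show "(\<lambda>t. pull a k t * cis t ^ Suc j) \<in> borel_measurable circ_meas"
        by (rule borel_measurable_times[OF borel_measurable_integrable[OF ik]])
           (intro measurable_continuous_circ continuous_intros)
    qed (simp add: norm_mult norm_power)
    have mk: "(\<lambda>t. k (cis t)) \<in> borel_measurable circ_meas" using k by (simp add: H2_mu_def Lp_mu_def)
    have "(LINT t|circ_meas. (?f (cis t) - ?h (cis t)) * cnj (k (cis t)) * of_real ((cmod (gpow a (cis t)))\<^sup>2))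
        = (LINT t|circ_meas. (\<Sum>i\<in>I. d i * cnj (pull a k t * cis t ^ Suc (e i))))"
    proof (rule integral_cong_AE)
      show "AE t in circ_meas. (?f (cis t) - ?h (cis t)) * cnj (k (cis t)) * of_real ((cmod (gpow a (cis t)))\<^sup>2)
          = (\<Sum>i\<in>I. d i * cnj (pull a k t * cis t ^ Suc (e i)))"
        using AE_circ_meas_cis
      proof eventually_elim
        case (elim t)
        then have g: "gpow a (cis t) \<noteq> 0" by (rule gpow_nonzero)
        have "(?f (cis t) - ?h (cis t)) * cnj (k (cis t)) * of_real ((cmod (gpow a (cis t)))\<^sup>2)
            = (U (cis t) - \<phi> (cis t)) * cnj (pull a k t)"
          unfolding complex_norm_square pull_def using g by (simp add: diff_divide_distrib[symmetric])
        also have "\<dots> = (\<Sum>i\<in>I. d i * cnj (pull a k t * cis t ^ Suc (e i)))"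
          unfolding U_def by (simp add: sum_distrib_left sum_distrib_right mult_ac)
        finally show ?case .
      qed
      have mc: "(\<lambda>t. cnj (F t)) \<in> borel_measurable circ_meas" if "F \<in> borel_measurable circ_meas" for F
        by (rule measurable_compose[OF that]) (auto intro!: borel_measurable_continuous_onI continuous_intros)
      have mh: "(\<lambda>t. \<phi> (cis t)) \<in> borel_measurable circ_meas"
        by (intro measurable_continuous_circ continuous_boundary cont)
      show "(\<lambda>t. (?f (cis t) - ?h (cis t)) * cnj (k (cis t)) * of_real ((cmod (gpow a (cis t)))\<^sup>2)) \<in> borel_measurable circ_meas"
        using mU mg mc[OF mk] mh by measurable
      show "(\<lambda>t. \<Sum>i\<in>I. d i * cnj (pull a k t * cis t ^ Suc (e i))) \<in> borel_measurable circ_meas"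
        by (intro borel_measurable_sum borel_measurable_times[OF borel_measurable_const] mc
            borel_measurable_integrable[OF ij])
    qed
    also have "\<dots> = (\<Sum>i\<in>I. LINT t|circ_meas. d i * cnj (pull a k t * cis t ^ Suc (e i)))"
      by (intro Bochner_Integration.integral_sum integrable_mult_right integrable_cnj ij)
    also have "\<dots> = (\<Sum>i\<in>I. d i * cnj (LINT t|circ_meas. pull a k t * cis t ^ Suc (e i)))"
      unfolding integral_mult_right_zero Bochner_Integration.integral_cnj ..
    also have "\<dots> = 0" unfolding k0 by simp
    finally show "(LINT t|circ_meas. (?f (cis t) - ?h (cis t)) * cnj (k (cis t)) * of_real ((cmod (gpow a (cis t)))\<^sup>2)) = 0" .
  qed
qed

lemma nn_integral_quotient:
  "(\<integral>\<^sup>+ t. ennreal (cmod (U (cis t) / gpow a (cis t)) powr p * (cmod (gpow a (cis t)))\<^sup>2) \<partial>circ_meas)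
   = (\<integral>\<^sup>+ t. ennreal (cmod (U (cis t)) powr p * wt (a * (2 - p)) 1 t) \<partial>circ_meas)"
  unfolding nn_integral_pull[of "\<lambda>z. U z / gpow a z"]
  by (rule nn_integral_cong_AE, use AE_circ_meas_cis in eventually_elim) (simp add: pull_def gpow_nonzero)

lemma wt_not_integrable:
  assumes "\<alpha> \<le> -1"
  shows "(\<integral>\<^sup>+ t. ennreal (wt \<alpha> 1 t) \<partial>circ_meas) = \<infinity>"
proof (rule ccontr)
  assume "\<not> ?thesis"
  then obtain c where c: "(\<integral>\<^sup>+ t. ennreal (wt \<alpha> 1 t) \<partial>circ_meas) = ennreal c" "c \<ge> 0"
    by (cases "\<integral>\<^sup>+ t. ennreal (wt \<alpha> 1 t) \<partial>circ_meas") auto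
  \<comment> \<open>Chosen so that the integral of 1 / t from \<epsilon> to 1 equals c + 1,
    exceeding the supposed value c.\<close>
  define \<epsilon> where "\<epsilon> = exp (- c - 1)"
  have e: "0 < \<epsilon>" "\<epsilon> < 1" using c by (auto simp: \<epsilon>_def)
  have lower: "1 / t \<le> wt \<alpha> 1 t" if t: "\<epsilon> \<le> t" "t \<le> 1" for t
  proof -
    have "cmod (1 - cis t) = 2 * \<bar>sin (t / 2)\<bar>"
      using dist_exp_i_1[of t] by (simp add: cis_conv_exp norm_minus_commute)
    moreover have "\<bar>sin (t / 2)\<bar> \<le> \<bar>t / 2\<bar>" by (rule abs_sin_x_le_abs_x)
    moreover have "0 < sin (t / 2)" using t e pi_gt3 by (intro sin_gt_zero) auto
    ultimately have x: "0 < cmod (1 - cis t)" "cmod (1 - cis t) \<le> t" using t e by auto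
    have "1 / t \<le> 1 / cmod (1 - cis t)" using x t e by (intro divide_left_mono) auto
    also have "\<dots> = cmod (1 - cis t) powr (-1)" using x by (simp add: powr_minus divide_inverse)
    also have "\<dots> \<le> cmod (1 - cis t) powr \<alpha>" using x t assms by (intro powr_mono') auto
    finally show ?thesis by (simp add: wt_def)
  qed
  have "ennreal (ln 1 - ln \<epsilon>) = (\<integral>\<^sup>+ t. ennreal (1 / t) * indicator {\<epsilon>..1} t \<partial>lborel)"
    by (rule nn_integral_FTC_Icc[symmetric]) (use e in \<open>auto intro!: derivative_eq_intros\<close>)
  also have "\<dots> \<le> (\<integral>\<^sup>+ t. ennreal (wt \<alpha> 1 t) * indicator {0..2*pi} t \<partial>lborel)"
    using lower e pi_gt3 by (intro nn_integral_mono) (auto simp: indicator_def intro!: ennreal_leI)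
  also have "\<dots> = (\<integral>\<^sup>+ t. ennreal (wt \<alpha> 1 t) \<partial>circ_meas)"
    unfolding circ_meas_def by (rule nn_integral_restrict_space[symmetric]) simp
  finally have "ennreal (1 + c) \<le> ennreal c" unfolding c by (simp add: \<epsilon>_def)
  then show False using c by (subst (asm) ennreal_le_iff) auto
qed

lemma not_szego_bounded_ge:
  assumes a: "a > 0" and p: "p > 2" "1 \<le> a * (p - 2)"
  shows "\<not> szego_bounded p (gpow a)"
proof
  assume "szego_bounded p (gpow a)"
  then obtain C where C: "\<And>f h. Lp_mu 2 (gpow a) f \<Longrightarrow> Lp_mu p (gpow a) f \<Longrightarrow> is_szego_proj (gpow a) f h \<Longrightarrow> Lp_mu p (gpow a) h"
    unfolding szego_bounded_def by blast
  define \<alpha> where "\<alpha> = a * (2 - p)"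
  have al: "\<alpha> \<le> -1" using p by (simp add: \<alpha>_def algebra_simps)
  \<comment> \<open>A zero of order n + 1 at the point 1 outweighs the singularity of the weight
    once (n + 1) p + \<alpha> \<ge> 0. The projection keeps only the constant term 1 of U and so
    loses this zero.\<close>
  obtain n :: nat where "a * (p - 2) / p \<le> real n" using real_arch_simple by blast
  then have n: "a * (p - 2) \<le> real (Suc n) * p" using p by (simp add: field_simps)
  define U where "U = (\<lambda>z::complex. (1 - cnj z) ^ Suc n)"
  define d where "d = (\<lambda>i. of_nat (Suc n choose Suc i) * (-1) ^ Suc i :: complex)"
  have U: "U z = 1 + (\<Sum>i\<in>{..<Suc n}. d i * cnj z ^ Suc i)" for z
  proof -
    have "U z = (- cnj z + 1) ^ Suc n" by (simp add: U_def)
    also have "\<dots> = (\<Sum>k\<le>Suc n. of_nat (Suc n choose k) * (- cnj z) ^ k)"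
      unfolding binomial_ring by simp
    also have "\<dots> = 1 + (\<Sum>i<Suc n. of_nat (Suc n choose Suc i) * (- cnj z) ^ Suc i)"
      unfolding sum.atMost_shift by simp
    also have "(\<Sum>i<Suc n. of_nat (Suc n choose Suc i) * (- cnj z) ^ Suc i) = (\<Sum>i\<in>{..<Suc n}. d i * cnj z ^ Suc i)"
      by (intro sum.cong refl) (simp only: d_def power_minus[of "cnj z"] mult.assoc)
    finally show ?thesis .
  qed
  have s: "Lp_mu 2 (gpow a) (\<lambda>z. U z / gpow a z)"
    "is_szego_proj (gpow a) (\<lambda>z. U z / gpow a z) (\<lambda>z. 1 / gpow a z)"
    using szego_proj_of_sum[where I = "{..<Suc n}" and \<phi> = "\<lambda>_. 1" and d = d and e = "\<lambda>i. i", OF a finite_lessThan]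
    unfolding U by auto
  have "cmod (U (cis t)) powr p * wt \<alpha> 1 t \<le> 2 powr (real (Suc n) * p + \<alpha>)" for t
  proof -
    define c where "c = cmod (1 - cis t)"
    have "cmod (U (cis t)) = cmod (cnj ((1 - cis t) ^ Suc n))" by (simp add: U_def)
    then have "cmod (U (cis t)) = c ^ Suc n" unfolding complex_mod_cnj norm_power c_def .
    also have "\<dots> = c powr real (Suc n)" by (rule powr_realpow'[symmetric]) (auto simp: c_def)
    finally have "cmod (U (cis t)) powr p = c powr (real (Suc n) * p)" by (simp only: powr_powr)
    then have "cmod (U (cis t)) powr p * wt \<alpha> 1 t = c powr (real (Suc n) * p + \<alpha>)"
      by (simp only: powr_add wt_def c_def of_real_1 mult_1_left)
    also have "\<dots> \<le> 2 powr (real (Suc n) * p + \<alpha>)"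
      using n norm_triangle_ineq4[of 1 "cis t"] by (intro powr_mono2) (auto simp: c_def \<alpha>_def algebra_simps)
    finally show ?thesis .
  qed
  then have "(\<integral>\<^sup>+ t. ennreal (cmod (U (cis t)) powr p * wt \<alpha> 1 t) \<partial>circ_meas)
      \<le> (\<integral>\<^sup>+ t. ennreal (2 powr (real (Suc n) * p + \<alpha>)) \<partial>circ_meas)"
    by (intro nn_integral_mono ennreal_leI)
  also have "\<dots> < \<infinity>" using emeasure_circ_meas by (simp add: ennreal_mult_less_top)
  finally have "Lp_mu p (gpow a) (\<lambda>z. U z / gpow a z)"
    using s(1) unfolding Lp_mu_def nn_integral_quotient[of U] \<alpha>_def by simp
  then have "Lp_mu p (gpow a) (\<lambda>z. 1 / gpow a z)" by (rule C[OF s(1) _ s(2)])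
  then have "(\<integral>\<^sup>+ t. ennreal (wt \<alpha> 1 t) \<partial>circ_meas) < \<infinity>"
    unfolding Lp_mu_def nn_integral_quotient[of "\<lambda>_. 1"] \<alpha>_def by simp
  then show False using wt_not_integrable[OF al] by simp
qed

subsection \<open>Unboundedness for small exponents\<close>

lemma sum_inverse_sqrt_le: "(\<Sum>n<N. 1 / sqrt (real (n + 1))) \<le> 2 * sqrt (real N)"
proof (induction N)
  case (Suc N)
  define x y where "x = sqrt (real N)" and "y = sqrt (real N + 1)"
  have y: "y > 0" "x \<ge> 0" by (auto simp: x_def y_def)
  have "y\<^sup>2 = x\<^sup>2 + 1" by (simp add: x_def y_def)
  moreover have "0 \<le> (y - x)\<^sup>2" by simp
  ultimately have "1 \<le> 2 * y * (y - x)" by (simp add: power2_eq_square algebra_simps)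
  then have "1 / y \<le> 2 * (y - x)" using y by (simp add: field_simps)
  then show ?case using Suc by (simp add: x_def y_def add.commute)
qed simp

text \<open>Summation by parts: multiplying by 1 - z leaves the differences of c, which telescope
  because c decreases.\<close>

lemma abel_geometric_bound:
  fixes c :: "nat \<Rightarrow> real" and z :: complex
  assumes c0: "\<And>n. 0 \<le> c n" and dec: "\<And>n. c (Suc n) \<le> c n" and z: "cmod z = 1"
  shows "cmod (1 - z) * cmod (\<Sum>n<L. of_real (c n) * z ^ n) \<le> 2 * c 0"
proof -
  \<comment> \<open>Including the boundary term makes each induction step change the sum by c L - c
    (L + 1) in modulus, which matches the change of the bound.\<close>
  have "cmod ((1 - z) * (\<Sum>n<L. of_real (c n) * z ^ n) + of_real (c L) * z ^ L) \<le> 2 * c 0 - c L"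
  proof (induction L)
    case (Suc L)
    let ?S = "(1 - z) * (\<Sum>n<L. of_real (c n) * z ^ n) + of_real (c L) * z ^ L"
    have "(1 - z) * (\<Sum>n<Suc L. of_real (c n) * z ^ n) + of_real (c (Suc L)) * z ^ Suc L
        = ?S - of_real (c L - c (Suc L)) * z ^ Suc L"
      by (simp add: algebra_simps)
    also have "cmod \<dots> \<le> cmod ?S + cmod (of_real (c L - c (Suc L)) * z ^ Suc L)"
      by (rule norm_triangle_ineq4)
    also have "cmod (of_real (c L - c (Suc L)) * z ^ Suc L) = c L - c (Suc L)"
      using dec[of L] z unfolding norm_mult norm_power norm_of_real by simp
    finally show ?case using Suc by simp
  qed (use c0 in simp)
  moreover have "cmod (of_real (c L) * z ^ L) = c L" using c0 z by (simp add: norm_mult norm_power)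
  moreover have "cmod ((1 - z) * (\<Sum>n<L. of_real (c n) * z ^ n))
    \<le> cmod ((1 - z) * (\<Sum>n<L. of_real (c n) * z ^ n) + of_real (c L) * z ^ L) + cmod (of_real (c L) * z ^ L)"
    using norm_triangle_ineq4[of "(1 - z) * (\<Sum>n<L. of_real (c n) * z ^ n) + of_real (c L) * z ^ L" "of_real (c L) * z ^ L"]
    by simp
  ultimately show ?thesis by (simp add: norm_mult)
qed

text \<open>The coefficients have the order of those of (1 - z) powr (- 1/2), which just fails to be
  in H^2.\<close>

definition qpoly :: "nat \<Rightarrow> complex \<Rightarrow> complex" where
  "qpoly N z = (\<Sum>n<N. of_real (1 / sqrt (real (n + 1))) * z ^ n)"

text \<open>The sum is split at about 1 / |1 - z|: before this index the triangle inequality is good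
  enough, after it the oscillation of z^n is exploited by summation by parts. Both parts are of
  order |1 - z| powr (- 1/2).\<close>

lemma qpoly_bound:
  assumes z: "cmod z = 1" "z \<noteq> 1"
  shows "(cmod (qpoly N z))\<^sup>2 \<le> 36 / cmod (1 - z)"
proof -
  define D where "D = cmod (1 - z)"
  have D: "0 < D" "D \<le> 2" using z norm_triangle_ineq4[of 1 z] by (auto simp: D_def)
  define M where "M = nat \<lceil>1 / D\<rceil>"
  have M: "1 / D \<le> real M" "real M \<le> 1 / D + 1" unfolding M_def using D by (auto simp: le_nat_iff)
  \<comment> \<open>Since D \<le> 2, the rounding error 1 in M is at most 2 / D.\<close>
  have "1 \<le> 2 / D" using D by simp
  then have M3: "real M \<le> 3 / D" using M(2) by (simp add: field_simps)
  let ?c = "\<lambda>n. 1 / sqrt (real (n + 1))"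
  have head: "cmod (\<Sum>n<K. of_real (?c n) * z ^ n) \<le> 2 * sqrt (3 / D)" if "K \<le> M" for K
  proof -
    have "cmod (\<Sum>n<K. of_real (?c n) * z ^ n) \<le> (\<Sum>n<K. ?c n)"
      by (rule order_trans[OF norm_sum]) (simp add: norm_mult norm_power z norm_divide)
    also have "\<dots> \<le> 2 * sqrt (real K)" by (rule sum_inverse_sqrt_le)
    also have "\<dots> \<le> 2 * sqrt (3 / D)" using that M3 by simp
    finally show ?thesis .
  qed
  have "cmod (qpoly N z) \<le> 2 * sqrt (3 / D) + 2 * sqrt (1 / D)"
  proof (cases "N \<le> M")
    case True
    then show ?thesis using head[OF True] D unfolding qpoly_def by (simp add: add_increasing2)
  next
    case False
    then obtain L where N: "N = M + L" by (metis le_add_diff_inverse nat_le_linear)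
    have sum_split: "(\<Sum>n<M + L. f n) = (\<Sum>n<M. f n) + (\<Sum>n<L. f (M + n))" for f :: "nat \<Rightarrow> complex"
      by (induction L) (simp_all add: add.assoc)
    have "qpoly N z = (\<Sum>n<M. of_real (?c n) * z ^ n) + (\<Sum>n<L. of_real (?c (M + n)) * z ^ (M + n))"
      unfolding qpoly_def N by (rule sum_split)
    also have "(\<Sum>n<L. of_real (?c (M + n)) * z ^ (M + n)) = z ^ M * (\<Sum>n<L. of_real (?c (M + n)) * z ^ n)"
      unfolding sum_distrib_left by (intro sum.cong) (auto simp: power_add)
    finally have "cmod (qpoly N z) \<le> cmod (\<Sum>n<M. of_real (?c n) * z ^ n) + cmod (\<Sum>n<L. of_real (?c (M + n)) * z ^ n)"
      using norm_triangle_ineq[of "\<Sum>n<M. of_real (?c n) * z ^ n" "z ^ M * (\<Sum>n<L. of_real (?c (M + n)) * z ^ n)"]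
      by (simp add: norm_mult norm_power z)
    moreover have "cmod (\<Sum>n<L. of_real (?c (M + n)) * z ^ n) \<le> 2 * sqrt (1 / D)"
    proof -
      have "D * cmod (\<Sum>n<L. of_real (?c (M + n)) * z ^ n) \<le> 2 * ?c (M + 0)"
        unfolding D_def by (rule abel_geometric_bound) (auto intro!: divide_left_mono simp: z)
      also have "?c (M + 0) \<le> 1 / sqrt (1 / D)"
        using M D by (intro divide_left_mono real_sqrt_le_mono) auto
      finally have "cmod (\<Sum>n<L. of_real (?c (M + n)) * z ^ n) \<le> 2 * (1 / sqrt (1 / D)) / D"
        using D by (simp add: field_simps)
      also have "2 * (1 / sqrt (1 / D)) / D = 2 * sqrt (1 / D)"
        using D by (simp add: real_sqrt_divide field_simps)
      finally show ?thesis .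
    qed
    ultimately show ?thesis using head[OF order_refl] by linarith
  qed
  also have "\<dots> \<le> 6 * sqrt (1 / D)"
  proof -
    have "sqrt (3 / D) \<le> sqrt (4 / D)" using D by (simp add: divide_right_mono)
    also have "\<dots> = 2 * sqrt (1 / D)" using D by (simp add: real_sqrt_divide)
    finally show ?thesis by simp
  qed
  finally have "(cmod (qpoly N z))\<^sup>2 \<le> (6 * sqrt (1 / D))\<^sup>2" by (intro power_mono) auto
  also have "\<dots> = 36 / D" using D by (simp add: power_mult_distrib)
  finally show ?thesis by (simp add: D_def)
qed

text \<open>On the circle z^m cnj z^n depends only on m - n, so the terms of |q|^2 with n \<le> m
  form an analytic polynomial and the others a polynomial in cnj z without constant term, the shape
  that \<open>szego_proj_of_sum\<close> requires. The diagonal gives the harmonic sum as value at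
  0.\<close>

lemma qpoly_decomposition:
  "\<exists>(\<phi> :: complex \<Rightarrow> complex) (I :: (nat \<times> nat) set) (d :: nat \<times> nat \<Rightarrow> complex) (e :: nat \<times> nat \<Rightarrow> nat).
    finite I \<and> continuous_on (cball 0 1) \<phi> \<and> \<phi> holomorphic_on ball 0 1
    \<and> \<phi> 0 = of_real (\<Sum>n<N. 1 / real (n + 1))
    \<and> (\<forall>z. cmod z = 1 \<longrightarrow> \<phi> z + (\<Sum>i\<in>I. d i * cnj z ^ Suc (e i)) = of_real ((cmod (qpoly N z))\<^sup>2))"
proof -
  define c :: "nat \<Rightarrow> complex" where "c = (\<lambda>n. of_real (1 / sqrt (real (n + 1))))"
  define J where "J = (SIGMA m:{..<N}. {..m})"
  define I where "I = {..<N} \<times> {..<N} - J"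
  define \<phi> where "\<phi> = (\<lambda>z. \<Sum>x\<in>J. c (fst x) * c (snd x) * z ^ (fst x - snd x))"
  define d where "d = (\<lambda>x. c (fst x) * c (snd x))"
  \<comment> \<open>On I the second component strictly exceeds the first, so the truncated
    subtraction is exact and \<open>Suc (e x)\<close> is the difference.\<close>
  define e where "e = (\<lambda>x::nat\<times>nat. snd x - fst x - 1)"
  have JI: "J \<subseteq> {..<N} \<times> {..<N}" by (auto simp: J_def)
  have fin: "finite J" "finite I" using finite_subset[OF JI] by (auto simp: I_def)
  have "\<phi> 0 = (\<Sum>m<N. \<Sum>n\<le>m. c m * c n * 0 ^ (m - n))"
    unfolding \<phi>_def J_def by (subst sum.Sigma) (auto simp: split_beta')
  \<comment> \<open>As \<open>0 ^ 0 = 1\<close>, only the diagonal survives at z = 0.\<close>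
  also have "\<dots> = (\<Sum>m<N. \<Sum>n\<le>m. if n = m then c m * c m else 0)"
    by (intro sum.cong refl) (auto simp: power_0_left)
  also have "\<dots> = (\<Sum>m<N. of_real (1 / real (m + 1)))"
    by (intro sum.cong refl) (simp add: c_def flip: of_real_mult)
  finally have phi0: "\<phi> 0 = of_real (\<Sum>n<N. 1 / real (n + 1))" by simp
  have "\<phi> z + (\<Sum>i\<in>I. d i * cnj z ^ Suc (e i)) = of_real ((cmod (qpoly N z))\<^sup>2)" if z: "cmod z = 1" for z
  proof -
    have zz: "z * cnj z = 1" using z by (simp add: complex_norm_square[symmetric])
    have *: "z ^ m * cnj z ^ n = (if n \<le> m then z ^ (m - n) else cnj z ^ (n - m))" for m n
    proof (cases "n \<le> m")
      case True
      then obtain k where m: "m = n + k" using le_Suc_ex by blast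
      have "z ^ m * cnj z ^ n = z ^ k * (z * cnj z) ^ n"
        by (simp add: m power_add power_mult_distrib mult_ac)
      then show ?thesis by (simp add: zz m)
    next
      case False
      then obtain k where n: "n = m + k" using nat_le_linear le_Suc_ex by blast
      have "z ^ m * cnj z ^ n = cnj z ^ k * (z * cnj z) ^ m"
        by (simp add: n power_add power_mult_distrib mult_ac)
      then show ?thesis using False by (simp add: zz n)
    qed
    have "of_real ((cmod (qpoly N z))\<^sup>2) = qpoly N z * cnj (qpoly N z)" by (rule complex_norm_square)
    also have "\<dots> = (\<Sum>m<N. c m * z ^ m) * (\<Sum>n<N. c n * cnj z ^ n)"
      by (simp add: qpoly_def c_def)
    also have "\<dots> = (\<Sum>x\<in>{..<N} \<times> {..<N}. c (fst x) * c (snd x) * (z ^ fst x * cnj z ^ snd x))"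
      unfolding sum_product sum.cartesian_product by (intro sum.cong) (auto simp: mult_ac)
    also have "\<dots> = (\<Sum>x\<in>I. c (fst x) * c (snd x) * (z ^ fst x * cnj z ^ snd x))
        + (\<Sum>x\<in>J. c (fst x) * c (snd x) * (z ^ fst x * cnj z ^ snd x))"
      unfolding I_def by (rule sum.subset_diff[OF JI]) simp
    also have "(\<Sum>x\<in>J. c (fst x) * c (snd x) * (z ^ fst x * cnj z ^ snd x)) = \<phi> z"
      unfolding \<phi>_def by (intro sum.cong refl) (auto simp: * J_def)
    also have "(\<Sum>x\<in>I. c (fst x) * c (snd x) * (z ^ fst x * cnj z ^ snd x)) = (\<Sum>i\<in>I. d i * cnj z ^ Suc (e i))"
    proof (intro sum.cong refl)
      fix x assume "x \<in> I"
      then have "fst x < snd x" by (auto simp: I_def J_def)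
      then have "\<not> snd x \<le> fst x" "Suc (e x) = snd x - fst x" by (auto simp: e_def)
      then show "c (fst x) * c (snd x) * (z ^ fst x * cnj z ^ snd x) = d x * cnj z ^ Suc (e x)"
        by (simp only: * d_def if_False)
    qed
    finally show ?thesis by (simp add: add.commute)
  qed
  moreover have "continuous_on (cball 0 1) \<phi>" "\<phi> holomorphic_on ball 0 1"
    unfolding \<phi>_def by (intro continuous_intros holomorphic_intros)+
  ultimately show ?thesis using fin phi0 by blast
qed

text \<open>Quantitative comparison: the p-th power of the norm of the test function is at most of
  order H^\<gamma>, that of its projection at least of order H^p, where H is a harmonic number.
  Boundedness would keep H^b = H^(p - \<gamma>) bounded, although b > 0 and H is unbounded.\<close>

lemma not_szego_bounded_le:
  assumes a: "a > 0" and p: "1 \<le> p" "p < 2" "p - 1 \<le> a * (2 - p)"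
  shows "\<not> szego_bounded p (gpow a)"
proof
  assume "szego_bounded p (gpow a)"
  then obtain C0 where C0: "\<And>f h. Lp_mu 2 (gpow a) f \<Longrightarrow> Lp_mu p (gpow a) f \<Longrightarrow> is_szego_proj (gpow a) f h
      \<Longrightarrow> pnorm_mu p (gpow a) h \<le> C0 * pnorm_mu p (gpow a) f"
    unfolding szego_bounded_def by blast
  \<comment> \<open>The constant given by boundedness may be negative, while a power of it is taken
    below.\<close>
  define C where "C = max C0 0"
  define \<alpha> where "\<alpha> = a * (2 - p)"
  have al: "\<alpha> > 0" using a p by (simp add: \<alpha>_def)
  \<comment> \<open>b factors |q|^2 are spent against the weight: (|q|^2)^b |1 - z|^\<alpha> stays
    bounded because b \<le> \<alpha>. The rest \<gamma> = p - b must be at most 1 so that the mean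
    of |q|^2 controls it; this is where p - 1 \<le> a (2 - p) enters.\<close>
  define b where "b = min \<alpha> p"
  define \<gamma> where "\<gamma> = p - b"
  have b: "0 < b" "b \<le> \<alpha>" "b \<le> p" "p - 1 \<le> b" using al p by (auto simp: b_def \<alpha>_def)
  have ga: "0 \<le> \<gamma>" "\<gamma> \<le> 1" using b by (auto simp: \<gamma>_def)
  define K where "K = 36 powr b * 2 powr (\<alpha> - b)"
  have K: "K > 0" by (simp add: K_def)
  \<comment> \<open>The factor 4 comes with pi from two equal terms of the upper bound, 2 powr (p -
    1) from the threshold H / 2 in the lower bound; pi cancels.\<close>
  define L where "L = C powr p * (4 * K * 2 powr (p - 1))"
  have L: "L \<ge> 0" using K by (simp add: L_def)
  define H where "H = (\<lambda>N. \<Sum>n<N. 1 / real (n + 1))"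
  have main: "H N powr b \<le> L" if HN: "H N > 0" for N
  proof -
    obtain \<phi> :: "complex \<Rightarrow> complex" and I :: "(nat \<times> nat) set" and d e where I: "finite I"
      and cont: "continuous_on (cball 0 1) \<phi>" and hol: "\<phi> holomorphic_on ball 0 1"
      and phi: "\<phi> 0 = of_real (\<Sum>n<N. 1 / real (n + 1))"
      and dec: "\<forall>z. cmod z = 1 \<longrightarrow> \<phi> z + (\<Sum>i\<in>I. d i * cnj z ^ Suc (e i)) = of_real ((cmod (qpoly N z))\<^sup>2)"
      using qpoly_decomposition[of N] by (elim exE conjE) (rule that)
    have phi0: "\<phi> 0 = of_real (H N)" using phi by (simp only: H_def)
    define U where "U = (\<lambda>z. \<phi> z + (\<Sum>i\<in>I. d i * cnj z ^ Suc (e i)))"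
    define y where "y = (\<lambda>t. (cmod (qpoly N (cis t)))\<^sup>2)"
    have Uy: "U (cis t) = of_real (y t)" for t unfolding U_def y_def by (rule dec[rule_format]) simp
    have conty: "continuous_on {0..2*pi} y"
      unfolding y_def qpoly_def by (intro continuous_intros)
    have iy: "integrable circ_meas y" by (rule circ_meas_integrable_continuous[OF conty])
    have "complex_of_real (LINT t|circ_meas. y t) = (LINT t|circ_meas. U (cis t))"
      unfolding Uy by (rule integral_complex_of_real[symmetric])
    also have "\<dots> = (LINT t|circ_meas. \<phi> (cis t)) + (LINT t|circ_meas. (\<Sum>i\<in>I. d i * cis (- t) ^ Suc (e i)))"
      unfolding U_def cis_cnj
      by (intro Bochner_Integration.integral_add mean_value_circ_meas(1)[OF cont hol] circ_meas_integrable_continuous continuous_intros)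
    also have "(LINT t|circ_meas. (\<Sum>i\<in>I. d i * cis (- t) ^ Suc (e i))) = (\<Sum>i\<in>I. LINT t|circ_meas. d i * cis (- t) ^ Suc (e i))"
      by (intro Bochner_Integration.integral_sum circ_meas_integrable_continuous continuous_intros)
    also have "\<dots> = 0" unfolding integral_mult_right_zero cis_minus_power_integral by simp
    also have "(LINT t|circ_meas. \<phi> (cis t)) + 0 = complex_of_real (2 * pi * H N)"
      unfolding mean_value_circ_meas(2)[OF cont hol] phi0 by simp
    finally have inty: "(LINT t|circ_meas. y t) = 2 * pi * H N" by (simp only: of_real_eq_iff)
    have up: "cmod (U (cis t)) powr p * wt \<alpha> 1 t \<le> K * (H N powr \<gamma> + H N powr (\<gamma> - 1) * y t)" if t: "cis t \<noteq> 1" for t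
    proof -
      define D where "D = cmod (1 - cis t)"
      have D: "0 < D" "D \<le> 2" using t norm_triangle_ineq4[of 1 "cis t"] by (auto simp: D_def)
      have y0: "0 \<le> y t" by (simp add: y_def)
      have yD: "y t \<le> 36 / D" unfolding y_def D_def using t by (intro qpoly_bound) auto
      have "y t powr b * D powr \<alpha> \<le> (36 / D) powr b * D powr \<alpha>"
        using y0 yD b by (intro mult_right_mono powr_mono2) auto
      also have "\<dots> = 36 powr b * D powr (\<alpha> - b)" using D by (simp add: powr_divide powr_diff)
      also have "\<dots> \<le> K" unfolding K_def using D b by (intro mult_left_mono powr_mono2) auto
      finally have 1: "y t powr b * D powr \<alpha> \<le> K" .
      \<comment> \<open>An elementary form of Jensen's inequality for the concave power \<gamma>:
        after integration each summand contributes 2 pi H^\<gamma>, as the mean of y is H.\<close>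
      have 2: "y t powr \<gamma> \<le> H N powr \<gamma> + H N powr (\<gamma> - 1) * y t"
      proof (cases "y t \<le> H N")
        case True
        then have "y t powr \<gamma> \<le> H N powr \<gamma>" using y0 ga by (intro powr_mono2) auto
        then show ?thesis using y0 by (simp add: add_increasing2)
      next
        case False
        then have "y t powr \<gamma> = y t powr (\<gamma> - 1) * y t" using HN by (simp add: powr_diff)
        also have "\<dots> \<le> H N powr (\<gamma> - 1) * y t"
          using False HN ga y0 by (intro mult_right_mono powr_mono2') auto
        finally show ?thesis by (simp add: add_increasing)
      qed
      have "cmod (U (cis t)) powr p * wt \<alpha> 1 t = y t powr (\<gamma> + b) * D powr \<alpha>"
        using y0 by (simp add: Uy wt_def D_def \<gamma>_def)
      also have "\<dots> = (y t powr b * D powr \<alpha>) * y t powr \<gamma>" by (simp add: powr_add)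
      also have "\<dots> \<le> K * (H N powr \<gamma> + H N powr (\<gamma> - 1) * y t)" using 1 2 K by (intro mult_mono) auto
      finally show ?thesis .
    qed
    have "(\<integral>\<^sup>+ t. ennreal (cmod (U (cis t)) powr p * wt \<alpha> 1 t) \<partial>circ_meas)
        \<le> (\<integral>\<^sup>+ t. ennreal (K * (H N powr \<gamma> + H N powr (\<gamma> - 1) * y t)) \<partial>circ_meas)"
      by (rule nn_integral_mono_AE, use AE_circ_meas_cis in eventually_elim) (intro ennreal_leI up)
    also have "\<dots> = ennreal (LINT t|circ_meas. K * (H N powr \<gamma> + H N powr (\<gamma> - 1) * y t))"
      using iy K by (intro nn_integral_eq_integral) (auto simp: y_def)
    also have "(LINT t|circ_meas. K * (H N powr \<gamma> + H N powr (\<gamma> - 1) * y t)) = 4 * pi * K * H N powr \<gamma>"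
    proof -
      have "(LINT t|circ_meas. K * (H N powr \<gamma> + H N powr (\<gamma> - 1) * y t))
          = K * (2 * pi * H N powr \<gamma> + H N powr (\<gamma> - 1) * (2 * pi * H N))"
        using iy by (simp add: inty)
      also have "H N powr (\<gamma> - 1) * (2 * pi * H N) = 2 * pi * H N powr \<gamma>"
        using HN by (simp add: powr_diff)
      finally show ?thesis by (simp add: algebra_simps)
    qed
    finally have IU: "(\<integral>\<^sup>+ t. ennreal (cmod (U (cis t)) powr p * wt \<alpha> 1 t) \<partial>circ_meas) \<le> ennreal (4 * pi * K * H N powr \<gamma>)" .
    have s: "Lp_mu 2 (gpow a) (\<lambda>z. U z / gpow a z)"
      "is_szego_proj (gpow a) (\<lambda>z. U z / gpow a z) (\<lambda>z. \<phi> z / gpow a z)"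
      using szego_proj_of_sum[OF a I cont hol, of d e] unfolding U_def by auto
    have "Lp_mu p (gpow a) (\<lambda>z. U z / gpow a z)"
      using s(1) le_less_trans[OF IU ennreal_less_top] unfolding Lp_mu_def nn_integral_quotient[of U] \<alpha>_def by simp
    then have "pnorm_mu p (gpow a) (\<lambda>z. \<phi> z / gpow a z) \<le> C0 * pnorm_mu p (gpow a) (\<lambda>z. U z / gpow a z)"
      by (rule C0[OF s(1) _ s(2)])
    also have "\<dots> \<le> C * pnorm_mu p (gpow a) (\<lambda>z. U z / gpow a z)"
      by (intro mult_right_mono) (auto simp: C_def pnorm_mu_def)
    finally have pn: "enn2real (\<integral>\<^sup>+ t. ennreal (cmod (\<phi> (cis t)) powr p * wt \<alpha> 1 t) \<partial>circ_meas) powr (1 / p)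
      \<le> C * enn2real (\<integral>\<^sup>+ t. ennreal (cmod (U (cis t)) powr p * wt \<alpha> 1 t) \<partial>circ_meas) powr (1 / p)"
      unfolding pnorm_mu_def nn_integral_quotient[of U] nn_integral_quotient[of \<phi>] \<alpha>_def .
    define Ih where "Ih = (LINT t|circ_meas. cmod (\<phi> (cis t)) powr p * wt \<alpha> 1 t)"
    obtain B where B: "\<And>z. z \<in> cball 0 1 \<Longrightarrow> cmod (\<phi> z) \<le> B"
      using compact_imp_bounded[OF compact_continuous_image[OF cont compact_cball]] unfolding bounded_iff by blast
    have wb: "wt \<alpha> 1 t \<le> 2 powr \<alpha>" for t
      unfolding wt_def using norm_triangle_ineq4[of 1 "cis t"] al by (intro powr_mono2) auto
    have mphi [measurable]: "(\<lambda>t. \<phi> (cis t)) \<in> borel_measurable circ_meas"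
      by (intro measurable_continuous_circ continuous_boundary cont)
    have ih: "integrable circ_meas (\<lambda>t. cmod (\<phi> (cis t)) powr p * wt \<alpha> 1 t)"
    proof (rule circ.integrable_const_bound[of _ "B powr p * 2 powr \<alpha>"])
      show "AE t in circ_meas. norm (cmod (\<phi> (cis t)) powr p * wt \<alpha> 1 t) \<le> B powr p * 2 powr \<alpha>"
        using B wb p by (intro AE_I2) (auto intro!: mult_mono powr_mono2)
    qed measurable
    have Ih0: "0 \<le> Ih" unfolding Ih_def by (intro Bochner_Integration.integral_nonneg) auto
    have "(\<integral>\<^sup>+ t. ennreal (cmod (\<phi> (cis t)) powr p * wt \<alpha> 1 t) \<partial>circ_meas) = ennreal Ih"
      unfolding Ih_def by (intro nn_integral_eq_integral ih) auto
    moreover have "enn2real (\<integral>\<^sup>+ t. ennreal (cmod (U (cis t)) powr p * wt \<alpha> 1 t) \<partial>circ_meas) \<le> 4 * pi * K * H N powr \<gamma>"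
      using enn2real_mono[OF IU] K by simp
    then have "C * enn2real (\<integral>\<^sup>+ t. ennreal (cmod (U (cis t)) powr p * wt \<alpha> 1 t) \<partial>circ_meas) powr (1 / p)
      \<le> C * (4 * pi * K * H N powr \<gamma>) powr (1 / p)"
      using p by (intro mult_left_mono powr_mono2) (auto simp: C_def)
    ultimately have "Ih powr (1 / p) \<le> C * (4 * pi * K * H N powr \<gamma>) powr (1 / p)"
      using pn Ih0 by simp
    then have "(Ih powr (1 / p)) powr p \<le> (C * (4 * pi * K * H N powr \<gamma>) powr (1 / p)) powr p"
      using p by (intro powr_mono2) auto
    then have upper: "Ih \<le> C powr p * (4 * pi * K * H N powr \<gamma>)"
      using p Ih0 K by (simp add: powr_mult powr_powr C_def)
    \<comment> \<open>Values below half the mean can account for at most half of the integral, so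
      the remaining half bounds the p-th power from below.\<close>
    define s where "s = H N / 2"
    have s0: "s > 0" using HN by (simp add: s_def)
    \<comment> \<open>This multiplier has value 1 at 0 and modulus wt^(1/p) on the circle. The mean
      value property thus turns \<phi> 0 = H into a lower bound for the weighted L^p integral of
      \<phi>.\<close>
    have contp: "continuous_on (cball 0 1) (\<lambda>z. \<phi> z * gpow (\<alpha> / p) z)"
      using al p by (intro continuous_intros cont gpow_continuous) auto
    have holp: "(\<lambda>z. \<phi> z * gpow (\<alpha> / p) z) holomorphic_on ball 0 1"
      by (intro holomorphic_intros hol gpow_holomorphic)
    have "complex_of_real (2 * pi * H N) = (LINT t|circ_meas. \<phi> (cis t) * gpow (\<alpha> / p) (cis t))"
      unfolding mean_value_circ_meas(2)[OF contp holp] phi0 by (simp add: gpow_def)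
    then have "cmod (complex_of_real (2 * pi * H N)) \<le> (LINT t|circ_meas. cmod (\<phi> (cis t) * gpow (\<alpha> / p) (cis t)))"
      by (simp only: integral_norm_bound)
    then have "2 * pi * H N \<le> (LINT t|circ_meas. cmod (\<phi> (cis t) * gpow (\<alpha> / p) (cis t)))"
      using HN by (simp only: norm_of_real)
    also have "\<dots> \<le> (LINT t|circ_meas. s + s powr (1 - p) * (cmod (\<phi> (cis t)) powr p * wt \<alpha> 1 t))"
    proof (rule integral_mono)
      show "integrable circ_meas (\<lambda>t. cmod (\<phi> (cis t) * gpow (\<alpha> / p) (cis t)))"
        by (intro integrable_norm mean_value_circ_meas(1)[OF contp holp])
      show "integrable circ_meas (\<lambda>t. s + s powr (1 - p) * (cmod (\<phi> (cis t)) powr p * wt \<alpha> 1 t))"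
        using ih by simp
      fix t
      define x where "x = cmod (\<phi> (cis t) * gpow (\<alpha> / p) (cis t))"
      have xp: "x powr p = cmod (\<phi> (cis t)) powr p * wt \<alpha> 1 t"
        using p by (simp add: x_def norm_mult cmod_gpow powr_mult powr_powr wt_def)
      have "x \<le> s + s powr (1 - p) * x powr p"
      proof (cases "x \<le> s")
        case False
        then have "x = x powr (1 - p) * x powr p" using s0 by (simp flip: powr_add)
        also have "\<dots> \<le> s powr (1 - p) * x powr p"
          using False s0 p by (intro mult_right_mono powr_mono2') auto
        finally show ?thesis using s0 by simp
      qed (simp add: add_increasing2)
      then show "x \<le> s + s powr (1 - p) * (cmod (\<phi> (cis t)) powr p * wt \<alpha> 1 t)" unfolding xp .
    qed
    also have "\<dots> = 2 * pi * s + s powr (1 - p) * Ih"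
      using ih by (simp add: Ih_def)
    finally have "pi * H N \<le> s powr (1 - p) * Ih" by (simp add: s_def)
    then have "pi * H N * s powr (p - 1) \<le> (s powr (1 - p) * Ih) * s powr (p - 1)"
      by (intro mult_right_mono) auto
    also have "\<dots> = Ih * (s powr (1 - p) * s powr (p - 1))" by simp
    also have "s powr (1 - p) * s powr (p - 1) = 1" using s0 by (simp flip: powr_add)
    finally have lower: "pi * H N * s powr (p - 1) \<le> Ih" by simp
    have "H N * s powr (p - 1) * 2 powr (p - 1) = H N powr p"
      using HN by (simp add: s_def powr_divide powr_diff)
    then have "pi * H N powr p = (pi * H N * s powr (p - 1)) * 2 powr (p - 1)" by (simp add: mult.assoc)
    also have "\<dots> \<le> C powr p * (4 * pi * K * H N powr \<gamma>) * 2 powr (p - 1)"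
      by (rule mult_right_mono[OF order_trans[OF lower upper]]) simp
    also have "\<dots> = pi * (L * H N powr \<gamma>)" by (simp add: L_def)
    finally have "H N powr p \<le> L * H N powr \<gamma>" by simp
    moreover have "H N powr p = H N powr b * H N powr \<gamma>" by (simp add: \<gamma>_def flip: powr_add)
    ultimately show ?thesis using HN by simp
  qed
  have Hharm: "H N = harm N" for N
    unfolding H_def harm_def by (simp add: sum.atLeast1_atMost_eq divide_inverse)
  have "eventually (\<lambda>N. harm N > (L + 1) powr (1 / b)) sequentially"
    using harm_at_top by (simp add: filterlim_at_top_dense)
  then obtain N where N: "H N > (L + 1) powr (1 / b)" unfolding Hharm by (auto simp: eventually_sequentially)
  then have HN: "H N > 0" using L by (auto intro: less_trans[of 0 "(L + 1) powr (1 / b)"])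
  have "L + 1 = ((L + 1) powr (1 / b)) powr b" using L b by (simp add: powr_powr)
  also have "\<dots> \<le> H N powr b" using N b by (intro powr_mono2) auto
  finally show False using main[OF HN] by simp
qed

section \<open>Matching the ranges of exponents\<close>

theorem theorem1:
  fixes p0 q0 :: real
  assumes "p0 > 2" and "1 / q0 + 1 / p0 = 1"
  shows "\<exists>g :: complex \<Rightarrow> complex.
           g holomorphic_on ball 0 1 \<and> continuous_on (cball 0 1) g \<and>
           (\<forall>z \<in> ball 0 1. g z \<noteq> 0) \<and>
           (\<forall>p::real. 1 \<le> p \<longrightarrow> (szego_bounded p g \<longleftrightarrow> q0 < p \<and> p < p0))"
proof -
  define a where "a = 1 / (p0 - 2)"
  have a: "a > 0" using assms(1) by (simp add: a_def)
  have p0: "p0 = 2 + 1 / a" using assms(1) by (simp add: a_def)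
  have "1 / q0 = (p0 - 1) / p0" using assms by (simp add: diff_divide_distrib)
  then have "1 / (1 / q0) = 1 / ((p0 - 1) / p0)" by (simp only:)
  then have "q0 = p0 / (p0 - 1)" by simp
  moreover have "p0 = (2 * a + 1) / a" "p0 - 1 = (a + 1) / a" using a by (simp_all add: p0 field_simps)
  ultimately have q0: "q0 = (2 * a + 1) / (a + 1)" using a by simp
  have "szego_bounded p (gpow a) \<longleftrightarrow> q0 < p \<and> p < p0" if p: "1 \<le> p" for p
  proof (cases "p \<ge> 2")
    case True
    have "q0 < 2" using a by (simp add: q0 field_simps)
    \<comment> \<open>The condition -1 < \<alpha>.\<close>
    moreover have "p < p0 \<longleftrightarrow> a * (p - 2) < 1" using a by (simp add: p0 field_simps)
    moreover have "p > 2" if "1 \<le> a * (p - 2)" using True that by (cases "p = 2") auto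
    ultimately show ?thesis
      using True szego_bounded_ge_2[OF a True] not_szego_bounded_ge[OF a, of p] by (auto simp: not_less[symmetric])
  next
    case False
    \<comment> \<open>The condition \<alpha> < p - 1.\<close>
    have "q0 < p \<longleftrightarrow> a * (2 - p) < p - 1" using a by (simp add: q0 field_simps)
    moreover have "p > 1" if "a * (2 - p) < p - 1"
    proof -
      have "0 < a * (2 - p)" using a False by simp
      with that show ?thesis by simp
    qed
    ultimately show ?thesis
      using False p assms(1) szego_bounded_lt_2[OF a, of p] not_szego_bounded_le[OF a p] by auto
  qed
  moreover have "\<forall>z \<in> ball 0 1. gpow a z \<noteq> 0" by (auto intro!: gpow_nonzero)
  ultimately show ?thesis
    using gpow_holomorphic gpow_continuous[OF a] by blast
qed

end
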